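(* Let $p$ be a complex polynomial of degree $n\ge 2$ with all its zeros in the closed unit disk $\{z\in\mathbb C: |z|\le 1\}$, and let $\zeta_1,\ldots,\zeta_{n-1}$ be its critical points (the zeros of $p'$), counted with multiplicity. Then at every zero $a$ of $p$, $$\sum_{j=1}^{n-1}\frac{1}{|a-\zeta_j|^2}\ge n-1 .$$ Equality holds (at the zero $a$) if and only if $p(z)=c(z^n-\omega)$ for some $c\in\mathbb C\setminus\{0\}$ and $\omega\in\mathbb C$ with $|\omega|=1$.
   Context: A term with zero denominator in a reciprocal-distance sum is interpreted as $+\infty$ (so if $a$ is itself a critical point, the sum is $+\infty$ and the inequality is strict). *)

theory Defs
  imports
    "HOL-Library.Extended_Nonnegative_Real"
    "HOL-Computational_Algebra.Computational_Algebra"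
begin

(* The summands are divided in ennreal, where 1 / 0 = \<infinity>: if a is itself a critical
   point of p, the sum is \<infinity>.  (In the reals, 1 / 0 would be 0.) *)
definition recip_dist_sq_sum :: "complex poly \<Rightarrow> complex \<Rightarrow> ennreal" where
  "recip_dist_sq_sum p a = (\<Sum>\<zeta>\<in>#proots (pderiv p). 1 / ennreal ((cmod (a - \<zeta>))\<^sup>2))"

lemma recip_dist_sq_sum_eq_top:
  assumes "\<zeta> \<in># proots (pderiv p)"
  shows "recip_dist_sq_sum p \<zeta> = \<infinity>"
proof -
  from assms obtain M where "proots (pderiv p) = add_mset \<zeta> M"
    by (metis insert_DiffM)
  then show ?thesis
    by (simp add: recip_dist_sq_sum_def)
qed

end

theory Submission
  imports Defs "HOL-Analysis.Analysis"
begin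

text \<open>
  Put \<open>m = n - 1\<close>, \<open>v\<^sub>j = 1 / (a - \<zeta>\<^sub>j)\<close> and
  \<open>q(z) = p(z) / ((z - a) p'(a))\<close>, which is the integral of \<open>\<Prod>\<^sub>j (1 + t (z - a) v\<^sub>j)\<close> over
  \<open>t \<in> [0, 1]\<close>.

  If \<open>|a| = 1\<close>, then \<open>Re (a / (a - z)) \<ge> 1/2\<close> for the zeros \<open>z\<close> of \<open>q\<close>. Since \<open>\<Sum> v\<^sub>j = p''(a) / p'(a)\<close>
  is twice the sum of the \<open>1 / (a - z)\<close>, this gives \<open>Re (a \<Sum> v\<^sub>j) \<ge> m\<close>, and
  \<open>\<Sum> |1 - a v\<^sub>j|\<^sup>2 \<ge> 0\<close> concludes, with equality only if all \<open>\<zeta>\<^sub>j\<close> vanish.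

  If \<open>|a| < 1\<close>, the inequality is strict. Suppose \<open>\<Sum> |v\<^sub>j|\<^sup>2 \<le> m\<close>. As \<open>q\<close> has all zeros in the closed
  disk, \<open>|q(b)| \<le> |b|\<^sup>m |q(1 / cnj b)|\<close> for \<open>|b| \<le> 1\<close>, and AM-GM bounds the right-hand side by an
  integral that depends only on \<open>a\<close> and on the mean \<open>\<mu>\<close> of the \<open>v\<^sub>j\<close>. At \<open>b = a\<close> the left-hand side
  is 1, which forces \<open>|\<mu>|\<close> and \<open>1 - |a|\<^sup>2\<close> to be large. At \<open>b = a - cnj \<mu>\<close> the left-hand side is the
  integral of a product of factors \<open>1 - t cnj \<mu> v\<^sub>j\<close> with real mean and small variance, so a
  differential equation bounds it from below; the two bounds are incompatible. The cases
  \<open>m \<le> 4\<close> are already excluded by \<open>b = a\<close>, the cases \<open>m \<le> 10\<close> need explicit polynomial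
  inequalities, and the remaining ones exponential estimates.
\<close>

section \<open>Products and integrals of products\<close>

text \<open>If all \<open>v j\<close> equal \<open>\<mu>\<close> and \<open>|\<mu>| = 1\<close>,
  then \<open>1 / \<mu> = cnj \<mu>\<close>, so all critical points sit at
  \<open>a - cnj \<mu>\<close>: this is the origin of the second test point. In that limit
  \<open>(m + 1) |q(b)|\<close> is exactly 1. With \<open>C = |\<mu>|^2\<close>, both estimates of
  \<open>|q(b)|\<close> are perturbations of this value in \<open>\<theta> = 1 - C\<close>, and the
  contradiction comes from comparing the terms with a factor \<open>\<theta>\<close>. The test point
  \<open>b = a\<close> cannot suffice for \<open>m \<ge> 5\<close>: for \<open>C = 1\<close>,
  \<open>|a| = 9/10\<close> and \<open>a \<mu> > 0\<close> its AM-GM bound exceeds 1. It serves to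
  confine the parameters: \<open>C\<close> cannot be small, and \<open>x = 1 - |a|^2\<close> cannot
  be small compared with \<open>1 - C + R\<close>, where \<open>R = |a - cnj \<mu>|^2\<close>. For
  small \<open>m\<close> this gives \<open>x > 1 - C + R\<close>; for large \<open>m\<close> only a
  fraction \<open>\<eta>\<close> of the right-hand side is available, and the upper estimate of
  \<open>|q(b)|\<close> pays for it with a term in \<open>1 - \<eta>\<close>. The margins are narrow
  for moderate \<open>m\<close>, hence the many explicit rationals.\<close>

lemma prod_le_mean_power:
  fixes x :: "'a \<Rightarrow> real"
  assumes "finite S" "S \<noteq> {}" "\<And>i. i \<in> S \<Longrightarrow> 0 \<le> x i"
  shows "(\<Prod>i\<in>S. x i) \<le> ((\<Sum>i\<in>S. x i) / card S) ^ card S"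
proof -
  let ?n = "card S"
  have n: "?n > 0" using assms by (simp add: card_gt_0_iff)
  have P: "0 \<le> (\<Prod>i\<in>S. x i)" using assms by (simp add: prod_nonneg)
  have "(\<Prod>i\<in>S. x i) powr (1 / ?n) \<le> (\<Sum>i\<in>S. x i) / ?n"
    using arith_geom_mean[OF assms(1,2), of x] assms(3) by (simp add: sum_divide_distrib)
  then have "((\<Prod>i\<in>S. x i) powr (1 / ?n)) ^ ?n \<le> ((\<Sum>i\<in>S. x i) / ?n) ^ ?n"
    by (intro power_mono) auto
  moreover have "((\<Prod>i\<in>S. x i) powr (1 / ?n)) ^ ?n = (\<Prod>i\<in>S. x i)"
    using n P by (cases "(\<Prod>i\<in>S. x i) = 0") (auto simp: powr_powr simp flip: powr_realpow)
  ultimately show ?thesis by simp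
qed

lemma prod_norm_le_mean_square:
  fixes f :: "'a \<Rightarrow> complex"
  assumes "finite S" "S \<noteq> {}"
  shows "(\<Prod>i\<in>S. cmod (f i))
      \<le> ((\<Sum>i\<in>S. (cmod (f i))\<^sup>2) / card S) powr (card S / 2)"
proof -
  let ?M = "(\<Sum>i\<in>S. (cmod (f i))\<^sup>2) / card S"
  have M: "0 \<le> ?M" by (simp add: sum_nonneg)
  have n: "card S > 0" using assms by (simp add: card_gt_0_iff)
  have "(\<Prod>i\<in>S. cmod (f i))\<^sup>2 \<le> ?M ^ card S"
    using prod_le_mean_power[OF assms, of "\<lambda>i. (cmod (f i))\<^sup>2"] by (simp add: prod_power_distrib)
  then have "(\<Prod>i\<in>S. cmod (f i)) \<le> sqrt (?M ^ card S)"
    using real_le_rsqrt by blast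
  also have "sqrt (?M ^ card S) = ?M powr (card S / 2)"
  proof (cases "?M = 0")
    case True
    then show ?thesis using n by simp
  next
    case False
    then have "?M > 0" using M by linarith
    then show ?thesis by (simp add: powr_half_sqrt [symmetric] powr_powr flip: powr_realpow)
  qed
  finally show ?thesis .
qed

text \<open>Concavity, derived from the tangent at 1 of the convex inverse power
  \<open>1 / r\<close>. It serves to raise the exponent \<open>m / 2\<close> to a more convenient
  one under the integral.\<close>

lemma powr_le_affine:
  fixes y r :: real
  assumes "0 \<le> y" "0 < r" "r \<le> 1"
  shows "y powr r \<le> 1 + r * (y - 1)"
proof (cases "y = 0")
  case True
  then show ?thesis using assms by simp
next
  case False
  then have y: "y > 0" using assms by simp
  have "(y powr r) powr (1 / r) \<ge> 1 + (1 / r) * (y powr r - 1)"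
  proof (cases "r = 1")
    case False
    define z where "z = y powr r"
    have z: "z > 0" using y by (simp add: z_def)
    have "z powr (1/r) \<ge> z powr (1/r) + 0" by simp
    have c: "convex_on {0<..} (\<lambda>x. x powr (1/r))" using powr_convex[of "1/r"] assms by simp
    have d: "((\<lambda>x. x powr (1/r)) has_real_derivative 1/r) (at 1)"
      by (auto intro!: derivative_eq_intros)
    have "(1/r) * (z - 1) \<le> z powr (1/r) - 1 powr (1/r)"
      using convex_on_imp_above_tangent[OF c _ _ _ has_field_derivative_at_within[OF d], of z] z
      by (auto simp: connected_Ioi interior_open)
    then show ?thesis by (simp add: z_def)
  qed auto
  moreover have "(y powr r) powr (1 / r) = y" using y assms by (simp add: powr_powr)
  ultimately have "1 + (1 / r) * (y powr r - 1) \<le> y" by simp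
  then have "r * (1 + (1 / r) * (y powr r - 1)) \<le> r * y"
    using assms by (intro mult_left_mono) auto
  then show ?thesis using assms by (simp add: algebra_simps)
qed

lemma norm_of_real_convex_comb_le:
  assumes "0 \<le> t" "t \<le> (1::real)"
  shows "cmod (of_real (1 - t) + of_real t * g) \<le> 1 - t + t * cmod g"
  using norm_triangle_ineq[of "of_real (1 - t)" "of_real t * g"] assms
  by (simp add: norm_mult del: of_real_diff)

section \<open>Lower bound for the integral of a product of factors with real mean\<close>

lemma product_mean_lower_bound:
  fixes g :: "nat \<Rightarrow> complex" and m :: nat and \<theta> D :: real
  assumes m: "m \<ge> 3" and \<theta>: "0 < \<theta>" "\<theta> < 1"
    and sum_g: "(\<Sum>j<m. g j) = of_real (m * \<theta>)"
    and sum_sq: "(\<Sum>j<m. (cmod (g j))\<^sup>2) \<le> m * \<theta>"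
    and D: "D = 1 - sqrt (m * \<theta> / (m - 1))"
  shows "1 - \<theta> ^ (m + 1) - m * \<theta> * (1 - \<theta>) * integral {0..1} (\<lambda>t. t * (1
      + t / (m - 1)) * (1 - t * D) ^ (m - 3))
    \<le> (m + 1) * (1 - \<theta>) * cmod (integral {0..1} (\<lambda>t. \<Prod>j<m. of_real (1 - t) + of_real t * g j))"
proof -
  txt \<open>For \<open>P(z) = \<Prod>\<^sub>j (1 - z + z g\<^sub>j)\<close> and \<open>d\<^sub>j = g\<^sub>j - \<theta>\<close> one has \<open>\<tau> P' = W - m C P\<close>, where \<open>W\<close> is of second
    order in the \<open>d\<^sub>j\<close> because they sum to 0; with the integrating factor \<open>\<kappa>\<close> this
    compares the integral of \<open>P\<close> with that of \<open>\<tau>\<^sup>m\<close>.\<close>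
  define C where "C = 1 - \<theta>"
  have C: "0 < C" "C < 1" using \<theta> by (auto simp: C_def)
  define d where "d j = g j - of_real \<theta>" for j
  define zf where "zf j z = 1 - z + z * g j" for j and z :: complex
  define P where "P z = (\<Prod>j<m. zf j z)" for z
  define Pr where "Pr j z = (\<Prod>i\<in>{..<m}-{j}. zf i z)" for j z
  define \<tau> where "\<tau> z = 1 - z * of_real C" for z :: complex
  define W where "W z = (\<Sum>j<m. d j * Pr j z)" for z
  have sum_d: "(\<Sum>j<m. d j) = 0"
    by (simp add: d_def sum_subtractf sum_g)
  have zf_d: "zf j z = \<tau> z + z * d j" for j z
    by (simp add: zf_def \<tau>_def d_def C_def algebra_simps)
  have zf_Pr: "zf j z * Pr j z = P z" if "j < m" for j z
    unfolding P_def Pr_def using that by (subst (2) prod.remove[of _ j]) auto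
  \<comment> \<open>Substituting \<open>\<tau> z = zf j z - z * d j\<close> turns the first-order
    part into multiples \<open>d j * P z\<close> of one and the same product, so it cancels.\<close>
  have tW: "\<tau> z * W z = - z * (\<Sum>j<m. (d j)\<^sup>2 * Pr j z)" for z
  proof -
    have "\<tau> z * W z = (\<Sum>j<m. d j * (zf j z * Pr j z) - z * ((d j)\<^sup>2 * Pr j z))"
      unfolding W_def sum_distrib_left
      by (intro sum.cong refl) (simp add: zf_d algebra_simps power2_eq_square)
    also have "\<dots> = (\<Sum>j<m. d j * P z) - z * (\<Sum>j<m. (d j)\<^sup>2 * Pr j z)"
      by (simp add: sum_subtractf zf_Pr sum_distrib_left)
    also have "(\<Sum>j<m. d j * P z) = 0"
      by (simp add: sum_d flip: sum_distrib_right)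
    finally show ?thesis by simp
  qed
  define P' where "P' z = (\<Sum>j<m. (g j - 1) * Pr j z)" for z
  have dP: "(P has_field_derivative P' z) (at z)" for z
    unfolding P_def P'_def Pr_def zf_def
    by (rule derivative_eq_intros has_field_derivative_prod refl | simp)+
  have P': "\<tau> z * P' z = W z - m * of_real C * P z" for z
  proof -
    have 1: "P' z = W z - of_real C * (\<Sum>j<m. Pr j z)"
      by (simp add: P'_def W_def d_def C_def algebra_simps sum_subtractf sum_distrib_left sum.distrib)
    have "\<tau> z * (\<Sum>j<m. Pr j z) = (\<Sum>j<m. zf j z * Pr j z - z * (d j * Pr j z))"
      unfolding sum_distrib_left by (intro sum.cong refl) (simp add: zf_d algebra_simps)
    also have "\<dots> = m * P z - z * W z"
      by (simp add: sum_subtractf zf_Pr W_def sum_distrib_left)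
    finally have 2: "\<tau> z * (\<Sum>j<m. Pr j z) = m * P z - z * W z" .
    have "\<tau> z * P' z = \<tau> z * W z - of_real C * (\<tau> z * (\<Sum>j<m. Pr j z))"
      by (simp add: 1 algebra_simps)
    also have "\<dots> = (\<tau> z + of_real C * z) * W z - m * of_real C * P z"
      by (simp add: 2 algebra_simps)
    finally show ?thesis by (simp add: \<tau>_def algebra_simps)
  qed
  have \<tau>r: "\<tau> (of_real t) = of_real (1 - t * C)" for t by (simp add: \<tau>_def)
  have \<tau>pos: "1 - t * C \<ge> \<theta>" if "0 \<le> t" "t \<le> 1" for t
  proof -
    have "t * C \<le> 1 * C" using that C by (intro mult_right_mono) auto
    then show ?thesis by (simp add: C_def)
  qed
  have \<tau>0: "\<tau> (of_real t) \<noteq> 0" if "0 \<le> t" "t \<le> 1" for t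
    using \<tau>pos[OF that] \<theta> unfolding \<tau>r of_real_eq_0_iff by linarith
  \<comment> \<open>Here \<open>(\<tau> P)' = W - (m + 1) C P\<close> and
    \<open>(P / \<tau>^m)' = W / \<tau>^(m + 1)\<close>. As \<open>\<tau> 1 = \<theta>\<close>, the
    subtracted multiple makes \<open>K 1\<close> vanish: the unknown value \<open>P 1\<close>
    disappears, while \<open>W\<close> only acquires a weight \<open>\<kappa>\<close> between 0 and
    1.\<close>
  define K where "K z = \<tau> z * P z - of_real \<theta> ^ (m+1) * (P z / \<tau> z ^ m)" for z
  define \<kappa> where "\<kappa> t = 1 - (\<theta> / (1 - t * C)) ^ (m+1)" for t
  have dK: "((\<lambda>t. K (of_real t)) has_vector_derivative
      (W (of_real t) * of_real (\<kappa> t) - (m+1) * of_real C * P (of_real t))) (at t within {0..1})"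
    if t: "0 \<le> t" "t \<le> 1" for t
  proof -
    let ?z = "of_real t :: complex"
    have n0: "\<tau> ?z \<noteq> 0" using \<tau>0[OF t] .
    have dt: "(\<tau> has_field_derivative - of_real C) (at ?z)"
      unfolding \<tau>_def by (auto intro!: derivative_eq_intros)
    have Wz: "W ?z = P' ?z * \<tau> ?z + m * of_real C * P ?z"
      unfolding mult.commute[of "P' ?z"] P'[of ?z] by simp
    obtain k where k: "m = Suc k" using m by (cases m) auto
    have q: "(P' ?z * \<tau> ?z ^ m - P ?z * (m * \<tau> ?z ^ (m-1) * - of_real C)) / (\<tau> ?z ^ m * \<tau> ?z ^ m)
        = W ?z / \<tau> ?z ^ (m+1)"
      using n0 by (simp add: Wz k field_simps)
    have r: "- of_real C * P ?z + \<tau> ?z * P' ?z = W ?z - (m+1) * of_real C * P ?z"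
      unfolding P' by (simp add: algebra_simps)
    have s: "of_real \<theta> ^ (m+1) * (W ?z / \<tau> ?z ^ (m+1))
        = W ?z * of_real ((\<theta> / (1 - t * C)) ^ (m+1))"
      by (simp add: \<tau>r power_divide)
    have "(K has_field_derivative (- of_real C * P ?z + \<tau> ?z * P' ?z)
        - of_real \<theta> ^ (m+1) * ((P' ?z * \<tau> ?z ^ m - P ?z * (m * \<tau> ?z ^ (m-1) * - of_real C)) / (\<tau> ?z ^ m * \<tau> ?z ^ m))) (at ?z)"
      unfolding K_def
      by (rule derivative_eq_intros dP dt refl | use n0 in simp)+
    then have "(K has_field_derivative (W ?z - (m+1) * of_real C * P ?z
        - W ?z * of_real ((\<theta> / (1 - t * C)) ^ (m+1)))) (at ?z)" by (simp only: q r s)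
    then have "(K has_field_derivative (W ?z * of_real (\<kappa> t) - (m+1) * of_real C * P ?z)) (at ?z)"
      by (simp add: \<kappa>_def algebra_simps)
    then show ?thesis by (rule has_vector_derivative_real_field)
  qed
  have K1: "K 1 = 0"
  proof -
    have "\<tau> 1 = of_real \<theta>" by (simp add: \<tau>_def C_def)
    then show ?thesis using \<theta> by (simp add: K_def field_simps)
  qed
  have K0: "K 0 = 1 - of_real \<theta> ^ (m+1)"
    by (simp add: K_def \<tau>_def P_def zf_def)
  have "((\<lambda>t. W (of_real t) * of_real (\<kappa> t) - (m+1) * of_real C * P (of_real t)) has_integral
      (K (of_real 1) - K (of_real 0))) {0..1}"
    by (rule fundamental_theorem_of_calculus) (use dK in auto)
  then have hi: "((\<lambda>t. W (of_real t) * of_real (\<kappa> t) - (m+1) * of_real C * P (of_real t)) has_integral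
      (of_real \<theta> ^ (m+1) - 1)) {0..1}" by (simp add: K0 K1)
  have contPr: "continuous_on A (Pr j)" "continuous_on A P" "continuous_on A W" for A j
    unfolding Pr_def P_def W_def zf_def by (intro continuous_intros)+
  have cr: "continuous_on A (\<lambda>t. F (of_real t :: complex))" if "continuous_on UNIV F" for F :: "complex \<Rightarrow> complex" and A :: "real set"
    by (rule continuous_on_compose2[OF that]) (auto intro!: continuous_intros)
  have intP: "(\<lambda>t. P (of_real t)) integrable_on {0..1}"
    by (intro integrable_continuous_real cr contPr)
  have cont\<kappa>: "continuous_on {0..1} \<kappa>"
    unfolding \<kappa>_def using \<tau>pos \<theta> by (intro continuous_intros) force
  have intW: "(\<lambda>t. W (of_real t) * of_real (\<kappa> t)) integrable_on {0..1}"
    by (intro integrable_continuous_real continuous_intros cr contPr cont\<kappa>)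
  have eq: "integral {0..1} (\<lambda>t. W (of_real t) * of_real (\<kappa> t)) - (m+1) * of_real C * integral {0..1} (\<lambda>t. P (of_real t))
      = of_real \<theta> ^ (m+1) - 1"
    using hi integral_unique[OF hi] intP intW
    by (subst (asm) integral_diff) (auto intro!: integrable_on_mult_right)
  define h where "h t = t * (1 + t / (m - 1)) * (1 - t * D) ^ (m - 3)" for t
  have bound: "cmod (W (of_real t) * of_real (\<kappa> t))
      \<le> m * \<theta> * C * h t" if t: "t \<in> {0..1}" for t
  proof -
    have t0: "0 \<le> t" "t \<le> 1" using t by auto
    let ?z = "of_real t :: complex"
    let ?\<beta> = "sqrt (m * \<theta> / (m - 1))"
    have tp: "1 - t * C > 0" using \<tau>pos[OF t0] \<theta> by linarith
    have oD: "1 - t * D = 1 - t + t * ?\<beta>" by (simp add: D algebra_simps)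
    have oD0: "0 \<le> 1 - t * D" using t0 \<theta> by (simp add: oD)
    have \<kappa>b: "\<bar>\<kappa> t\<bar> \<le> 1"
    proof -
      have "0 \<le> \<theta> / (1 - t * C)" "\<theta> / (1 - t * C)
          \<le> 1" using \<tau>pos[OF t0] \<theta> tp by auto
      then have "0 \<le> (\<theta> / (1 - t * C)) ^ (m+1)" "(\<theta> / (1 - t * C)) ^ (m+1) \<le> 1"
        by (auto intro: power_le_one simp del: power_Suc)
      then show ?thesis by (simp add: \<kappa>_def)
    qed
    \<comment> \<open>AM-GM, then Cauchy-Schwarz over the \<open>m - 1\<close> indices other than
      \<open>j\<close>. The full sum of squares \<open>m * \<theta>\<close> is kept for these
      indices, which is why \<open>D\<close> contains \<open>m * \<theta> / (m - 1)\<close>.\<close>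
    have Prb: "cmod (Pr j ?z) \<le> (1 - t * D) ^ (m - 1)" if j: "j < m" for j
    proof -
      let ?S = "{..<m} - {j}"
      have cS: "card ?S = m - 1" "finite ?S" "?S \<noteq> {}"
      proof -
        show "card ?S = m - 1" "finite ?S" using j by auto
        then show "?S \<noteq> {}" using m by force
      qed
      have "cmod (Pr j ?z) = (\<Prod>i\<in>?S. cmod (zf i ?z))" by (simp add: Pr_def prod_norm)
      also have "\<dots> \<le> (\<Prod>i\<in>?S. 1 - t + t * cmod (g i))"
        using norm_of_real_convex_comb_le[OF t0] by (intro prod_mono) (auto simp: zf_def)
      also have "\<dots> \<le> ((\<Sum>i\<in>?S. 1 - t + t * cmod (g i)) / card ?S) ^ card ?S"
        using t0 cS by (intro prod_le_mean_power) auto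
      also have "(\<Sum>i\<in>?S. 1 - t + t * cmod (g i)) / card ?S = 1 - t
          + t * ((\<Sum>i\<in>?S. cmod (g i)) / (m-1))"
      proof -
        have "(\<Sum>i\<in>?S. 1 - t + t * cmod (g i)) = card ?S * (1 - t)
            + t * (\<Sum>i\<in>?S. cmod (g i))"
          by (simp only: sum.distrib sum_constant sum_distrib_left)
        moreover have "real (m - 1) > 0" using m by simp
        ultimately show ?thesis unfolding cS(1) by (simp only: add_divide_distrib) simp
      qed
      also have "(\<dots>) ^ card ?S \<le> (1 - t + t * ?\<beta>) ^ card ?S"
      proof (intro power_mono add_left_mono mult_left_mono)
        have "(\<Sum>i\<in>?S. cmod (g i))\<^sup>2 \<le> card ?S * (\<Sum>i\<in>?S. (cmod (g i))\<^sup>2)"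
          using Cauchy_Schwarz_ineq_sum[of "\<lambda>_. 1" "\<lambda>i. cmod (g i)" ?S] by simp
        also have "\<dots> \<le> (m - 1) * (m * \<theta>)"
        proof -
          have "(\<Sum>i\<in>?S. (cmod (g i))\<^sup>2) \<le> m * \<theta>"
            using sum_mono2[of "{..<m}" ?S "\<lambda>i. (cmod (g i))\<^sup>2"] sum_sq by fastforce
          then show ?thesis unfolding cS(1) by (intro mult_left_mono) auto
        qed
        finally have "(\<Sum>i\<in>?S. cmod (g i))\<^sup>2 / (real (m - 1))\<^sup>2
            \<le> (m - 1) * (m * \<theta>) / (real (m - 1))\<^sup>2"
          by (intro divide_right_mono) auto
        then have "((\<Sum>i\<in>?S. cmod (g i)) / (m - 1))\<^sup>2 \<le> m * \<theta> / (m - 1)"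
          using m by (simp add: power_divide power2_eq_square split: if_splits)
        then show "(\<Sum>i\<in>?S. cmod (g i)) / (m - 1) \<le> ?\<beta>" by (rule real_le_rsqrt)
      qed (use t0 in \<open>auto intro!: add_nonneg_nonneg mult_nonneg_nonneg divide_nonneg_nonneg sum_nonneg\<close>)
      finally show ?thesis using cS by (simp add: oD)
    qed
    have sumd: "(\<Sum>j<m. (cmod (d j))\<^sup>2) \<le> m * \<theta> * C"
    proof -
      have "(cmod (d j))\<^sup>2 = (cmod (g j))\<^sup>2 - 2 * \<theta> * Re (g j) + \<theta>\<^sup>2" for j
        by (simp add: d_def cmod_power2 power2_diff algebra_simps)
      then have "(\<Sum>j<m. (cmod (d j))\<^sup>2)
          = (\<Sum>j<m. (cmod (g j))\<^sup>2) - 2 * \<theta> * Re (\<Sum>j<m. g j) + m * \<theta>\<^sup>2"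
        by (simp add: sum.distrib sum_subtractf sum_distrib_left)
      also have "\<dots> \<le> m * \<theta> * C"
        using sum_sq by (simp add: sum_g C_def algebra_simps power2_eq_square)
      finally show ?thesis .
    qed
    have "cmod (W ?z) * (1 - t * C) = cmod (\<tau> ?z * W ?z)"
      using tp by (simp only: norm_mult \<tau>r norm_of_real) simp
    also have "\<dots> = t * cmod (\<Sum>j<m. (d j)\<^sup>2 * Pr j ?z)"
      using t0 by (simp add: tW norm_mult)
    also have "\<dots> \<le> t * (\<Sum>j<m. (cmod (d j))\<^sup>2 * (1 - t * D) ^ (m - 1))"
      using t0 Prb by (intro mult_left_mono sum_norm_le) (auto simp: norm_mult norm_power intro!: mult_left_mono)
    also have "\<dots> \<le> t * (m * \<theta> * C * (1 - t * D) ^ (m - 1))"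
      using t0 sumd oD0 by (simp flip: sum_distrib_right) (intro mult_left_mono mult_right_mono, auto)
    finally have 1: "cmod (W ?z) * (1 - t * C) \<le> t * (m * \<theta> * C * (1 - t * D) ^ (m - 1))" .
    \<comment> \<open>Two of the \<open>m - 1\<close> factors \<open>1 - t * D\<close> are spent to
      cancel the factor \<open>1 - t * C\<close> next to \<open>cmod (W ?z)\<close>; this explains
      the exponent \<open>m - 3\<close>. By the choice of \<open>D\<close> the last bracket of the
      identity below vanishes.\<close>
    have 2: "(1 - t * D)\<^sup>2 \<le> (1 - t * C) * (1 + t / (m - 1))"
    proof -
      have s: "(1 - D)\<^sup>2 = m * \<theta> / (m - 1)" using \<theta> m by (simp add: D)
      define e where "e = 1 / real (m - 1)"
      have e: "e \<ge> 0" "(1 - D)\<^sup>2 = (1 + e) * (1 - C)"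
        using s m by (auto simp: e_def C_def field_simps)
      have "(1 - t * C) * (1 + t * e) - (1 - t * D)\<^sup>2 = t * (1 - t) * (C * e + D\<^sup>2)
          + t * ((1 + e) * (1 - C) - (1 - D)\<^sup>2)"
        by (simp add: algebra_simps power2_eq_square)
      moreover have "t * (1 - t) * (C * e + D\<^sup>2) \<ge> 0" using t0 C e by simp
      ultimately show ?thesis using e(2) by (simp add: e_def)
    qed
    obtain k where k: "m = k + 3" using m by (metis add.commute le_Suc_ex)
    have "(1 - t * D) ^ (m - 1) = (1 - t * D)\<^sup>2 * (1 - t * D) ^ (m - 3)"
      by (simp add: k power2_eq_square)
    also have "\<dots> \<le> (1 - t * C) * (1 + t / (m - 1)) * (1 - t * D) ^ (m - 3)"
      using 2 oD0 by (intro mult_right_mono) auto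
    finally have "t * (m * \<theta> * C * (1 - t * D) ^ (m - 1))
        \<le> t * (m * \<theta> * C * ((1 - t * C) * (1 + t / (m - 1)) * (1 - t * D) ^ (m - 3)))"
      using t0 \<theta> C by (intro mult_left_mono) auto
    also have "\<dots> = m * \<theta> * C * h t * (1 - t * C)" by (simp add: h_def)
    finally have "cmod (W ?z) * (1 - t * C) \<le> m * \<theta> * C * h t * (1 - t * C)" using 1 by linarith
    then have "cmod (W ?z) \<le> m * \<theta> * C * h t" using tp by simp
    moreover have "cmod (W ?z * of_real (\<kappa> t)) \<le> cmod (W ?z) * 1"
      unfolding norm_mult norm_of_real using \<kappa>b by (intro mult_left_mono) auto
    ultimately show ?thesis by simp
  qed
  have inth: "h integrable_on {0..1}"
    unfolding h_def using m by (intro integrable_continuous_real continuous_intros) auto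
  have "cmod (integral {0..1} (\<lambda>t. W (of_real t) * of_real (\<kappa> t)))
      \<le> integral {0..1} (\<lambda>t. m * \<theta> * C * h t)"
    by (rule integral_norm_bound_integral[OF intW _ bound]) (intro integrable_on_mult_right inth)
  then have B: "cmod (integral {0..1} (\<lambda>t. W (of_real t) * of_real (\<kappa> t)))
      \<le> m * \<theta> * C * integral {0..1} h"
    by simp
  have "(m+1) * of_real C * integral {0..1} (\<lambda>t. P (of_real t)) =
      of_real (1 - \<theta> ^ (m+1)) + integral {0..1} (\<lambda>t. W (of_real t) * of_real (\<kappa> t))"
    using eq by (simp add: algebra_simps)
  then have "cmod ((m+1) * of_real C * integral {0..1} (\<lambda>t. P (of_real t))) \<ge>
      cmod (of_real (1 - \<theta> ^ (m+1))) - cmod (integral {0..1} (\<lambda>t. W (of_real t) * of_real (\<kappa> t)))"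
    by (simp only: norm_diff_ineq)
  moreover have "cmod (of_real (1 - \<theta> ^ (m+1))) = 1 - \<theta> ^ (m+1)"
    using \<theta> power_le_one[of \<theta> "m+1"] by (simp only: norm_of_real) simp
  moreover have "cmod ((m+1) * of_real C * integral {0..1} (\<lambda>t. P (of_real t)))
      = (m+1) * C * cmod (integral {0..1} (\<lambda>t. P (of_real t)))"
    using C by (simp only: norm_mult norm_of_real norm_of_nat) simp
  ultimately have "1 - \<theta> ^ (m+1) - m * \<theta> * C * integral {0..1} h
      \<le> (m+1) * C * cmod (integral {0..1} (\<lambda>t. P (of_real t)))"
    using B by linarith
  then show ?thesis unfolding P_def zf_def C_def h_def[abs_def] by (simp add: of_real_diff)
qed

text \<open>Only the term quadratic in \<open>v\<close> is estimated, so the individual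
  \<open>v j\<close> survive through their mean alone.\<close>

lemma mean_square_affine:
  fixes v :: "nat \<Rightarrow> complex" and \<alpha> \<beta> :: complex and s :: real
  assumes "m > 0" "(\<Sum>j<m. (cmod (v j))\<^sup>2) \<le> m"
  shows "(\<Sum>j<m. (cmod (\<alpha> + of_real s * \<beta> * v j))\<^sup>2) / m
    \<le> (cmod \<alpha>)\<^sup>2 + 2 * s * Re (cnj \<alpha> * \<beta> * ((\<Sum>j<m. v j) / m)) + s\<^sup>2 * (cmod \<beta>)\<^sup>2"
proof -
  have 1: "(cmod (\<alpha> + of_real s * \<beta> * w))\<^sup>2 =
      (cmod \<alpha>)\<^sup>2 + 2 * s * Re (cnj \<alpha> * \<beta> * w) + s\<^sup>2 * (cmod \<beta>)\<^sup>2 * (cmod w)\<^sup>2" for w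
    unfolding cmod_power2 by (simp add: power2_eq_square algebra_simps)
  have "(\<Sum>j<m. (cmod (\<alpha> + of_real s * \<beta> * v j))\<^sup>2) =
      m * (cmod \<alpha>)\<^sup>2 + 2 * s * Re (cnj \<alpha> * \<beta> * (\<Sum>j<m. v j)) + s\<^sup>2 * (cmod \<beta>)\<^sup>2 * (\<Sum>j<m. (cmod (v j))\<^sup>2)"
    unfolding 1 by (simp add: sum.distrib sum_distrib_left Re_sum)
  also have "\<dots> \<le> m * (cmod \<alpha>)\<^sup>2
      + 2 * s * Re (cnj \<alpha> * \<beta> * (\<Sum>j<m. v j)) + s\<^sup>2 * (cmod \<beta>)\<^sup>2 * m"
    using assms by (intro add_left_mono mult_left_mono) auto
  also have "\<dots> = m * ((cmod \<alpha>)\<^sup>2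
      + 2 * s * Re (cnj \<alpha> * \<beta> * ((\<Sum>j<m. v j) / m)) + s\<^sup>2 * (cmod \<beta>)\<^sup>2)"
  proof -
    have "Re (cnj \<alpha> * \<beta> * (\<Sum>j<m. v j))
        = m * Re (cnj \<alpha> * \<beta> * ((\<Sum>j<m. v j) / m))"
    proof -
      define w where "w = (\<Sum>j<m. v j) / m"
      have "(\<Sum>j<m. v j) = of_nat m * w" using assms by (simp add: w_def)
      then show ?thesis unfolding w_def [symmetric] by (simp add: algebra_simps)
    qed
    moreover have "r * X + 2 * s * A + S * Y * r = r * (X + 2 * s * B + S * Y)" if "A
        = r * B" for A B X Y S r :: real
      using that by (simp add: algebra_simps)
    ultimately show ?thesis by blast
  qed
  finally show ?thesis using assms by (simp add: divide_le_eq mult.commute)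
qed

lemma affine_le_powr:
  fixes z q :: real
  assumes "0 < z" "1 \<le> q"
  shows "1 + q * (z - 1) \<le> z powr q"
proof -
  have d: "((\<lambda>x. x powr q) has_real_derivative q) (at 1)"
    by (auto intro!: derivative_eq_intros)
  have "q * (z - 1) \<le> z powr q - 1 powr q"
    using convex_on_imp_above_tangent[OF powr_convex[OF assms(2)] _ _ _ has_field_derivative_at_within[OF d], of z] assms
    by (auto simp: connected_Ioi interior_open)
  then show ?thesis by simp
qed

lemma powr_convex_comb3:
  fixes \<alpha> \<beta> \<gamma> X Y Z q :: real
  assumes "0 < X" "0 < Y" "0 < Z" "0 \<le> \<alpha>" "0 \<le> \<beta>" "0 \<le> \<gamma>" "\<alpha>
      + \<beta> + \<gamma> = 1" "1 \<le> q"
  shows "(\<alpha> * X + \<beta> * Y + \<gamma> * Z) powr q \<le> \<alpha> * X powr q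
      + \<beta> * Y powr q + \<gamma> * Z powr q"
proof -
  define M where "M = \<alpha> * X + \<beta> * Y + \<gamma> * Z"
  have M: "M > 0"
  proof -
    have "\<alpha> > 0 \<or> \<beta> > 0 \<or> \<gamma> > 0" using assms by linarith
    then show ?thesis using assms unfolding M_def
      by (smt (verit) mult_nonneg_nonneg mult_pos_pos)
  qed
  have t: "M powr q * (1 + q * (w / M - 1)) \<le> w powr q" if "w > 0" for w
  proof -
    have "M powr q * (1 + q * (w / M - 1)) \<le> M powr q * (w / M) powr q"
      using affine_le_powr[of "w / M" q] that M assms by (intro mult_left_mono) auto
    also have "\<dots> = w powr q" using that M by (simp add: powr_divide)
    finally show ?thesis .
  qed
  have "\<alpha> * (M powr q * (1 + q * (X / M - 1))) + \<beta> * (M powr q * (1 + q * (Y / M - 1)))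
      + \<gamma> * (M powr q * (1 + q * (Z / M - 1)))
    \<le> \<alpha> * X powr q + \<beta> * Y powr q + \<gamma> * Z powr q"
    using assms by (intro add_mono mult_left_mono t) auto
  moreover have "\<alpha> * (M powr q * (1 + q * (X / M - 1))) + \<beta> * (M powr q * (1
      + q * (Y / M - 1))) + \<gamma> * (M powr q * (1 + q * (Z / M - 1)))
      = M powr q * ((\<alpha> + \<beta> + \<gamma>) + q * ((\<alpha> * X + \<beta> * Y + \<gamma> * Z) / M - (\<alpha> + \<beta> + \<gamma>)))"
    by (simp add: algebra_simps add_divide_distrib)
  moreover have "\<dots> = M powr q" unfolding assms(7) M_def [symmetric] using M by simp
  ultimately show ?thesis unfolding M_def [symmetric] by linarith
qed

text \<open>The majorant of \<open>Q\<close> is the convex combination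
  \<open>(1 - R - \<rho>) s^2 + R (1 - s)^2 + \<rho> s\<close>, to which convexity of the power
  \<open>m / 2\<close> applies. Since \<open>s^m\<close> and \<open>(1 - s)^m\<close> have the same
  integral, \<open>R\<close> drops out; only the last term, with integral
  \<open>2 / (m + 2)\<close>, costs more than \<open>1 / (m + 1)\<close>.\<close>

lemma integral_reflected_bound:
  fixes R C \<rho> :: real and Q :: "real \<Rightarrow> real"
  assumes m: "m \<ge> 2" and R: "0 \<le> R" and \<rho>: "0 \<le> \<rho>" "R + \<rho> \<le> 1"
    and Q: "continuous_on {0..1} Q" "\<And>s. s \<in> {0..1} \<Longrightarrow> 0 \<le> Q s"
    and lt: "\<And>s. s \<in> {0<..<1} \<Longrightarrow> Q s < s\<^sup>2 + R * (1 - 2 * s)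
        + \<rho> * (s * (1 - s))"
  shows "(real m + 1) * integral {0..1} (\<lambda>s. Q s powr (m / 2)) < 1 + \<rho> * real m / (real m + 2)"
proof -
  let ?q = "real m / 2"
  define G where "G s = (1 - R - \<rho>) * s ^ m + R * (1 - s) ^ m + \<rho> * s powr ?q" for s :: real
  have q: "?q \<ge> 1" using m by simp
  have pt: "Q s powr ?q < G s" if s: "s \<in> {0<..<1}" for s
  proof -
    have s': "0 < s" "s < 1" using s by auto
    let ?f = "\<lambda>x. x powr ?q"
    have "Q s powr ?q < (s\<^sup>2 + R * (1 - 2 * s) + \<rho> * (s * (1 - s))) powr ?q"
      using lt[OF s] Q(2)[of s] s q by (intro powr_less_mono2) auto
    also have "s\<^sup>2 + R * (1 - 2 * s) + \<rho> * (s * (1 - s)) = (1 - R - \<rho>) * s\<^sup>2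
        + R * (1 - s)\<^sup>2 + \<rho> * s"
      by (simp add: algebra_simps power2_eq_square)
    also have "?f \<dots> \<le> (1 - R - \<rho>) * ?f (s\<^sup>2) + R * ?f ((1 - s)\<^sup>2)
        + \<rho> * ?f s"
      using R \<rho> s' q by (intro powr_convex_comb3) auto
    also have "\<dots> = G s"
    proof -
      have "x\<^sup>2 powr ?q = x ^ m" if "x > 0" for x :: real
      proof -
        have "x\<^sup>2 = x powr 2" using that by simp
        then have "x\<^sup>2 powr ?q = x powr (2 * ?q)" by (simp only: powr_powr)
        then show ?thesis using that by (simp add: powr_realpow)
      qed
      then show ?thesis using s' by (simp add: G_def)
    qed
    finally show ?thesis .
  qed
  have c1: "continuous_on {0..1} (\<lambda>s. Q s powr ?q)"
    using Q q by (intro continuous_on_powr' continuous_intros) auto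
  have c2: "continuous_on {0..1} G"
    unfolding G_def using q by (intro continuous_intros continuous_on_powr') auto
  have "integral {0..1} (\<lambda>s. Q s powr ?q) < integral {0..1} G"
    using pt by (intro integral_less_real c1 c2) auto
  also have "(G has_integral ((1 - R - \<rho>) * (1 / (m+1)) + R * (1 / (m+1)) + \<rho> * (1 / (?q
      + 1)))) {0..1}"
  proof -
    have "((\<lambda>s::real. s powr m) has_integral 1 / (m+1)) {0..1}"
      using has_integral_powr_from_0[of "real m" 1] by (simp add: add.commute)
    then have i1: "((\<lambda>s::real. s ^ m) has_integral 1 / (m+1)) {0..1}"
      by (rule has_integral_eq[rotated]) (use m in \<open>auto simp: powr_realpow'\<close>)
    have d: "((\<lambda>s::real. - ((1 - s) ^ Suc m / Suc m)) has_real_derivative (1 - s) ^ m) (at s within {0..1})" for s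
      by (rule derivative_eq_intros refl | simp del: power_Suc)+
    have "((\<lambda>s::real. (1 - s) ^ m)
        has_integral (- ((1 - 1) ^ Suc m / Suc m) - - ((1 - 0) ^ Suc m / Suc m))) {0..1}"
      by (rule fundamental_theorem_of_calculus)
        (use d in \<open>simp_all add: has_real_derivative_iff_has_vector_derivative del: power_Suc\<close>)
    then have i2: "((\<lambda>s::real. (1 - s) ^ m) has_integral 1 / (m+1)) {0..1}"
      by simp
    have i3: "((\<lambda>s::real. s powr ?q) has_integral 1 / (?q + 1)) {0..1}"
      using has_integral_powr_from_0[of ?q 1] by simp
    show ?thesis unfolding G_def
      by (intro has_integral_add has_integral_mult_right i1 i2 i3)
  qed
  then have "integral {0..1} G = (1 - R - \<rho>) * (1 / (m+1)) + R * (1 / (m+1)) + \<rho> * (1 / (?q + 1))"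
    by (rule integral_unique)
  finally have "(real m + 1) * integral {0..1} (\<lambda>s. Q s powr ?q)
      < (real m + 1) * ((1 - R - \<rho>) * (1 / (m+1)) + R * (1 / (m+1)) + \<rho> * (1 / (?q + 1)))"
    by simp
  also have "\<dots> = (1 - \<rho>) * ((real m + 1) * (1 / (m+1))) + \<rho> * ((real m + 1) * (1 / (?q
      + 1)))"
    by (simp only: distrib_left distrib_right left_diff_distrib right_diff_distrib mult_ac)
  also have "(real m + 1) * (1 / (m+1)) = 1" by simp
  also have "(real m + 1) * (1 / (?q + 1)) = 1 + real m / (real m + 2)" by (simp add: field_simps)
  finally show ?thesis by (simp add: algebra_simps)
qed

section \<open>Configurations of reciprocals violating the strict inequality\<close>

text \<open>
  The assumption \<open>schur\<close> is the inequality \<open>|q(b)| \<le> |b|\<^sup>m |q(1 / cnj b)|\<close>, with the modulus moved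
  inside the integral on the right so that \<open>b = 0\<close> needs no separate formulation.
\<close>

locale reciprocal_configuration =
  fixes a :: complex and v :: "nat \<Rightarrow> complex" and m :: nat
  assumes m_pos: "m > 0"
    and a_less: "cmod a < 1"
    and mean_square: "(\<Sum>j<m. (cmod (v j))\<^sup>2) \<le> m"
    and schur: "\<And>b. cmod b \<le> 1 \<Longrightarrow>
      cmod (integral {0..1} (\<lambda>t. \<Prod>j<m. 1 + of_real t * (b - a) * v j))
      \<le> integral {0..1} (\<lambda>t. \<Prod>j<m. cmod (cnj b + of_real t * (1 - a * cnj b) * v j))"
begin

definition \<mu> :: complex where "\<mu> = (\<Sum>j<m. v j) / m"
definition C :: real where "C = (cmod \<mu>)\<^sup>2"
definition x :: real where "x = 1 - (cmod a)\<^sup>2"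
definition y :: real where "y = 2 * Re (a * \<mu>)"
text \<open>The squared modulus of the second test point.\<close>

definition R :: real where "R = (cmod (a - cnj \<mu>))\<^sup>2"
text \<open>The bound for the mean square of the factors on the right of \<open>schur\<close> at
  \<open>b = a\<close>.\<close>

definition Va :: "real \<Rightarrow> real" where "Va t = 1 - x + t * x * y + t\<^sup>2 * x\<^sup>2"

lemma sum_v: "(\<Sum>j<m. v j) = m * \<mu>"
  using m_pos by (simp add: \<mu>_def)

lemma C_le_1: "C \<le> 1"
proof -
  have "(\<Sum>j<m. cmod (v j))\<^sup>2 \<le> m * (\<Sum>j<m. (cmod (v j))\<^sup>2)"
    using Cauchy_Schwarz_ineq_sum[of "\<lambda>_. 1" "\<lambda>j. cmod (v j)" "{..<m}"] by simp
  also have "\<dots> \<le> real m * real m" using mean_square by (intro mult_left_mono) auto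
  finally have "(\<Sum>j<m. cmod (v j))\<^sup>2 \<le> (real m)\<^sup>2" by (simp add: power2_eq_square)
  then have "(\<Sum>j<m. cmod (v j)) \<le> m" by (rule power2_le_imp_le) simp
  then have "cmod (\<Sum>j<m. v j) \<le> m" using norm_sum[of v "{..<m}"] by linarith
  then have "cmod \<mu> \<le> 1" using m_pos by (simp add: \<mu>_def norm_divide)
  then show ?thesis by (simp add: C_def power_le_one)
qed

lemma C_nonneg: "0 \<le> C" by (simp add: C_def)

lemma x_bounds: "0 < x" "x \<le> 1"
  using a_less power_strict_mono[of "cmod a" 1 2] by (auto simp: x_def)

lemma R_nonneg: "0 \<le> R" by (simp add: R_def)

lemma R_eq: "R = 1 - x - y + C"
  unfolding R_def x_def y_def C_def cmod_power2 by (simp add: power2_eq_square algebra_simps)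

lemma y_square_le: "y\<^sup>2 \<le> 4 * (1 - x) * C"
proof -
  have "\<bar>Re (a * \<mu>)\<bar> \<le> cmod a * cmod \<mu>" by (metis abs_Re_le_cmod norm_mult)
  then have "(Re (a * \<mu>))\<^sup>2
      \<le> (cmod a * cmod \<mu>)\<^sup>2" by (metis abs_ge_zero power2_abs power_mono)
  moreover have "y\<^sup>2 = 4 * (Re (a * \<mu>))\<^sup>2" unfolding y_def power_mult_distrib by simp
  ultimately show ?thesis by (simp add: x_def C_def power_mult_distrib)
qed

section \<open>The inequality \<open>schur\<close> at the two test points\<close>

lemma mean_bound:
  "(\<Prod>j<m. cmod (\<alpha> + of_real s * \<beta> * v j))
    \<le> ((cmod \<alpha>)\<^sup>2 + 2 * s * Re (cnj \<alpha> * \<beta> * \<mu>) + s\<^sup>2 * (cmod \<beta>)\<^sup>2) powr (m / 2)"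
  "0 \<le> (cmod \<alpha>)\<^sup>2 + 2 * s * Re (cnj \<alpha> * \<beta> * \<mu>)
      + s\<^sup>2 * (cmod \<beta>)\<^sup>2"
proof -
  let ?B = "(cmod \<alpha>)\<^sup>2 + 2 * s * Re (cnj \<alpha> * \<beta> * \<mu>)
      + s\<^sup>2 * (cmod \<beta>)\<^sup>2"
  let ?S = "(\<Sum>j<m. (cmod (\<alpha> + of_real s * \<beta> * v j))\<^sup>2) / m"
  have S0: "0 \<le> ?S" by (simp add: sum_nonneg)
  have le: "?S \<le> ?B" using mean_square_affine[OF m_pos mean_square] by (simp add: \<mu>_def)
  show "0 \<le> ?B" using S0 le by linarith
  have "(\<Prod>j<m. cmod (\<alpha> + of_real s * \<beta> * v j)) \<le> ?S powr (m / 2)"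
    using prod_norm_le_mean_square[of "{..<m}" "\<lambda>j. \<alpha>
        + of_real s * \<beta> * v j"] m_pos by auto
  also have "\<dots> \<le> ?B powr (m / 2)" using S0 le by (intro powr_mono2) auto
  finally show "(\<Prod>j<m. cmod (\<alpha> + of_real s * \<beta> * v j)) \<le> ?B powr (m / 2)" .
qed

lemma Va_alt: "Va t = (cmod (cnj a))\<^sup>2 + 2 * t * Re (cnj (cnj a) * (1 - a * cnj a) * \<mu>)
    + t\<^sup>2 * (cmod (1 - a * cnj a))\<^sup>2"
proof -
  have "1 - a * cnj a = of_real x"
    unfolding x_def of_real_diff complex_norm_square by simp
  moreover have "(cmod (of_real x :: complex))\<^sup>2 = x\<^sup>2" by simp
  moreover have "Re (cnj (cnj a) * of_real x * \<mu>) = x * Re (a * \<mu>)" by (simp add: algebra_simps)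
  ultimately show ?thesis by (simp add: Va_def y_def x_def)
qed

lemma Va_nonneg: "0 \<le> Va t"
  unfolding Va_alt by (rule mean_bound(2))

lemma cont_Va: "continuous_on A Va"
  unfolding Va_def by (intro continuous_intros)

lemma cont_Va_powr: "continuous_on A (\<lambda>t. Va t powr (m / 2))"
  using Va_nonneg m_pos by (intro continuous_on_powr' cont_Va continuous_intros) auto

lemma one_le_integral_Va: "1 \<le> integral {0..1} (\<lambda>t. Va t powr (m / 2))"
proof -
  have "cmod (integral {0..1} (\<lambda>t. \<Prod>j<m. 1 + of_real t * (a - a) * v j)) = 1" by simp
  then have "1 \<le> integral {0..1} (\<lambda>t. \<Prod>j<m. cmod (cnj a
      + of_real t * (1 - a * cnj a) * v j))"
    using schur[of a] a_less by simp
  also have "\<dots> \<le> integral {0..1} (\<lambda>t. Va t powr (m / 2))"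
    using mean_bound(1)[of "cnj a" _ "1 - a * cnj a", folded Va_alt]
    by (intro integral_le integrable_continuous_real cont_Va_powr) (auto intro!: continuous_intros)
  finally show ?thesis .
qed

text \<open>This amounts to \<open>y > 1 - x\<close>; otherwise \<open>Va\<close> would stay below 1
  inside the unit interval. Together with \<open>C \<le> 1\<close> it places
  \<open>a - cnj \<mu>\<close> in the unit disk, where \<open>schur\<close> applies.\<close>

lemma R_less_C: "R < C"
proof (rule ccontr)
  assume "\<not> R < C"
  then have y: "y \<le> 1 - x" by (simp add: R_eq)
  have "integral {0..1} (\<lambda>t. Va t powr (m / 2)) < integral {0..1} (\<lambda>_::real. 1)"
  proof (rule integral_less_real)
    fix t :: real assume t: "t \<in> {0<..<1}"
    have "Va t \<le> 1 - x + t * x * (1 - x) + t\<^sup>2 * x\<^sup>2"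
      using y t x_bounds by (simp add: Va_def mult_left_mono)
    also have "\<dots> = 1 - x * (1 - t) * (1 + t * x)"
      by (simp add: algebra_simps power2_eq_square)
    also have "\<dots> < 1" using t x_bounds by (simp add: add_pos_pos)
    finally have "Va t < 1" .
    then show "Va t powr (m / 2) < 1"
      using powr_less_mono2[of "m/2" "Va t" 1] Va_nonneg m_pos by simp
  qed (auto intro: cont_Va_powr)
  then show False using one_le_integral_Va by simp
qed

text \<open>The parameter \<open>\<eta>\<close> measures how much of \<open>x > 1 - C + R\<close> is
  available: for \<open>\<eta> = 1\<close> the bound is 1, and a deficit costs a term proportional
  to \<open>1 - C\<close>.\<close>

lemma reflected_bound:
  assumes m: "m \<ge> 2" and \<eta>: "0 \<le> \<eta>" "\<eta> \<le> 1" and x: "x > \<eta> * (1 - C + R)"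
  shows "(real m + 1) * cmod (integral {0..1} (\<lambda>t. \<Prod>j<m. of_real (1 - t)
      + of_real t * (1 - cnj \<mu> * v j)))
    < 1 + (1 - \<eta>) * (1 - C) * real m / (real m + 2)"
proof -
  define b where "b = a - cnj \<mu>"
  have R1: "R < 1" using R_less_C C_le_1 by linarith
  have b1: "cmod b \<le> 1"
  proof -
    have "(cmod b)\<^sup>2 < 1" using R1 unfolding R_def b_def .
    then have "(cmod b)\<^sup>2 \<le> 1\<^sup>2" by simp
    then show ?thesis by (rule power2_le_imp_le) simp
  qed
  define Q where "Q s = (cmod (cnj b))\<^sup>2 + 2 * s * Re (cnj (cnj b) * (1 - a * cnj b) * \<mu>)
      + s\<^sup>2 * (cmod (1 - a * cnj b))\<^sup>2" for s
  have Q0: "0 \<le> Q s" for s unfolding Q_def by (rule mean_bound(2))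
  have Qeq: "Q s = R + 2 * s * (y / 2 - C - R * y / 2) + s\<^sup>2 * (1 - 2 * (1 - x) + y
      + (1 - x) * R)" for s
  proof -
    have 1: "(cmod (cnj b))\<^sup>2 = R" unfolding complex_mod_cnj R_def b_def ..
    have bb: "b * cnj b = of_real R"
      unfolding R_def b_def by (rule complex_norm_square [symmetric])
    have "cnj (cnj b) * (1 - a * cnj b) * \<mu> = b * \<mu> - (b * cnj b) * (a * \<mu>)"
      by (simp add: algebra_simps)
    then have "Re (cnj (cnj b) * (1 - a * cnj b) * \<mu>) = Re (b * \<mu>) - R * Re (a * \<mu>)"
      unfolding bb by simp
    also have "Re (b * \<mu>) = y / 2 - C"
      unfolding b_def y_def C_def cmod_power2 by (simp add: power2_eq_square field_simps)
    finally have 2: "Re (cnj (cnj b) * (1 - a * cnj b) * \<mu>) = y / 2 - C - R * y / 2"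
      by (simp add: y_def)
    have "(cmod (1 - a * cnj b))\<^sup>2 = 1 - 2 * Re (a * cnj b) + (cmod a)\<^sup>2 * (cmod b)\<^sup>2"
      unfolding cmod_power2 by (simp add: power2_eq_square algebra_simps)
    also have "Re (a * cnj b) = (1 - x) - y / 2"
      unfolding b_def x_def y_def cmod_power2 by (simp add: power2_eq_square field_simps)
    also have "(cmod b)\<^sup>2 = R" unfolding R_def b_def ..
    finally have 3: "(cmod (1 - a * cnj b))\<^sup>2 = 1 - 2 * (1 - x) + y + (1 - x) * R"
      by (simp add: x_def)
    show ?thesis unfolding Q_def 1 2 3 ..
  qed
  have Qlt: "Q s < s\<^sup>2 + R * (1 - 2 * s)
      + ((1 - \<eta>) * (1 - C)) * (s * (1 - s))" if s: "s \<in> {0<..<1}" for s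
  proof -
    \<comment> \<open>Once \<open>y\<close> is eliminated, the difference splits into a term that is
      positive by the hypothesis on \<open>x\<close> and two that are nonnegative because
      \<open>R < C\<close>.\<close>
    have yy: "y = 1 - x - R + C" using R_eq by simp
    have "s\<^sup>2 + R * (1 - 2 * s) + ((1 - \<eta>) * (1 - C)) * (s * (1 - s)) - Q s
      = (x - \<eta> * (1 - C + R)) * (s * (1 - s)) * (1 - R) + \<eta> * R * (C - R) * (s * (1 - s)) + s * R * (C - R)"
      unfolding Qeq yy by (simp add: field_simps power2_eq_square)
    moreover have "(x - \<eta> * (1 - C + R)) * (s * (1 - s)) * (1 - R) > 0"
      using x s R1 by (intro mult_pos_pos) auto
    moreover have "\<eta> * R * (C - R) * (s * (1 - s)) \<ge> 0" "s * R * (C - R) \<ge> 0"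
      using \<eta> s R_nonneg R_less_C by auto
    ultimately show ?thesis by linarith
  qed
  have contQ': "continuous_on {0..1} Q" unfolding Q_def by (intro continuous_intros)
  have contQ: "continuous_on {0..1} (\<lambda>s. Q s powr (m / 2))"
    using Q0 m by (intro continuous_on_powr' contQ' continuous_intros) auto
  have factor: "of_real (1 - t) + of_real t * (1 - cnj \<mu> * w) = 1 + of_real t * (b - a) * w" for t w
    by (simp add: b_def algebra_simps)
  have "cmod (integral {0..1} (\<lambda>t. \<Prod>j<m. of_real (1 - t) + of_real t * (1 - cnj \<mu> * v j)))
      = cmod (integral {0..1} (\<lambda>t. \<Prod>j<m. 1 + of_real t * (b - a) * v j))"
    by (simp only: factor)
  also have "\<dots> \<le> integral {0..1} (\<lambda>t. \<Prod>j<m. cmod (cnj b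
      + of_real t * (1 - a * cnj b) * v j))"
    by (rule schur[OF b1])
  also have "\<dots> \<le> integral {0..1} (\<lambda>s. Q s powr (m / 2))"
    using mean_bound(1)[of "cnj b" _ "1 - a * cnj b", folded Q_def]
    by (intro integral_le integrable_continuous_real contQ) (auto intro!: continuous_intros)
  finally have "(real m + 1) * cmod (integral {0..1} (\<lambda>t. \<Prod>j<m. of_real (1 - t)
      + of_real t * (1 - cnj \<mu> * v j)))
      \<le> (real m + 1) * integral {0..1} (\<lambda>s. Q s powr (m / 2))"
    by (intro mult_left_mono) auto
  also have "\<dots> < 1 + ((1 - \<eta>) * (1 - C)) * real m / (real m + 2)"
  proof (rule integral_reflected_bound[where Q = Q and R = R and \<rho> = "(1 - \<eta>) * (1 - C)"])
    show "0 \<le> (1 - \<eta>) * (1 - C)" using \<eta> C_le_1 by simp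
    have "R + (1 - \<eta>) * (1 - C) \<le> R + 1 * (1 - C)"
      using \<eta> C_le_1 by (intro add_left_mono mult_right_mono) auto
    also have "\<dots> \<le> 1" using R_less_C by simp
    finally show "R + (1 - \<eta>) * (1 - C) \<le> 1" .
    show "continuous_on {0..1} Q" by (rule contQ')
  qed (use m R_nonneg Q0 Qlt in auto)
  finally show ?thesis .
qed

end

section \<open>Explicit integrals and exponential estimates\<close>

lemma has_integral_power_unit:
  "((\<lambda>t::real. t ^ i) has_integral 1 / (real i + 1)) {0..1}"
proof -
  have d: "((\<lambda>t::real. t ^ Suc i / Suc i) has_real_derivative t ^ i) (at t within {0..1})" for t
    by (rule derivative_eq_intros refl | simp del: power_Suc)+
  have "((\<lambda>t::real. t ^ i) has_integral (1 ^ Suc i / Suc i - 0 ^ Suc i / Suc i)) {0..1}"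
    by (rule fundamental_theorem_of_calculus)
      (use d in \<open>simp_all add: has_real_derivative_iff_has_vector_derivative del: power_Suc\<close>)
  then show ?thesis by (simp add: add.commute)
qed

section \<open>Integrals of powers of quadratics, for the small degrees\<close>

lemma has_integral_quadratic_power3:
  fixes A B G :: real
  shows "((\<lambda>t. (A + t * B + t\<^sup>2 * G) ^ 3) has_integral
    ((A ^ 3) + (3 * A ^ 2 * B) / 2 + (3 * A * B ^ 2 + 3 * A ^ 2 * G) / 3 + (B ^ 3
      + 6 * A * B * G) / 4 + (3 * B ^ 2 * G + 3 * A * G ^ 2) / 5 + (3 * B * G ^ 2) / 6
      + (G ^ 3) / 7)) {0..1}"
proof -
  have "(A + t * B + t\<^sup>2 * G) ^ 3 = (A ^ 3) * t ^ 0 + (3 * A ^ 2 * B) * t ^ 1 + (3 * A * B ^ 2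
      + 3 * A ^ 2 * G) * t ^ 2 + (B ^ 3 + 6 * A * B * G) * t ^ 3 + (3 * B ^ 2 * G
      + 3 * A * G ^ 2) * t ^ 4 + (3 * B * G ^ 2) * t ^ 5 + (G ^ 3) * t ^ 6" for t
    by algebra
  moreover have "((\<lambda>t::real. (A ^ 3) * t ^ 0 + (3 * A ^ 2 * B) * t ^ 1 + (3 * A * B ^ 2
      + 3 * A ^ 2 * G) * t ^ 2 + (B ^ 3 + 6 * A * B * G) * t ^ 3 + (3 * B ^ 2 * G
      + 3 * A * G ^ 2) * t ^ 4 + (3 * B * G ^ 2) * t ^ 5 + (G ^ 3) * t ^ 6)
      has_integral ((A ^ 3) * (1 / (real 0 + 1)) + (3 * A ^ 2 * B) * (1 / (real 1 + 1)) + (3 * A * B ^ 2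
      + 3 * A ^ 2 * G) * (1 / (real 2 + 1)) + (B ^ 3 + 6 * A * B * G) * (1 / (real 3 + 1))
      + (3 * B ^ 2 * G + 3 * A * G ^ 2) * (1 / (real 4 + 1)) + (3 * B * G ^ 2) * (1 / (real 5 + 1))
      + (G ^ 3) * (1 / (real 6 + 1)))) {0..1}"
    by (intro has_integral_add has_integral_mult_right has_integral_power_unit)
  ultimately show ?thesis by simp
qed

lemma has_integral_quadratic_power4:
  fixes A B G :: real
  shows "((\<lambda>t. (A + t * B + t\<^sup>2 * G) ^ 4) has_integral
    ((A ^ 4) + (4 * A ^ 3 * B) / 2 + (6 * A ^ 2 * B ^ 2 + 4 * A ^ 3 * G) / 3 + (4 * A * B ^ 3
      + 12 * A ^ 2 * B * G) / 4 + (B ^ 4 + 12 * A * B ^ 2 * G + 6 * A ^ 2 * G ^ 2) / 5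
      + (4 * B ^ 3 * G + 12 * A * B * G ^ 2) / 6 + (6 * B ^ 2 * G ^ 2 + 4 * A * G ^ 3) / 7
      + (4 * B * G ^ 3) / 8 + (G ^ 4) / 9)) {0..1}"
proof -
  have "(A + t * B + t\<^sup>2 * G) ^ 4 = (A ^ 4) * t ^ 0 + (4 * A ^ 3 * B) * t ^ 1 + (6 * A ^ 2 * B ^ 2
      + 4 * A ^ 3 * G) * t ^ 2 + (4 * A * B ^ 3 + 12 * A ^ 2 * B * G) * t ^ 3 + (B ^ 4
      + 12 * A * B ^ 2 * G + 6 * A ^ 2 * G ^ 2) * t ^ 4 + (4 * B ^ 3 * G + 12 * A * B * G ^ 2) * t ^ 5
      + (6 * B ^ 2 * G ^ 2 + 4 * A * G ^ 3) * t ^ 6 + (4 * B * G ^ 3) * t ^ 7 + (G ^ 4) * t ^ 8" for t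
    by algebra
  moreover have "((\<lambda>t::real. (A ^ 4) * t ^ 0 + (4 * A ^ 3 * B) * t ^ 1 + (6 * A ^ 2 * B ^ 2
      + 4 * A ^ 3 * G) * t ^ 2 + (4 * A * B ^ 3 + 12 * A ^ 2 * B * G) * t ^ 3 + (B ^ 4
      + 12 * A * B ^ 2 * G + 6 * A ^ 2 * G ^ 2) * t ^ 4 + (4 * B ^ 3 * G + 12 * A * B * G ^ 2) * t ^ 5
      + (6 * B ^ 2 * G ^ 2 + 4 * A * G ^ 3) * t ^ 6 + (4 * B * G ^ 3) * t ^ 7 + (G ^ 4) * t ^ 8)
      has_integral ((A ^ 4) * (1 / (real 0 + 1)) + (4 * A ^ 3 * B) * (1 / (real 1 + 1))
      + (6 * A ^ 2 * B ^ 2 + 4 * A ^ 3 * G) * (1 / (real 2 + 1)) + (4 * A * B ^ 3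
      + 12 * A ^ 2 * B * G) * (1 / (real 3 + 1)) + (B ^ 4 + 12 * A * B ^ 2 * G
      + 6 * A ^ 2 * G ^ 2) * (1 / (real 4 + 1)) + (4 * B ^ 3 * G + 12 * A * B * G ^ 2) * (1 / (real 5
      + 1)) + (6 * B ^ 2 * G ^ 2 + 4 * A * G ^ 3) * (1 / (real 6 + 1)) + (4 * B * G ^ 3) * (1 / (real 7
      + 1)) + (G ^ 4) * (1 / (real 8 + 1)))) {0..1}"
    by (intro has_integral_add has_integral_mult_right has_integral_power_unit)
  ultimately show ?thesis by simp
qed

lemma has_integral_quadratic_power5:
  fixes A B G :: real
  shows "((\<lambda>t. (A + t * B + t\<^sup>2 * G) ^ 5) has_integral
    ((A ^ 5) + (5 * A ^ 4 * B) / 2 + (10 * A ^ 3 * B ^ 2 + 5 * A ^ 4 * G) / 3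
      + (10 * A ^ 2 * B ^ 3 + 20 * A ^ 3 * B * G) / 4 + (5 * A * B ^ 4 + 30 * A ^ 2 * B ^ 2 * G
      + 10 * A ^ 3 * G ^ 2) / 5 + (B ^ 5 + 20 * A * B ^ 3 * G + 30 * A ^ 2 * B * G ^ 2) / 6
      + (5 * B ^ 4 * G + 30 * A * B ^ 2 * G ^ 2 + 10 * A ^ 2 * G ^ 3) / 7 + (10 * B ^ 3 * G ^ 2
      + 20 * A * B * G ^ 3) / 8 + (10 * B ^ 2 * G ^ 3 + 5 * A * G ^ 4) / 9
      + (5 * B * G ^ 4) / 10 + (G ^ 5) / 11)) {0..1}"
proof -
  have "(A + t * B + t\<^sup>2 * G) ^ 5 = (A ^ 5) * t ^ 0 + (5 * A ^ 4 * B) * t ^ 1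
      + (10 * A ^ 3 * B ^ 2 + 5 * A ^ 4 * G) * t ^ 2 + (10 * A ^ 2 * B ^ 3 + 20 * A ^ 3 * B * G) * t ^ 3
      + (5 * A * B ^ 4 + 30 * A ^ 2 * B ^ 2 * G + 10 * A ^ 3 * G ^ 2) * t ^ 4 + (B ^ 5
      + 20 * A * B ^ 3 * G + 30 * A ^ 2 * B * G ^ 2) * t ^ 5 + (5 * B ^ 4 * G + 30 * A * B ^ 2 * G ^ 2
      + 10 * A ^ 2 * G ^ 3) * t ^ 6 + (10 * B ^ 3 * G ^ 2 + 20 * A * B * G ^ 3) * t ^ 7
      + (10 * B ^ 2 * G ^ 3 + 5 * A * G ^ 4) * t ^ 8 + (5 * B * G ^ 4) * t ^ 9 + (G ^ 5) * t ^ 10" for t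
    by algebra
  moreover have "((\<lambda>t::real. (A ^ 5) * t ^ 0 + (5 * A ^ 4 * B) * t ^ 1 + (10 * A ^ 3 * B ^ 2
      + 5 * A ^ 4 * G) * t ^ 2 + (10 * A ^ 2 * B ^ 3 + 20 * A ^ 3 * B * G) * t ^ 3 + (5 * A * B ^ 4
      + 30 * A ^ 2 * B ^ 2 * G + 10 * A ^ 3 * G ^ 2) * t ^ 4 + (B ^ 5 + 20 * A * B ^ 3 * G
      + 30 * A ^ 2 * B * G ^ 2) * t ^ 5 + (5 * B ^ 4 * G + 30 * A * B ^ 2 * G ^ 2
      + 10 * A ^ 2 * G ^ 3) * t ^ 6 + (10 * B ^ 3 * G ^ 2 + 20 * A * B * G ^ 3) * t ^ 7
      + (10 * B ^ 2 * G ^ 3 + 5 * A * G ^ 4) * t ^ 8 + (5 * B * G ^ 4) * t ^ 9 + (G ^ 5) * t ^ 10)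
      has_integral ((A ^ 5) * (1 / (real 0 + 1)) + (5 * A ^ 4 * B) * (1 / (real 1 + 1))
      + (10 * A ^ 3 * B ^ 2 + 5 * A ^ 4 * G) * (1 / (real 2 + 1)) + (10 * A ^ 2 * B ^ 3
      + 20 * A ^ 3 * B * G) * (1 / (real 3 + 1)) + (5 * A * B ^ 4 + 30 * A ^ 2 * B ^ 2 * G
      + 10 * A ^ 3 * G ^ 2) * (1 / (real 4 + 1)) + (B ^ 5 + 20 * A * B ^ 3 * G
      + 30 * A ^ 2 * B * G ^ 2) * (1 / (real 5 + 1)) + (5 * B ^ 4 * G + 30 * A * B ^ 2 * G ^ 2
      + 10 * A ^ 2 * G ^ 3) * (1 / (real 6 + 1)) + (10 * B ^ 3 * G ^ 2
      + 20 * A * B * G ^ 3) * (1 / (real 7 + 1)) + (10 * B ^ 2 * G ^ 3 + 5 * A * G ^ 4) * (1 / (real 8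
      + 1)) + (5 * B * G ^ 4) * (1 / (real 9 + 1)) + (G ^ 5) * (1 / (real 10 + 1)))) {0..1}"
    by (intro has_integral_add has_integral_mult_right has_integral_power_unit)
  ultimately show ?thesis by simp
qed

text \<open>
  In these estimates the difference, cleared of denominators, has positive coefficients in the
  Bernstein basis \<open>x\<^sup>i (1 - x)\<^sup>j\<close>.
\<close>

lemma quadratic_power3_integral_less_1:
  fixes x :: real
  assumes "0 < x" "x \<le> 1"
  shows "integral {0..1} (\<lambda>t. (1 - x + t * (x * (39/20 - 6/5 * x))
      + t\<^sup>2 * x\<^sup>2) ^ 3) < 1"
proof -
  define A B G where "A = (20 * (1 - x))" and "B = (x * (39 - 24 * x))" and "G = (20 * x\<^sup>2)"
  let ?I = "(A ^ 3) + (3 * A ^ 2 * B) / 2 + (3 * A * B ^ 2 + 3 * A ^ 2 * G) / 3 + (B ^ 3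
      + 6 * A * B * G) / 4 + (3 * B ^ 2 * G + 3 * A * G ^ 2) / 5 + (3 * B * G ^ 2) / 6 + (G ^ 3) / 7"
  \<comment> \<open>\<open>420\<close> is the least common multiple of 1, ..., 7, and
    \<open>8000 = 20^3\<close> comes from the denominators in the base. With the coefficients kept
    as variables this is a linear identity, and \<open>algebra\<close> then meets integer
    coefficients only. The later lemmas use 2520 and 27720 in the same way.\<close>
  have scale: "420 * (8000 - (p0 + p1 / 2 + p2 / 3 + p3 / 4 + p4 / 5 + p5 / 6 + p6 / 7))
      = 3360000 - (420 * p0 + 210 * p1 + 140 * p2 + 105 * p3 + 84 * p4 + 70 * p5
      + 60 * p6)" for p0 p1 p2 p3 p4 p5 p6 :: real
    by simp
  have "420 * (8000 - ?I) = 3360000 - (420 * (A ^ 3) + 210 * (3 * A ^ 2 * B) + 140 * (3 * A * B ^ 2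
      + 3 * A ^ 2 * G) + 105 * (B ^ 3 + 6 * A * B * G) + 84 * (3 * B ^ 2 * G + 3 * A * G ^ 2)
      + 70 * (3 * B * G ^ 2) + 60 * (G ^ 3))"
    by (rule scale)
  also have "\<dots> = x ^ 1 * (252000 * (1 - x) ^ 5 + 747600 * x * (1 - x) ^ 4
      + 1071105 * x ^ 2 * (1 - x) ^ 3 + 1065435 * x ^ 3 * (1 - x) ^ 2 + 537075 * x ^ 4 * (1 - x)
      + 131625 * x ^ 5)"
    unfolding A_def B_def G_def by algebra
  also have "\<dots> > 0"
    using assms by (intro mult_pos_pos add_nonneg_pos add_nonneg_nonneg) auto
  finally have pos: "420 * (8000 - ?I) > 0" .
  have "I < 8000" if "420 * (8000 - I) > 0" for I :: real
    using that by simp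
  from this[OF pos] have I: "?I < 8000" .
  have eq: "20 * (1 - x + t * (x * (39/20 - 6/5 * x)) + t\<^sup>2 * x\<^sup>2) = A + t * B
      + t\<^sup>2 * G" for t
    by (simp add: A_def B_def G_def algebra_simps)
  have "8000 * (1 - x + t * (x * (39/20 - 6/5 * x)) + t\<^sup>2 * x\<^sup>2) ^ 3 = (A + t * B
      + t\<^sup>2 * G) ^ 3" for t
    unfolding eq [symmetric] power_mult_distrib by simp
  then have "integral {0..1} (\<lambda>t. 8000 * (1 - x + t * (x * (39/20 - 6/5 * x))
      + t\<^sup>2 * x\<^sup>2) ^ 3) = ?I"
    using integral_unique[OF has_integral_quadratic_power3[of A B G]] by presburger
  with I show ?thesis by simp
qed

lemma quadratic_power4_integral_less_1:
  fixes x :: real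
  assumes "0 < x" "x \<le> 1"
  shows "integral {0..1} (\<lambda>t. (1 - x + t * (x * (15/8 - 5/4 * x)) + t\<^sup>2 * x\<^sup>2) ^ 4) < 1"
proof -
  define A B G where "A = (8 * (1 - x))" and "B = (x * (15 - 10 * x))" and "G = (8 * x\<^sup>2)"
  let ?I = "(A ^ 4) + (4 * A ^ 3 * B) / 2 + (6 * A ^ 2 * B ^ 2 + 4 * A ^ 3 * G) / 3 + (4 * A * B ^ 3
      + 12 * A ^ 2 * B * G) / 4 + (B ^ 4 + 12 * A * B ^ 2 * G + 6 * A ^ 2 * G ^ 2) / 5 + (4 * B ^ 3 * G
      + 12 * A * B * G ^ 2) / 6 + (6 * B ^ 2 * G ^ 2 + 4 * A * G ^ 3) / 7 + (4 * B * G ^ 3) / 8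
      + (G ^ 4) / 9"
  have scale: "2520 * (4096 - (p0 + p1 / 2 + p2 / 3 + p3 / 4 + p4 / 5 + p5 / 6 + p6 / 7 + p7 / 8
      + p8 / 9)) = 10321920 - (2520 * p0 + 1260 * p1 + 840 * p2 + 630 * p3 + 504 * p4 + 420 * p5
      + 360 * p6 + 315 * p7 + 280 * p8)" for p0 p1 p2 p3 p4 p5 p6 p7 p8 :: real
    by simp
  have "2520 * (4096 - ?I) = 10321920 - (2520 * (A ^ 4) + 1260 * (4 * A ^ 3 * B)
      + 840 * (6 * A ^ 2 * B ^ 2 + 4 * A ^ 3 * G) + 630 * (4 * A * B ^ 3 + 12 * A ^ 2 * B * G)
      + 504 * (B ^ 4 + 12 * A * B ^ 2 * G + 6 * A ^ 2 * G ^ 2) + 420 * (4 * B ^ 3 * G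
      + 12 * A * B * G ^ 2) + 360 * (6 * B ^ 2 * G ^ 2 + 4 * A * G ^ 3) + 315 * (4 * B * G ^ 3)
      + 280 * (G ^ 4))"
    by (rule scale)
  also have "\<dots> = x ^ 1 * (2580480 * (1 - x) ^ 7 + 11719680 * x * (1 - x) ^ 6
      + 20986560 * x ^ 2 * (1 - x) ^ 5 + 19554696 * x ^ 3 * (1 - x) ^ 4 + 11350752 * x ^ 4 * (1 - x) ^ 3
      + 5290416 * x ^ 5 * (1 - x) ^ 2 + 2265120 * x ^ 6 * (1 - x) + 498440 * x ^ 7)"
    unfolding A_def B_def G_def by algebra
  also have "\<dots> > 0"
    using assms by (intro mult_pos_pos add_nonneg_pos add_nonneg_nonneg) auto
  finally have pos: "2520 * (4096 - ?I) > 0" .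
  have "I < 4096" if "2520 * (4096 - I) > 0" for I :: real
    using that by simp
  from this[OF pos] have I: "?I < 4096" .
  have eq: "8 * (1 - x + t * (x * (15/8 - 5/4 * x)) + t\<^sup>2 * x\<^sup>2) = A + t * B
      + t\<^sup>2 * G" for t
    by (simp add: A_def B_def G_def algebra_simps)
  have "4096 * (1 - x + t * (x * (15/8 - 5/4 * x)) + t\<^sup>2 * x\<^sup>2) ^ 4 = (A + t * B
      + t\<^sup>2 * G) ^ 4" for t
    unfolding eq [symmetric] power_mult_distrib by simp
  then have "integral {0..1} (\<lambda>t. 4096 * (1 - x + t * (x * (15/8 - 5/4 * x))
      + t\<^sup>2 * x\<^sup>2) ^ 4) = ?I"
    using integral_unique[OF has_integral_quadratic_power4[of A B G]] by presburger
  with I show ?thesis by simp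
qed

lemma quadratic_power5_integral_less_1:
  fixes x :: real
  assumes "0 < x" "x \<le> 1"
  shows "integral {0..1} (\<lambda>t. (1 - x + t * (x * (7/4 - 5/4 * x)) + t\<^sup>2 * x\<^sup>2) ^ 5) < 1"
proof -
  define A B G where "A = (4 * (1 - x))" and "B = (x * (7 - 5 * x))" and "G = (4 * x\<^sup>2)"
  let ?I = "(A ^ 5) + (5 * A ^ 4 * B) / 2 + (10 * A ^ 3 * B ^ 2 + 5 * A ^ 4 * G) / 3
      + (10 * A ^ 2 * B ^ 3 + 20 * A ^ 3 * B * G) / 4 + (5 * A * B ^ 4 + 30 * A ^ 2 * B ^ 2 * G
      + 10 * A ^ 3 * G ^ 2) / 5 + (B ^ 5 + 20 * A * B ^ 3 * G + 30 * A ^ 2 * B * G ^ 2) / 6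
      + (5 * B ^ 4 * G + 30 * A * B ^ 2 * G ^ 2 + 10 * A ^ 2 * G ^ 3) / 7 + (10 * B ^ 3 * G ^ 2
      + 20 * A * B * G ^ 3) / 8 + (10 * B ^ 2 * G ^ 3 + 5 * A * G ^ 4) / 9 + (5 * B * G ^ 4) / 10
      + (G ^ 5) / 11"
  have scale: "27720 * (1024 - (p0 + p1 / 2 + p2 / 3 + p3 / 4 + p4 / 5 + p5 / 6 + p6 / 7 + p7 / 8
      + p8 / 9 + p9 / 10 + p10 / 11)) = 28385280 - (27720 * p0 + 13860 * p1 + 9240 * p2 + 6930 * p3
      + 5544 * p4 + 4620 * p5 + 3960 * p6 + 3465 * p7 + 3080 * p8 + 2772 * p9
      + 2520 * p10)" for p0 p1 p2 p3 p4 p5 p6 p7 p8 p9 p10 :: real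
    by simp
  have "27720 * (1024 - ?I) = 28385280 - (27720 * (A ^ 5) + 13860 * (5 * A ^ 4 * B)
      + 9240 * (10 * A ^ 3 * B ^ 2 + 5 * A ^ 4 * G) + 6930 * (10 * A ^ 2 * B ^ 3 + 20 * A ^ 3 * B * G)
      + 5544 * (5 * A * B ^ 4 + 30 * A ^ 2 * B ^ 2 * G + 10 * A ^ 3 * G ^ 2) + 4620 * (B ^ 5
      + 20 * A * B ^ 3 * G + 30 * A ^ 2 * B * G ^ 2) + 3960 * (5 * B ^ 4 * G + 30 * A * B ^ 2 * G ^ 2
      + 10 * A ^ 2 * G ^ 3) + 3465 * (10 * B ^ 3 * G ^ 2 + 20 * A * B * G ^ 3)
      + 3080 * (10 * B ^ 2 * G ^ 3 + 5 * A * G ^ 4) + 2772 * (5 * B * G ^ 4) + 2520 * (G ^ 5))"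
    by (rule scale)
  also have "\<dots> = x ^ 1 * (17740800 * (1 - x) ^ 9 + 124185600 * x * (1 - x) ^ 8
      + 382536000 * x ^ 2 * (1 - x) ^ 7 + 688527840 * x ^ 3 * (1 - x) ^ 6
      + 813346380 * x ^ 4 * (1 - x) ^ 5 + 670329000 * x ^ 5 * (1 - x) ^ 4
      + 394796160 * x ^ 6 * (1 - x) ^ 3 + 162180480 * x ^ 7 * (1 - x) ^ 2 + 41659200 * x ^ 8 * (1 - x)
      + 4973440 * x ^ 9)"
    unfolding A_def B_def G_def by algebra
  also have "\<dots> > 0"
    using assms by (intro mult_pos_pos add_nonneg_pos add_nonneg_nonneg) auto
  finally have pos: "27720 * (1024 - ?I) > 0" .
  have "I < 1024" if "27720 * (1024 - I) > 0" for I :: real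
    using that by simp
  from this[OF pos] have I: "?I < 1024" .
  have eq: "4 * (1 - x + t * (x * (7/4 - 5/4 * x)) + t\<^sup>2 * x\<^sup>2) = A + t * B
      + t\<^sup>2 * G" for t
    by (simp add: A_def B_def G_def algebra_simps)
  have "1024 * (1 - x + t * (x * (7/4 - 5/4 * x)) + t\<^sup>2 * x\<^sup>2) ^ 5 = (A + t * B
      + t\<^sup>2 * G) ^ 5" for t
    unfolding eq [symmetric] power_mult_distrib by simp
  then have "integral {0..1} (\<lambda>t. 1024 * (1 - x + t * (x * (7/4 - 5/4 * x))
      + t\<^sup>2 * x\<^sup>2) ^ 5) = ?I"
    using integral_unique[OF has_integral_quadratic_power5[of A B G]] by presburger
  with I show ?thesis by simp
qed

text \<open>The slope \<open>2 - 2 * x\<close> is the bound on \<open>y\<close> that follows from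
  \<open>x \<le> 1 - C + R\<close>. The integral differs from 1 only in third order at
  \<open>x = 0\<close>, whence the factor \<open>x ^ 3\<close>.\<close>

lemma quadratic_power5_integral_less_1':
  fixes x :: real
  assumes "0 < x" "x \<le> 1"
  shows "integral {0..1} (\<lambda>t. (1 - x + t * (x * (2 - 2 * x)) + t\<^sup>2 * x\<^sup>2) ^ 5) < 1"
proof -
  define A B G where "A = (1 - x)" and "B = (2 * x * (1 - x))" and "G = (x\<^sup>2)"
  let ?I = "(A ^ 5) + (5 * A ^ 4 * B) / 2 + (10 * A ^ 3 * B ^ 2 + 5 * A ^ 4 * G) / 3
      + (10 * A ^ 2 * B ^ 3 + 20 * A ^ 3 * B * G) / 4 + (5 * A * B ^ 4 + 30 * A ^ 2 * B ^ 2 * G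
      + 10 * A ^ 3 * G ^ 2) / 5 + (B ^ 5 + 20 * A * B ^ 3 * G + 30 * A ^ 2 * B * G ^ 2) / 6
      + (5 * B ^ 4 * G + 30 * A * B ^ 2 * G ^ 2 + 10 * A ^ 2 * G ^ 3) / 7 + (10 * B ^ 3 * G ^ 2
      + 20 * A * B * G ^ 3) / 8 + (10 * B ^ 2 * G ^ 3 + 5 * A * G ^ 4) / 9 + (5 * B * G ^ 4) / 10
      + (G ^ 5) / 11"
  have scale: "27720 * (1 - (p0 + p1 / 2 + p2 / 3 + p3 / 4 + p4 / 5 + p5 / 6 + p6 / 7 + p7 / 8 + p8 / 9
      + p9 / 10 + p10 / 11)) = 27720 - (27720 * p0 + 13860 * p1 + 9240 * p2 + 6930 * p3 + 5544 * p4
      + 4620 * p5 + 3960 * p6 + 3465 * p7 + 3080 * p8 + 2772 * p9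
      + 2520 * p10)" for p0 p1 p2 p3 p4 p5 p6 p7 p8 p9 p10 :: real
    by simp
  have "27720 * (1 - ?I) = 27720 - (27720 * (A ^ 5) + 13860 * (5 * A ^ 4 * B)
      + 9240 * (10 * A ^ 3 * B ^ 2 + 5 * A ^ 4 * G) + 6930 * (10 * A ^ 2 * B ^ 3 + 20 * A ^ 3 * B * G)
      + 5544 * (5 * A * B ^ 4 + 30 * A ^ 2 * B ^ 2 * G + 10 * A ^ 3 * G ^ 2) + 4620 * (B ^ 5
      + 20 * A * B ^ 3 * G + 30 * A ^ 2 * B * G ^ 2) + 3960 * (5 * B ^ 4 * G + 30 * A * B ^ 2 * G ^ 2
      + 10 * A ^ 2 * G ^ 3) + 3465 * (10 * B ^ 3 * G ^ 2 + 20 * A * B * G ^ 3)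
      + 3080 * (10 * B ^ 2 * G ^ 3 + 5 * A * G ^ 4) + 2772 * (5 * B * G ^ 4) + 2520 * (G ^ 5))"
    by (rule scale)
  also have "\<dots> = x ^ 3 * (92400 * (1 - x) ^ 7 + 637560 * x * (1 - x) ^ 6
      + 1774080 * x ^ 2 * (1 - x) ^ 5 + 2541000 * x ^ 3 * (1 - x) ^ 4 + 2023560 * x ^ 4 * (1 - x) ^ 3
      + 930600 * x ^ 5 * (1 - x) ^ 2 + 234080 * x ^ 6 * (1 - x) + 25200 * x ^ 7)"
    unfolding A_def B_def G_def by algebra
  also have "\<dots> > 0"
    using assms by (intro mult_pos_pos add_nonneg_pos add_nonneg_nonneg) auto
  finally have pos: "27720 * (1 - ?I) > 0" .
  have "I < 1" if "27720 * (1 - I) > 0" for I :: real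
    using that by simp
  from this[OF pos] have I: "?I < 1" .
  have eq: "1 * (1 - x + t * (x * (2 - 2 * x)) + t\<^sup>2 * x\<^sup>2) = A + t * B + t\<^sup>2 * G" for t
    by (simp add: A_def B_def G_def algebra_simps)
  have "1 * (1 - x + t * (x * (2 - 2 * x)) + t\<^sup>2 * x\<^sup>2) ^ 5 = (A + t * B
      + t\<^sup>2 * G) ^ 5" for t
    unfolding eq [symmetric] power_mult_distrib by simp
  then have "integral {0..1} (\<lambda>t. 1 * (1 - x + t * (x * (2 - 2 * x))
      + t\<^sup>2 * x\<^sup>2) ^ 5) = ?I"
    using integral_unique[OF has_integral_quadratic_power5[of A B G]] by presburger
  with I show ?thesis by simp
qed

lemma linear_power4_integral_less:
  fixes s :: real
  assumes "0 \<le> s" "s < 1"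
  shows "integral {0..1} (\<lambda>t. (s + t * (1 - s\<^sup>2)) ^ 4) < 1"
proof -
  define B where "B = 1 - s\<^sup>2"
  have "5 * (1 - (s ^ 4 + 4 * s ^ 3 * B / 2 + 6 * s\<^sup>2 * B\<^sup>2 / 3 + 4 * s * B ^ 3 / 4
      + B ^ 4 / 5))
      = 5 - (5 * s ^ 4 + 10 * s ^ 3 * B + 10 * s\<^sup>2 * B\<^sup>2 + 5 * s * B ^ 3 + B ^ 4)"
    by (simp add: field_simps)
  also have "\<dots> = (1 - s) ^ 3 * (10 * s ^ 5 + 49 * (1 - s) * s ^ 4 + 88 * (1 - s)\<^sup>2 * s ^ 3
      + 71 * (1 - s) ^ 3 * s\<^sup>2 + 27 * (1 - s) ^ 4 * s + 4 * (1 - s) ^ 5)"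
    unfolding B_def by algebra
  also have "\<dots> > 0"
    using assms by (intro mult_pos_pos add_nonneg_pos add_nonneg_nonneg) auto
  finally have pos: "5 * (1 - (s ^ 4 + 4 * s ^ 3 * B / 2 + 6 * s\<^sup>2 * B\<^sup>2 / 3
      + 4 * s * B ^ 3 / 4 + B ^ 4 / 5)) > 0" .
  have "I < 1" if "5 * (1 - I) > 0" for I :: real using that by simp
  from this[OF pos] have "s ^ 4 + 4 * s ^ 3 * B / 2 + 6 * s\<^sup>2 * B\<^sup>2 / 3 + 4 * s * B ^ 3 / 4
      + B ^ 4 / 5 < 1" .
  then show ?thesis
    using integral_unique[OF has_integral_quadratic_power4[of s B 0]] by (simp add: B_def)
qed

section \<open>Exponential inequalities in one variable\<close>

lemma nonneg_if_DERIV_nonneg: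
  fixes f f' :: "real \<Rightarrow> real"
  assumes "\<And>x. (f has_real_derivative f' x) (at x)" "\<And>x. 0 \<le> x \<Longrightarrow> 0
      \<le> f' x" "0 \<le> f 0" "0 \<le> x"
  shows "0 \<le> f x"
  using DERIV_nonneg_imp_nondecreasing[of 0 x f] assms by force

text \<open>The quadratic is the second-order Taylor polynomial at 0 of the reciprocal of the
  integral of \<open>t * exp (- (v * t))\<close> over the unit interval. The difference cleared of
  denominators, \<open>h0\<close>, vanishes at 0 together with its first three derivatives, and its
  fourth factor in the chain, \<open>h4\<close>, is nonnegative.\<close>

lemma exp_quadratic_bound:
  fixes v :: real
  assumes "0 \<le> v"
  shows "(1 - (1 + v) * exp (- v)) * (2 + 4/3 * v + 7/18 * v\<^sup>2) \<le> v\<^sup>2"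
proof -
  define h0 where "h0 v = exp v * (11 * v\<^sup>2 - 24 * v - 36) + (36 + 60 * v + 31 * v\<^sup>2
      + 7 * v ^ 3)" for v :: real
  define h1 where "h1 v = exp v * (11 * v\<^sup>2 - 2 * v - 60) + (60 + 62 * v
      + 21 * v\<^sup>2)" for v :: real
  define h2 where "h2 v = exp v * (11 * v\<^sup>2 + 20 * v - 62) + (62 + 42 * v)" for v :: real
  define h3 where "h3 v = exp v * (11 * v\<^sup>2 + 42 * v - 42) + 42" for v :: real
  define h4 where "h4 v = exp v * (11 * v\<^sup>2 + 64 * v)" for v :: real
  have d: "(h0 has_real_derivative h1 v) (at v)" "(h1 has_real_derivative h2 v) (at v)"
    "(h2 has_real_derivative h3 v) (at v)" "(h3 has_real_derivative h4 v) (at v)" for v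
    unfolding h0_def h1_def h2_def h3_def h4_def
    by (auto intro!: derivative_eq_intros simp: algebra_simps power2_eq_square)
  have "0 \<le> h4 v" if "0 \<le> v" for v using that by (simp add: h4_def)
  then have "0 \<le> h3 v" if "0 \<le> v" for v
    using nonneg_if_DERIV_nonneg[OF d(4), of v] that by (simp add: h3_def)
  then have "0 \<le> h2 v" if "0 \<le> v" for v
    using nonneg_if_DERIV_nonneg[OF d(3), of v] that by (simp add: h2_def)
  then have "0 \<le> h1 v" if "0 \<le> v" for v
    using nonneg_if_DERIV_nonneg[OF d(2), of v] that by (simp add: h1_def)
  then have "0 \<le> h0 v"
    using nonneg_if_DERIV_nonneg[OF d(1), of v] assms by (simp add: h0_def)
  then have "0 \<le> exp (- v) * h0 v" by simp
  also have "exp (- v) * h0 v = 18 * v\<^sup>2 - (1 - (1 + v) * exp (- v)) * (36 + 24 * v + 7 * v\<^sup>2)"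
  proof -
    have "exp (- v) * exp v = 1" by (simp flip: exp_add)
    then show ?thesis unfolding h0_def by algebra
  qed
  finally show ?thesis by (simp add: field_simps)
qed

lemma integral_times_exp:
  fixes v :: real
  assumes "v > 0"
  shows "((\<lambda>t. t * exp (- (v * t))) has_integral (1 - (1 + v) * exp (- v)) / v\<^sup>2) {0..1}"
proof -
  let ?F = "\<lambda>t. - ((t / v + 1 / v\<^sup>2) * exp (- (v * t)))"
  have "((\<lambda>t. t * exp (- (v * t))) has_integral (?F 1 - ?F 0)) {0..1}"
    using assms
    by (intro fundamental_theorem_of_calculus)
      (auto intro!: derivative_eq_intros simp: field_simps power2_eq_square simp flip: has_real_derivative_iff_has_vector_derivative)
  then show ?thesis using assms by (simp add: field_simps power2_eq_square)
qed

lemma integral_times_exp_le: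
  fixes v w :: real
  assumes "0 < w" "w \<le> v"
  shows "integral {0..1} (\<lambda>t. t * exp (- (v * t))) \<le> 1 / (2 + 4/3 * w + 7/18 * w\<^sup>2)"
    and "integral {0..1} (\<lambda>t. t * exp (- (v * t))) \<le> 1 / w\<^sup>2"
proof -
  have v: "v > 0" using assms by simp
  have eq: "integral {0..1} (\<lambda>t. t * exp (- (v * t))) = (1 - (1 + v) * exp (- v)) / v\<^sup>2"
    using integral_times_exp[OF v] by (rule integral_unique)
  have mono: "2 + 4/3 * w + 7/18 * w\<^sup>2 \<le> 2 + 4/3 * v + 7/18 * v\<^sup>2" "w\<^sup>2
      \<le> v\<^sup>2"
    using assms by (auto intro!: add_mono power_mono mult_left_mono)
  have P: "2 + 4/3 * w + 7/18 * w\<^sup>2 > 0" "2 + 4/3 * v + 7/18 * v\<^sup>2 > 0"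
    using assms by (auto intro!: add_pos_nonneg)
  have "(1 - (1 + v) * exp (- v)) / v\<^sup>2 \<le> 1 / (2 + 4/3 * v + 7/18 * v\<^sup>2)"
    using exp_quadratic_bound[of v] v P(2) by (simp add: divide_le_eq pos_le_divide_eq mult.commute)
  also have "\<dots> \<le> 1 / (2 + 4/3 * w + 7/18 * w\<^sup>2)"
    using mono P by (intro divide_left_mono) auto
  finally show "integral {0..1} (\<lambda>t. t * exp (- (v * t))) \<le> 1 / (2 + 4/3 * w
      + 7/18 * w\<^sup>2)"
    by (simp add: eq)
  have "(1 - (1 + v) * exp (- v)) / v\<^sup>2 \<le> 1 / v\<^sup>2"
    using v by (intro divide_right_mono) auto
  also have "\<dots> \<le> 1 / w\<^sup>2" using mono assms by (intro divide_left_mono) auto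
  finally show "integral {0..1} (\<lambda>t. t * exp (- (v * t))) \<le> 1 / w\<^sup>2"
    by (simp add: eq)
qed

lemma strict_decreasing_pos:
  fixes f f' :: "real \<Rightarrow> real"
  assumes "\<And>x. 0 < x \<Longrightarrow> x < 1 \<Longrightarrow> (f has_real_derivative f' x) (at x)"
    and "\<And>x. 0 < x \<Longrightarrow> x < 1 \<Longrightarrow> f' x < 0"
    and "isCont f 1" "0 < s" "s < 1"
  shows "f 1 < f s"
proof (rule DERIV_neg_imp_decreasing_open[of s 1 f])
  show "s < 1" by fact
  show "\<exists>y. (f has_real_derivative y) (at x) \<and> y < 0" if "s < x" "x < 1" for x
  proof (intro exI conjI)
    have "0 < x" using assms(4) that by linarith
    then show "(f has_real_derivative f' x) (at x)" "f' x < 0"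
      using assms(1,2) that by blast+
  qed
  show "continuous_on {s..1} f"
  proof (intro continuous_at_imp_continuous_on ballI)
    fix x assume x: "x \<in> {s..1}"
    show "isCont f x"
    proof (cases "x = 1")
      case False
      then have "0 < x" "x < 1" using x assms(4) by auto
      then show ?thesis by (rule DERIV_isCont[OF assms(1)])
    qed (use assms(3) in simp)
  qed
qed

text \<open>This decides the sign of \<open>K'\<close> in \<open>exp_minus_id_less\<close>. The
  logarithms of both sides agree at \<open>s = 1\<close>, and the numerator of the derivative of
  their difference is negative with a factor \<open>(1 - s)^2\<close>.\<close>

lemma exp_pade_bound:
  fixes s :: real
  assumes "0 < s" "s < 1"
  shows "exp (3 * (1 - s)) * (3 * s\<^sup>2 - 2 * s ^ 3 + 3 * s ^ 4) < 3 + 3 * s\<^sup>2 - 2 * s ^ 3"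
proof -
  define N where "N s = 3 + 3 * s\<^sup>2 - 2 * s ^ 3" for s :: real
  define M where "M s = 3 * s\<^sup>2 - 2 * s ^ 3 + 3 * s ^ 4" for s :: real
  define N' where "N' s = 6 * s - 6 * s\<^sup>2" for s :: real
  define M' where "M' s = 6 * s - 6 * s\<^sup>2 + 12 * s ^ 3" for s :: real
  have dN: "(N has_real_derivative N' s) (at s)" "(M has_real_derivative M' s) (at s)" for s
    unfolding N_def M_def N'_def M'_def
    by (auto intro!: derivative_eq_intros simp: algebra_simps power2_eq_square power3_eq_cube)
  have pos: "N s > 0" "M s > 0" if "0 < s" "s \<le> 1" for s
  proof -
    have "s ^ 3 \<le> s\<^sup>2" using that by (intro power_decreasing) auto
    moreover have "s\<^sup>2 > 0" "s ^ 4 > 0" using that by auto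
    ultimately show "N s > 0" "M s > 0" unfolding N_def M_def by linarith+
  qed
  define f where "f s = ln (N s) - ln (M s) - 3 * (1 - s)" for s
  define f' where "f' s = N' s / N s - M' s / M s + 3" for s
  have df: "(f has_real_derivative f' s) (at s)" if "0 < s" "s \<le> 1" for s
    unfolding f_def f'_def using pos[OF that]
    by (auto intro!: derivative_eq_intros dN simp: divide_simps)
  have "f 1 < f s"
  proof (rule strict_decreasing_pos[OF _ _ _ assms])
    show "isCont f 1" using df[of 1] by (intro DERIV_isCont) auto
    show "f' s < 0" if s: "0 < s" "s < 1" for s
    proof -
      have q: "2 - s + 2 * s\<^sup>2 - s ^ 3 + 2 * s ^ 4 > 0"
      proof -
        have "s ^ 3 \<le> s\<^sup>2" using s by (intro power_decreasing) auto
        moreover have "s\<^sup>2 \<ge> 0" "s ^ 4 \<ge> 0" by auto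
        ultimately show ?thesis using s by linarith
      qed
      have "N' s * M s - M' s * N s + 3 * N s * M s = - (9 * s * (1 - s)\<^sup>2 * (2 - s
          + 2 * s\<^sup>2 - s ^ 3 + 2 * s ^ 4))"
        unfolding N_def M_def N'_def M'_def by algebra
      also have "\<dots> < 0" using s q by simp
      finally have *: "N' s * M s - M' s * N s + 3 * N s * M s < 0" .
      have "f' s = (N' s * M s - M' s * N s + 3 * N s * M s) / (N s * M s)"
        using pos[of s] s by (simp add: f'_def field_simps)
      also have "\<dots> < 0" using * pos[of s] s by (intro divide_neg_pos) auto
      finally show ?thesis .
    qed
  qed (use df in auto)
  moreover have "f 1 = 0" by (simp add: f_def N_def M_def)
  ultimately have "3 * (1 - s) + ln (M s) < ln (N s)" by (simp add: f_def)
  then have "exp (3 * (1 - s) + ln (M s)) < exp (ln (N s))" by simp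
  then show ?thesis using pos[of s] assms by (simp add: exp_add N_def M_def)
qed

lemma exp_minus_id_less:
  fixes X :: real
  assumes "X > 0"
  shows "exp (3 * X / (3 + X)) - 3 * X / (3 + X) < exp (- X) + X"
proof -
  txt \<open>In the parameter \<open>s = 3 / (3 + X)\<close> the exponent \<open>3 X / (3 + X)\<close> becomes \<open>3 (1 - s)\<close>.\<close>
  define Xf where "Xf s = 3 / s - 3" for s :: real
  define K where "K s = exp (Xf s) * (1 + s\<^sup>2) - s\<^sup>2 * exp (3 * (1 - s) + Xf s)" for s
  define G where "G s = exp (- Xf s) + Xf s - exp (3 * (1 - s)) + 3 * (1 - s)" for s
  define K' where "K' s = exp (Xf s) * (- (3 / s\<^sup>2) * (1 + s\<^sup>2) + 2 * s) - exp (3 * (1 - s)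
      + Xf s) * (2 * s + s\<^sup>2 * (- 3 - 3 / s\<^sup>2))" for s
  define G' where "G' s = - (3 / s\<^sup>2) * (1 - exp (- Xf s)) + 3 * (exp (3 * (1 - s)) - 1)" for s
  have dX: "(Xf has_real_derivative - (3 / s\<^sup>2)) (at s)" if "s > 0" for s
    unfolding Xf_def using that by (auto intro!: derivative_eq_intros simp: power2_eq_square)
  have dK: "(K has_real_derivative K' s) (at s)" if "s > 0" for s
    unfolding K_def K'_def by (rule derivative_eq_intros dX[OF that] refl)+ (simp add: algebra_simps)
  have dG: "(G has_real_derivative G' s) (at s)" if "s > 0" for s
    unfolding G_def G'_def by (rule derivative_eq_intros dX[OF that] refl)+ (simp add: algebra_simps diff_divide_distrib)
  \<comment> \<open>\<open>K s > 1\<close> is the condition \<open>G' s < 0\<close> multiplied by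
    positive factors, among them \<open>s^2\<close> and \<open>exp (Xf s)\<close>. Both functions
    decrease towards \<open>s = 1\<close>, that is \<open>X = 0\<close>, where \<open>K\<close> is 1
    and \<open>G\<close> is 0.\<close>
  have K: "K s > 1" if s: "0 < s" "s < 1" for s
  proof -
    have "K 1 < K s"
    proof (rule strict_decreasing_pos[OF _ _ _ s])
      show "isCont K 1" using dK[of 1] by (intro DERIV_isCont) auto
      show "K' s < 0" if s: "0 < s" "s < 1" for s
      proof -
        define r where "r = 3 / s\<^sup>2"
        have r: "r * s\<^sup>2 = 3" using s by (simp add: r_def)
        have "s\<^sup>2 * K' s = exp (Xf s) * (exp (3 * (1 - s)) * (3 * s\<^sup>2 - 2 * s ^ 3
            + 3 * s ^ 4) - (3 + 3 * s\<^sup>2 - 2 * s ^ 3))"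
        proof -
          have "s\<^sup>2 * (E * (- r * (1 + s\<^sup>2) + 2 * s) - U * E * (2 * s + s\<^sup>2 * (- 3 - r)))
            = E * (U * (3 * s\<^sup>2 - 2 * s ^ 3 + 3 * s ^ 4) - (3 + 3 * s\<^sup>2 - 2 * s ^ 3))" for E U
          proof -
            have "s\<^sup>2 * (E * (- r * (1 + s\<^sup>2) + 2 * s) - U * E * (2 * s
                + s\<^sup>2 * (- 3 - r)))
              = E * (- (r * s\<^sup>2) * (1 + s\<^sup>2) + 2 * s ^ 3) - U * E * (2 * s ^ 3 - 3 * s ^ 4 - (r * s\<^sup>2) * s\<^sup>2)"
              by algebra
            also have "\<dots> = E * (U * (3 * s\<^sup>2 - 2 * s ^ 3 + 3 * s ^ 4) - (3
                + 3 * s\<^sup>2 - 2 * s ^ 3))"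
              unfolding r by algebra
            finally show ?thesis .
          qed
          then show ?thesis unfolding K'_def exp_add r_def [symmetric] .
        qed
        also have "\<dots> < 0"
          using exp_pade_bound[OF s] by (intro mult_pos_neg) auto
        finally show ?thesis using s by (simp add: mult_less_0_iff)
      qed
    qed (use dK in auto)
    then show ?thesis by (simp add: K_def Xf_def)
  qed
  have G: "G s > 0" if s: "0 < s" "s < 1" for s
  proof -
    have "G 1 < G s"
    proof (rule strict_decreasing_pos[OF _ _ _ s])
      show "isCont G 1" using dG[of 1] by (intro DERIV_isCont) auto
      show "G' s < 0" if s: "0 < s" "s < 1" for s
      proof -
        have "exp (- Xf s) * K s = 1 + s\<^sup>2 - s\<^sup>2 * exp (3 * (1 - s))"
        proof -
          have "exp (- Xf s) * exp (Xf s) = 1" by (simp flip: exp_add)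
          then show ?thesis unfolding K_def exp_add by algebra
        qed
        moreover have "exp (- Xf s) < exp (- Xf s) * K s"
          using K[OF s] by simp
        ultimately have "exp (- Xf s) < 1 + s\<^sup>2 - s\<^sup>2 * exp (3 * (1 - s))" by linarith
        then have "s\<^sup>2 * (exp (3 * (1 - s)) - 1) < 1 - exp (- Xf s)"
          unfolding right_diff_distrib by linarith
        then have "exp (3 * (1 - s)) - 1 < (1 - exp (- Xf s)) / s\<^sup>2"
          using s by (simp add: pos_less_divide_eq mult.commute)
        then have "exp (3 * (1 - s)) - 1 - (1 - exp (- Xf s)) / s\<^sup>2 < 0"
          by (simp only: diff_less_0_iff_less)
        then have "3 * (exp (3 * (1 - s)) - 1 - (1 - exp (- Xf s)) / s\<^sup>2) < 0"
          by (rule mult_pos_neg[OF zero_less_numeral])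
        moreover have "G' s = 3 * (exp (3 * (1 - s)) - 1 - (1 - exp (- Xf s)) / s\<^sup>2)"
          by (simp add: G'_def)
        ultimately show ?thesis by (simp only:)
      qed
    qed (use dG in auto)
    then show ?thesis by (simp add: G_def Xf_def)
  qed
  define s where "s = 3 / (3 + X)"
  have s: "0 < s" "s < 1" using assms by (auto simp: s_def)
  have "Xf s = X" "3 * (1 - s) = 3 * X / (3 + X)"
    using assms by (auto simp: Xf_def s_def field_simps)
  then show ?thesis using G[OF s] by (simp add: G_def)
qed

section \<open>The weight integral from the lower bound for products\<close>

lemma weight_integral_le_5:
  "integral {0..1} (\<lambda>t. t * (1 + t / 4) * (1 - t * (16/25)) ^ 2) \<le> (499/2500 :: real)"
proof -
  have "t * (1 + t / 4) * (1 - t * (16/25)) ^ 2 = 1 * t ^ 1 + (-103 / 100) * t ^ 2 + (56 / 625) * t ^ 3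
      + (64 / 625) * t ^ 4" for t :: real
    by (simp add: field_simps eval_nat_numeral)
  moreover have "((\<lambda>t. 1 * t ^ 1 + (-103 / 100) * t ^ 2 + (56 / 625) * t ^ 3
      + (64 / 625) * t ^ 4) has_integral (1 * (1 / (real 1 + 1)) + (-103 / 100) * (1 / (real 2 + 1))
      + (56 / 625) * (1 / (real 3 + 1)) + (64 / 625) * (1 / (real 4 + 1)))) {0..1}"
    by (intro has_integral_add has_integral_mult_right has_integral_power_unit)
  ultimately have "((\<lambda>t. t * (1 + t / 4) * (1 - t * (16/25)) ^ 2) has_integral (1 * (1 / (real 1
      + 1)) + (-103 / 100) * (1 / (real 2 + 1)) + (56 / 625) * (1 / (real 3 + 1))
      + (64 / 625) * (1 / (real 4 + 1)))) {0..1}"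
    by presburger
  from integral_unique[OF this] show ?thesis by simp
qed

lemma weight_integral_le_6:
  "integral {0..1} (\<lambda>t. t * (1 + t / 5) * (1 - t * (3/5)) ^ 3) \<le> (7/50 :: real)"
proof -
  have "t * (1 + t / 5) * (1 - t * (3/5)) ^ 3 = 1 * t ^ 1 + (-8 / 5) * t ^ 2 + (18 / 25) * t ^ 3
      + (-27 / 625) * t ^ 5" for t :: real
    by (simp add: field_simps eval_nat_numeral)
  moreover have "((\<lambda>t. 1 * t ^ 1 + (-8 / 5) * t ^ 2 + (18 / 25) * t ^ 3 + (-27 / 625) * t ^ 5)
      has_integral (1 * (1 / (real 1 + 1)) + (-8 / 5) * (1 / (real 2 + 1)) + (18 / 25) * (1 / (real 3
      + 1)) + (-27 / 625) * (1 / (real 5 + 1)))) {0..1}"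
    by (intro has_integral_add has_integral_mult_right has_integral_power_unit)
  ultimately have "((\<lambda>t. t * (1 + t / 5) * (1 - t * (3/5)) ^ 3) has_integral (1 * (1 / (real 1
      + 1)) + (-8 / 5) * (1 / (real 2 + 1)) + (18 / 25) * (1 / (real 3 + 1))
      + (-27 / 625) * (1 / (real 5 + 1)))) {0..1}"
    by presburger
  from integral_unique[OF this] show ?thesis by simp
qed

lemma weight_integral_le_7:
  "integral {0..1} (\<lambda>t. t * (1 + t / 6) * (1 - t * (49/100)) ^ 4) \<le> (27/200 :: real)"
proof -
  have "t * (1 + t / 6) * (1 - t * (49/100)) ^ 4 = 1 * t ^ 1 + (-269 / 150) * t ^ 2
      + (16709 / 15000) * t ^ 3 + (-7203 / 31250) * t ^ 4 + (-6235397 / 300000000) * t ^ 5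
      + (5764801 / 600000000) * t ^ 6" for t :: real
    by (simp add: field_simps eval_nat_numeral)
  moreover have "((\<lambda>t. 1 * t ^ 1 + (-269 / 150) * t ^ 2 + (16709 / 15000) * t ^ 3
      + (-7203 / 31250) * t ^ 4 + (-6235397 / 300000000) * t ^ 5 + (5764801 / 600000000) * t ^ 6)
      has_integral (1 * (1 / (real 1 + 1)) + (-269 / 150) * (1 / (real 2 + 1))
      + (16709 / 15000) * (1 / (real 3 + 1)) + (-7203 / 31250) * (1 / (real 4 + 1))
      + (-6235397 / 300000000) * (1 / (real 5 + 1)) + (5764801 / 600000000) * (1 / (real 6 + 1)))) {0..1}"
    by (intro has_integral_add has_integral_mult_right has_integral_power_unit)
  ultimately have "((\<lambda>t. t * (1 + t / 6) * (1 - t * (49/100)) ^ 4)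
      has_integral (1 * (1 / (real 1 + 1)) + (-269 / 150) * (1 / (real 2 + 1))
      + (16709 / 15000) * (1 / (real 3 + 1)) + (-7203 / 31250) * (1 / (real 4 + 1))
      + (-6235397 / 300000000) * (1 / (real 5 + 1)) + (5764801 / 600000000) * (1 / (real 6 + 1)))) {0..1}"
    by presburger
  from integral_unique[OF this] show ?thesis by simp
qed

lemma weight_integral_le_8:
  "integral {0..1} (\<lambda>t. t * (1 + t / 7) * (1 - t * (1/2)) ^ 5) \<le> (1/10 :: real)"
proof -
  have "t * (1 + t / 7) * (1 - t * (1/2)) ^ 5 = 1 * t ^ 1 + (-33 / 14) * t ^ 2 + (15 / 7) * t ^ 3
      + (-25 / 28) * t ^ 4 + (15 / 112) * t ^ 5 + (3 / 224) * t ^ 6 + (-1 / 224) * t ^ 7" for t :: real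
    by (simp add: field_simps eval_nat_numeral)
  moreover have "((\<lambda>t. 1 * t ^ 1 + (-33 / 14) * t ^ 2 + (15 / 7) * t ^ 3 + (-25 / 28) * t ^ 4
      + (15 / 112) * t ^ 5 + (3 / 224) * t ^ 6 + (-1 / 224) * t ^ 7) has_integral (1 * (1 / (real 1
      + 1)) + (-33 / 14) * (1 / (real 2 + 1)) + (15 / 7) * (1 / (real 3 + 1))
      + (-25 / 28) * (1 / (real 4 + 1)) + (15 / 112) * (1 / (real 5 + 1)) + (3 / 224) * (1 / (real 6
      + 1)) + (-1 / 224) * (1 / (real 7 + 1)))) {0..1}"
    by (intro has_integral_add has_integral_mult_right has_integral_power_unit)
  ultimately have "((\<lambda>t. t * (1 + t / 7) * (1 - t * (1/2)) ^ 5) has_integral (1 * (1 / (real 1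
      + 1)) + (-33 / 14) * (1 / (real 2 + 1)) + (15 / 7) * (1 / (real 3 + 1))
      + (-25 / 28) * (1 / (real 4 + 1)) + (15 / 112) * (1 / (real 5 + 1)) + (3 / 224) * (1 / (real 6
      + 1)) + (-1 / 224) * (1 / (real 7 + 1)))) {0..1}"
    by presburger
  from integral_unique[OF this] show ?thesis by simp
qed

lemma mult_le_one_of_le_one:
  fixes t D :: real
  assumes "0 \<le> t" "t \<le> 1" "D \<le> 1"
  shows "t * D \<le> 1"
  using mult_left_mono[OF assms(3,1)] assms(2) by simp

lemma weight_integral_mono:
  fixes D D\<^sub>0 r :: real
  assumes "D\<^sub>0 \<le> D" "D \<le> 1" "0 < r"
  shows "integral {0..1} (\<lambda>t. t * (1 + t / r) * (1 - t * D) ^ p)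
      \<le> integral {0..1} (\<lambda>t. t * (1 + t / r) * (1 - t * D\<^sub>0) ^ p)"
proof (rule integral_le)
  fix t :: real assume t: "t \<in> {0..1}"
  have "t * D \<le> 1" using t assms by (intro mult_le_one_of_le_one) auto
  moreover have "t * D\<^sub>0 \<le> t * D" using t assms by (intro mult_left_mono) auto
  ultimately show "t * (1 + t / r) * (1 - t * D) ^ p \<le> t * (1 + t / r) * (1 - t * D\<^sub>0) ^ p"
    using t assms by (intro mult_left_mono power_mono) auto
qed (use assms in \<open>auto intro!: integrable_continuous_real continuous_intros\<close>)

text \<open>This is the hypothesis \<open>est\<close> of \<open>contradiction_criterion\<close> for
  \<open>\<eta> = 1\<close> and \<open>\<theta> = 1 - C\<close>; the thresholds for
  \<open>\<theta>\<close> are complementary to those in \<open>C_lower_bounds\<close>.\<close>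

lemma weight_integral_small:
  fixes m :: nat and \<theta> D :: real
  assumes m: "5 \<le> m" "m \<le> 8" and \<theta>: "0 \<le> \<theta>" "\<theta> \<le> (if m
      \<le> 6 then 1/10 else 7/32)"
    and D: "D = 1 - sqrt (m * \<theta> / (m - 1))"
  shows "\<theta> ^ m + m * (1 - \<theta>) * integral {0..1} (\<lambda>t. t * (1
      + t / (m - 1)) * (1 - t * D) ^ (m - 3)) \<le> 1"
proof -
  define J where "J = integral {0..1} (\<lambda>t. t * (1 + t / (m - 1)) * (1 - t * D) ^ (m - 3))"
  have D1: "D \<le> 1" using \<theta> m by (simp add: D)
  have lower: "D\<^sub>0 \<le> D" if "m * \<theta> / (m - 1) \<le> (1 - D\<^sub>0)\<^sup>2" "D\<^sub>0
      \<le> 1" for D\<^sub>0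
  proof -
    have "sqrt (m * \<theta> / (m - 1)) \<le> 1 - D\<^sub>0" using that by (intro real_le_lsqrt) auto
    then show ?thesis by (simp add: D)
  qed
  have J0: "0 \<le> J"
    unfolding J_def
  proof (rule integral_nonneg)
    fix t :: real assume t: "t \<in> {0..1}"
    have "t * D \<le> 1" using t D1 by (intro mult_le_one_of_le_one) auto
    then show "0 \<le> t * (1 + t / (m - 1)) * (1 - t * D) ^ (m - 3)" using t by simp
  qed (use m in \<open>auto intro!: integrable_continuous_real continuous_intros\<close>)
  have reduce: ?thesis if "m * J \<le> b" "\<theta> ^ m \<le> c" "c + b \<le> 1" for b c
  proof -
    have "(1 - \<theta>) * (m * J) \<le> 1 * (m * J)" using \<theta> J0 by (intro mult_right_mono) auto
    moreover have "m * (1 - \<theta>) * J = (1 - \<theta>) * (m * J)" by simp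
    ultimately show ?thesis using that unfolding J_def [symmetric] by linarith
  qed
  consider "m = 5" | "m = 6" | "m = 7" | "m = 8" using m by linarith
  then show ?thesis
  proof cases
    case 1
    have "\<theta> ^ 5 \<le> (1/10) ^ 5" using \<theta> 1 by (intro power_mono) auto
    moreover have "16/25 \<le> D" using \<theta> 1 by (intro lower) (auto simp: power2_eq_square)
    ultimately show ?thesis
      using weight_integral_mono[of "16/25" D 4 2] weight_integral_le_5 D1 1
      by (intro reduce[of "2495/2500" "1/100000"]) (auto simp: J_def power_divide)
  next
    case 2
    have "\<theta> ^ 6 \<le> (1/10) ^ 6" using \<theta> 2 by (intro power_mono) auto
    moreover have "3/5 \<le> D" using \<theta> 2 by (intro lower) (auto simp: power2_eq_square)
    ultimately show ?thesis
      using weight_integral_mono[of "3/5" D 5 3] weight_integral_le_6 D1 2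
      by (intro reduce[of "42/50" "1/1000000"]) (auto simp: J_def power_divide)
  next
    case 3
    have "\<theta> ^ 7 \<le> (1/4) ^ 7" using \<theta> 3 by (intro power_mono) auto
    moreover have "49/100 \<le> D" using \<theta> 3 by (intro lower) (auto simp: power2_eq_square)
    ultimately show ?thesis
      using weight_integral_mono[of "49/100" D 6 4] weight_integral_le_7 D1 3
      by (intro reduce[of "189/200" "1/16384"]) (auto simp: J_def power_divide)
  next
    case 4
    have "\<theta> ^ 8 \<le> (1/4) ^ 8" using \<theta> 4 by (intro power_mono) auto
    moreover have "1/2 \<le> D" using \<theta> 4 by (intro lower) (auto simp: power2_eq_square)
    ultimately show ?thesis
      using weight_integral_mono[of "1/2" D 7 5] weight_integral_le_8 D1 4
      by (intro reduce[of "8/10" "1/65536"]) (auto simp: J_def power_divide)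
  qed
qed

lemma weight_integral_le_exp:
  fixes m :: nat and D :: real
  assumes m: "m \<ge> 4" and D: "D \<le> 1"
  shows "integral {0..1} (\<lambda>t. t * (1 + t / (m - 1)) * (1 - t * D) ^ (m - 3))
    \<le> integral {0..1} (\<lambda>t. t * exp (- (((m - 3) * D - 1 / (m - 1)) * t)))"
proof (rule integral_le)
  fix t :: real assume t: "t \<in> {0..1}"
  have tD: "0 \<le> 1 - t * D" using mult_le_one_of_le_one[of t D] t D by simp
  have "1 + t / (m - 1) \<le> exp (t / (m - 1))" by (rule exp_ge_add_one_self)
  moreover have "(1 - t * D) ^ (m - 3) \<le> exp (- (t * D)) ^ (m - 3)"
    using exp_ge_add_one_self[of "- (t * D)"] tD by (intro power_mono) auto
  ultimately have "(1 + t / (m - 1)) * (1 - t * D) ^ (m - 3)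
      \<le> exp (t / (m - 1)) * exp (- (t * D)) ^ (m - 3)"
    using t tD by (intro mult_mono) auto
  also have "\<dots> = exp (- (((m - 3) * D - 1 / (m - 1)) * t))"
    by (simp add: algebra_simps flip: exp_add exp_of_nat_mult)
  finally show "t * (1 + t / (m - 1)) * (1 - t * D) ^ (m - 3)
      \<le> t * exp (- (((m - 3) * D - 1 / (m - 1)) * t))"
    using t by (simp add: mult_left_mono mult.assoc)
qed (use m in \<open>auto intro!: integrable_continuous_real continuous_intros\<close>)

lemma sqrt_one_minus_le:
  fixes d :: real
  assumes "0 \<le> d" "d \<le> 1"
  shows "sqrt (1 - d) \<le> 1 - d / 2 - d\<^sup>2 / 8"
proof (rule real_le_lsqrt)
  have "d\<^sup>2 \<le> 1" using assms by (simp add: power_le_one)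
  then show "0 \<le> 1 - d / 2 - d\<^sup>2 / 8" using assms by simp
  have "(1 - d / 2 - d\<^sup>2 / 8)\<^sup>2 = 1 - d + d ^ 3 / 8 + d ^ 4 / 64"
    by (simp add: field_simps power2_eq_square eval_nat_numeral)
  then show "1 - d \<le> (1 - d / 2 - d\<^sup>2 / 8)\<^sup>2" using assms by simp
qed

text \<open>Here \<open>k\<close> is \<open>m * C\<close>, so that \<open>m - k\<close> is
  \<open>m * \<theta>\<close>. A bound linear in \<open>k\<close> and free of \<open>m\<close>
  reduces the remaining estimate essentially to one variable.\<close>

lemma decay_rate_lower_bound:
  fixes m :: nat and k D :: real
  assumes m: "m \<ge> 9" and k: "22/5 \<le> k" "k \<le> m" "m \<le> 10 \<Longrightarrow> k \<ge> 5/8 * m"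
    and D: "D = 1 - sqrt ((m - k) / (m - 1))"
  shows "(117 * k - 171) / 250 \<le> (m - 3) * D - 1 / (m - 1)"
proof -
  \<comment> \<open>The tangent of the square root at 4/9. For \<open>k = 5/8 * m\<close> the
    argument is 27/64 when \<open>m = 9\<close> and 5/12 when \<open>m = 10\<close>, both close to
    4/9.\<close>
  have sq: "sqrt w \<le> 1/3 + 3/4 * w" if "w \<ge> 0" for w :: real
  proof (rule real_le_lsqrt)
    show "w \<le> (1/3 + 3/4 * w)\<^sup>2"
      using zero_le_power2[of "1/3 - 3/4 * w"] by (simp add: power2_eq_square algebra_simps)
  qed (use that in auto)
  consider "m = 9" | "m = 10" | "m \<ge> 11" using m by linarith
  then show ?thesis
  proof cases
    case 1
    then have "D \<ge> 1 - (1/3 + 3/4 * ((9 - k) / 8))" using sq[of "(9 - k) / 8"] k by (simp add: D)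
    moreover have "k \<ge> 45/8" using k(3) 1 by simp
    ultimately have "(117 * k - 171) / 250 \<le> 6 * D - 1 / 8" by argo
    then show ?thesis using 1 by simp
  next
    case 2
    then have "D \<ge> 1 - (1/3 + 3/4 * ((10 - k) / 9))" using sq[of "(10 - k) / 9"] k by (simp add: D)
    moreover have "k \<ge> 25/4" using k(3) 2 by simp
    ultimately have "(117 * k - 171) / 250 \<le> 7 * D - 1 / 9" by argo
    then show ?thesis using 2 by simp
  next
    case 3
    define N where "N = real m - 1"
    have N: "N \<ge> 10" "real (m - 1) = N" "real (m - 3) = N - 2" using 3 by (auto simp: N_def)
    define d where "d = (k - 1) / N"
    have d: "0 \<le> d" "d \<le> 1" using k N by (auto simp: d_def N_def)
    have "(m - k) / real (m - 1) = 1 - d" using N by (simp add: d_def N_def field_simps)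
    then have "D \<ge> d / 2 + d\<^sup>2 / 8" using sqrt_one_minus_le[OF d] by (simp add: D)
    then have "(N - 2) * (d / 2 + d\<^sup>2 / 8) \<le> (N - 2) * D" using N by (intro mult_left_mono) auto
    then have le: "(N - 2) * (d / 2 + d\<^sup>2 / 8) - 1 / N \<le> (m - 3) * D - 1 / (m - 1)"
      unfolding N(2,3) by linarith
    have eq: "(N - 2) * (d / 2 + d\<^sup>2 / 8) - 1 / N - (117 * k - 171) / 250
        = 4/125 * k + 23/125 + (1 / N) * ((1/10) * (k - 1)\<^sup>2 - k) + (N - 10) * (k - 1)\<^sup>2 / (40 * N\<^sup>2)"
      using N by (simp add: d_def field_simps power2_eq_square)
    have p: "4/125 * k + 23/125 + (1 / N) * ((1/10) * (k - 1)\<^sup>2 - k) \<ge> 0"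
    proof (cases "(1/10) * (k - 1)\<^sup>2 - k \<ge> 0")
      case True
      then have "(1 / N) * ((1/10) * (k - 1)\<^sup>2 - k) \<ge> 0" using N by simp
      then show ?thesis using k by linarith
    next
      case False
      have "(1 / N) * ((1/10) * (k - 1)\<^sup>2 - k) \<ge> (1 / 10) * ((1/10) * (k - 1)\<^sup>2 - k)"
        using False N by (intro mult_right_mono_neg) (auto simp: field_simps)
      moreover have "4/125 * k + 23/125 + (1 / 10) * ((1/10) * (k - 1)\<^sup>2 - k)
          = (1/100) * (k - 22/5)\<^sup>2 + 1/2500"
        by (simp add: field_simps power2_eq_square)
      moreover have "(1/100) * (k - 22/5)\<^sup>2 \<ge> 0" by simp
      ultimately show ?thesis by linarith
    qed
    have q: "(N - 10) * (k - 1)\<^sup>2 / (40 * N\<^sup>2) \<ge> 0" using N by simp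
    have "0 \<le> (N - 2) * (d / 2 + d\<^sup>2 / 8) - 1 / N - (117 * k - 171) / 250"
      unfolding eq using p q by (rule add_nonneg_nonneg)
    then have "(117 * k - 171) / 250 \<le> (N - 2) * (d / 2 + d\<^sup>2 / 8) - 1 / N" by simp
    then show ?thesis using le by (rule order_trans)
  qed
qed

lemma power_complement_le_exp:
  fixes k :: real
  assumes "m > 0" "0 \<le> k" "k \<le> real m" "c \<le> k"
  shows "(1 - k / m) ^ m \<le> exp (- c)"
proof -
  have "(1 - k / m) ^ m \<le> exp (- (k / m)) ^ m"
    using exp_ge_add_one_self[of "- (k / m)"] assms by (intro power_mono) auto
  also have "\<dots> = exp (- k)" using assms by (simp flip: exp_of_nat_mult)
  finally show ?thesis using assms by (smt (verit) exp_le_cancel_iff)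
qed

lemma exp_minus_nat_le: "exp (- real j) \<le> (2/5) ^ j"
proof -
  have "5/2 \<le> exp (1::real)" using exp_lower_Taylor_quadratic[of 1] by simp
  then have "exp (- 1 :: real) \<le> 2/5" by (simp add: exp_minus field_simps)
  then have "exp (- 1 :: real) ^ j \<le> (2/5) ^ j" by (intro power_mono) auto
  then show ?thesis by (simp flip: exp_of_nat_mult)
qed

text \<open>\<open>L\<close> stands for the integral of \<open>t * exp (- (v * t))\<close>, whose
  rate is known only through a lower bound, and \<open>e\<close> for
  \<open>k * (1 - \<eta>)\<close>. The first bound on \<open>L\<close> serves for moderate
  \<open>k\<close> or \<open>e = 0\<close>, the second from \<open>k = 41/5\<close> on.\<close>

lemma large_degree_estimate:
  fixes m :: nat and k L :: real
  assumes m: "m \<ge> 9" and k: "22/5 \<le> k" "k \<le> m"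
    and L: "\<And>w. 0 < w \<Longrightarrow> w \<le> (117 * k - 171) / 250 \<Longrightarrow> L
        \<le> 1 / (2 + 4/3 * w + 7/18 * w\<^sup>2) \<and> L \<le> 1 / w\<^sup>2"
    and e: "e = 0 \<or> m \<ge> 11 \<and> e = max 0 (k - 6)"
  shows "(1 - k / m) ^ m + k * L + e / (m + 2) \<le> 1"
proof -
  define w where "w = (117 * k - 171) / 250"
  have w: "w > 0" using k by (simp add: w_def)
  have Lw: "L \<le> 1 / (2 + 4/3 * w + 7/18 * w\<^sup>2)" "L \<le> 1 / w\<^sup>2"
    using L[OF w eq_refl[OF w_def]] by auto
  have L1: "k * L \<le> k / (2 + 4/3 * w + 7/18 * w\<^sup>2)" and L2: "k * L \<le> k / w\<^sup>2"
    using Lw[THEN mult_left_mono, of k] k by simp_all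
  have P: "2 + 4/3 * w + 7/18 * w\<^sup>2 > 0" using w by (auto intro!: add_pos_nonneg)
  have pw: "(1 - k / m) ^ m \<le> exp (- c)" if "c \<le> k" for c
    using power_complement_le_exp[of m k c] m k that by simp
  show ?thesis
  proof (cases "e = 0 \<or> k \<le> 6")
    case True
    then have e0: "e = 0" using e by auto
    have "(1 - k / m) ^ m \<le> 16/625" using pw[of 4] exp_minus_nat_le[of 4] k by (simp add: power_divide)
    \<comment> \<open>\<open>609/625\<close> is what the exponential bound 16/625 leaves of 1; the
      constants with denominators 15625 and 390625 below arise likewise. Replacing
      \<open>w^2\<close> by its tangent at 111/100 makes the claim linear in
      \<open>w\<close>.\<close>
    moreover have "k / (2 + 4/3 * w + 7/18 * w\<^sup>2) \<le> 609/625"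
    proof -
      have "w\<^sup>2 \<ge> 111/50 * w - 12321/10000"
        using zero_le_power2[of "w - 111/100"] by (simp add: power2_eq_square algebra_simps)
      moreover have "k = (250 * w + 171) / 117" unfolding w_def by (simp add: field_simps)
      ultimately have "k \<le> 609/625 * (2 + 4/3 * w + 7/18 * w\<^sup>2)" using w by simp
      then show ?thesis using P by (simp add: divide_le_eq)
    qed
    ultimately have "(1 - k / m) ^ m + k * L \<le> 1" using L1 by linarith
    then show ?thesis by (simp add: e0)
  next
    case False
    then have e': "m \<ge> 11" "e = k - 6" "k > 6" using e by auto
    have m': "real m \<ge> 11" using e' by simp
    consider "k \<le> 41/5" | "41/5 \<le> k" "k \<le> 11" | "11 \<le> k" by linarith
    then show ?thesis
    proof cases
      case 1
      have "(1 - k / m) ^ m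
          \<le> 64/15625" using pw[of 6] exp_minus_nat_le[of 6] e' by (simp add: power_divide)
      moreover have "e / (m + 2) \<le> (k - 6) / 13" using e' m' by (intro frac_le) auto
      moreover have "k / (2 + 4/3 * w + 7/18 * w\<^sup>2) \<le> 15561/15625 - (k - 6) / 13"
      proof -
        \<comment> \<open>The cubic in \<open>k\<close> is written in the Bernstein basis of the
          interval from 6 to 41/5, where all coefficients are positive; the next case does the same
          from 41/5 to 11.\<close>
        have "(15561/15625 - (k - 6) / 13) * (2 + 4/3 * w + 7/18 * w\<^sup>2) - k =
          (99333453 / 1890625000) * ((41 / 5) - k) ^ 3 + (632467041 / 4726562500) * (k - 6) * ((41 / 5) - k) ^ 2 + (1178205183 / 11816406250) * (k - 6) ^ 2 * ((41 / 5) - k) + (70225284 / 5908203125) * (k - 6) ^ 3"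
          by (simp add: w_def field_simps power2_eq_square power3_eq_cube)
        also have "\<dots> \<ge> 0" using 1 e' by (intro add_nonneg_nonneg mult_nonneg_nonneg zero_le_power) auto
        finally show ?thesis using P by (simp add: pos_divide_le_eq)
      qed
      ultimately show ?thesis using L1 by linarith
    next
      case 2
      have "(1 - k / m) ^ m
          \<le> 256/390625" using pw[of 8] exp_minus_nat_le[of 8] 2 by (simp add: power_divide)
      moreover have "e / (m + 2) \<le> (k - 6) / 13" using e' m' by (intro frac_le) auto
      moreover have "k / w\<^sup>2 \<le> 390369/390625 - (k - 6) / 13"
      proof -
        have "(390369/390625 - (k - 6) / 13) * w\<^sup>2 - k =
          (110375077277 / 43544921875000) * (11 - k) ^ 3 + (4137362665487 / 43544921875000) * (k - (41 / 5)) * (11 - k) ^ 2 + (1447994217557 / 8708984375000) * (k - (41 / 5)) ^ 2 * (11 - k) + (99173546233 / 1741796875000) * (k - (41 / 5)) ^ 3"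
          by (simp add: w_def field_simps power2_eq_square power3_eq_cube)
        also have "\<dots> \<ge> 0" using 2 by (intro add_nonneg_nonneg mult_nonneg_nonneg zero_le_power) auto
        finally show ?thesis using w by (simp add: pos_divide_le_eq)
      qed
      ultimately show ?thesis using L2 by linarith
    next
      case 3
      have "exp (- k) \<le> 2 / k\<^sup>2"
      proof -
        have "k\<^sup>2 / 2 \<le> exp k" using exp_lower_Taylor_quadratic[of k] 3 by simp
        then have "1 / exp k \<le> 1 / (k\<^sup>2 / 2)" using 3 by (intro divide_left_mono) auto
        then show ?thesis by (simp add: exp_minus inverse_eq_divide)
      qed
      then have "(1 - k / m) ^ m \<le> 2 / k\<^sup>2" using pw[of k] by simp
      also have "\<dots> \<le> (2/11) / k" using 3 by (simp add: field_simps power2_eq_square)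
      finally have 1: "(1 - k / m) ^ m \<le> (2/11) / k" .
      \<comment> \<open>For large \<open>k\<close> the denominator 13 is useless, as
        \<open>(k - 6) / 13\<close> grows beyond 1; \<open>k \<le> m\<close> replaces
        \<open>11 \<le> m\<close>.\<close>
      have "e / (m + 2) \<le> (k - 6) / (k + 2)" using e' k by (intro frac_le) auto
      also have "\<dots> = 1 - 8 / (k + 2)" using 3 by (simp add: field_simps)
      finally have 2: "e / (m + 2) \<le> 1 - 8 / (k + 2)" .
      have "(2/5 * k)\<^sup>2 \<le> w\<^sup>2" using 3 by (intro power_mono) (auto simp: w_def)
      then have "k / w\<^sup>2 \<le> k / (2/5 * k)\<^sup>2" using 3 w by (intro divide_left_mono) auto
      also have "\<dots> = (25/4) / k" using 3 by (simp add: power2_eq_square field_simps)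
      finally have 3: "k / w\<^sup>2 \<le> (25/4) / k" .
      have "(2/11) / k + (25/4) / k \<le> 8 / (k
          + 2)" using \<open>11 \<le> k\<close> by (simp add: field_simps)
      then show ?thesis using 1 2 3 L2 by linarith
    qed
  qed
qed

section \<open>Nonexistence of such configurations\<close>

context reciprocal_configuration
begin

text \<open>AM-GM with a free weight \<open>w\<close> removes the square root from
  \<open>y \<le> 2 sqrt ((1 - x) C)\<close>, so that the resulting integrals are polynomials in
  \<open>x\<close>.\<close>

lemma y_le_affine:
  assumes "w > 0"
  shows "y \<le> w * (1 - x) + C / w"
proof (rule power2_le_imp_le)
  have am_gm: "4 * p * q \<le> (p + q)\<^sup>2" for p q :: real
    using sum_squares_bound[of p q] by (simp add: power2_sum)
  have "4 * (1 - x) * C = 4 * (w * (1 - x)) * (C / w)" using assms by simp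
  also have "\<dots> \<le> (w * (1 - x) + C / w)\<^sup>2" by (rule am_gm)
  finally show "y\<^sup>2 \<le> (w * (1 - x) + C / w)\<^sup>2" using y_square_le by linarith
  show "0 \<le> w * (1 - x) + C / w" using assms x_bounds C_nonneg by simp
qed

text \<open>The exponent \<open>m / 2\<close> may be raised to any \<open>1 / e \<ge> m / 2\<close>:
  by concavity the integral of a power of \<open>U\<close> with exponent at most 1 can reach 1 only
  if that of \<open>U\<close> does. One inequality thus covers several degrees.\<close>

lemma integral_Va_le:
  assumes "\<And>t. t \<in> {0..1} \<Longrightarrow> Va t
      \<le> (U t) powr e" "\<And>t. t \<in> {0..1} \<Longrightarrow> 0 \<le> U t"
    and "continuous_on {0..1} U" "0 < e" "m / 2 * e \<le> 1"
  shows "1 \<le> integral {0..1} U"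
proof -
  let ?r = "m / 2 * e"
  have r: "0 < ?r" using m_pos assms by simp
  have intU: "U integrable_on {0..1}" using assms by (intro integrable_continuous_real)
  have "1 \<le> integral {0..1} (\<lambda>t. Va t powr (m / 2))" by (rule one_le_integral_Va)
  also have "\<dots> \<le> integral {0..1} (\<lambda>t. 1 + ?r * (U t - 1))"
  proof (rule integral_le)
    fix t :: real assume t: "t \<in> {0..1}"
    have "Va t powr (m / 2) \<le> (U t powr e) powr (m / 2)"
      using assms t Va_nonneg by (intro powr_mono2) auto
    also have "\<dots> = U t powr ?r" by (simp add: powr_powr mult.commute)
    also have "\<dots> \<le> 1 + ?r * (U t - 1)" using assms t r by (intro powr_le_affine) auto
    finally show "Va t powr (m / 2) \<le> 1 + ?r * (U t - 1)" .
  qed (use assms in \<open>auto intro!: integrable_continuous_real continuous_intros cont_Va_powr\<close>)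
  also have "\<dots> = 1 + ?r * (integral {0..1} U - 1)"
  proof (rule integral_unique)
    have "((\<lambda>_::real. 1::real)
        has_integral 1) {0..1}" using has_integral_const_real[of "1::real" 0 1] by simp
    then show "((\<lambda>t. 1 + ?r * (U t - 1)) has_integral 1 + ?r * (integral {0..1} U - 1)) {0..1}"
      by (intro has_integral_add has_integral_mult_right has_integral_diff integrable_integral intU)
  qed
  finally have "0 \<le> ?r * (integral {0..1} U - 1)" by simp
  then show ?thesis using r by (simp add: zero_le_mult_iff)
qed

lemma integral_quadratic_power_ge_1:
  assumes "y \<le> Y" "q > 0" "m \<le> 2 * q"
  shows "1 \<le> integral {0..1} (\<lambda>t. (1 - x + t * (x * Y) + t\<^sup>2 * x\<^sup>2) ^ q)"
proof (rule integral_Va_le[where e = "1 / real q"])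
  fix t :: real assume t: "t \<in> {0..1}"
  have le: "Va t \<le> 1 - x + t * (x * Y) + t\<^sup>2 * x\<^sup>2"
    using assms t x_bounds by (simp add: Va_def mult_left_mono mult.assoc)
  then have nn: "0 \<le> 1 - x + t * (x * Y) + t\<^sup>2 * x\<^sup>2" using Va_nonneg[of t] by linarith
  then show "0 \<le> (1 - x + t * (x * Y) + t\<^sup>2 * x\<^sup>2) ^ q" by simp
  have "(w ^ q) powr (1 / q) = w" if "0 \<le> w" for w :: real
    using that assms by (cases "w = 0") (auto simp: powr_powr simp flip: powr_realpow)
  then show "Va t \<le> ((1 - x + t * (x * Y) + t\<^sup>2 * x\<^sup>2) ^ q) powr (1 / real q)"
    using le nn by simp
qed (use assms in \<open>auto intro!: continuous_intros simp: field_simps\<close>)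

text \<open>With \<open>C \<le> 1\<close> alone one has \<open>y \<le> 2 * s\<close> for
  \<open>s = cmod a\<close>, which bounds \<open>Va\<close> by the perfect square
  \<open>(s + t * x)^2\<close>; for \<open>m \<le> 4\<close> the fourth power of its root
  suffices.\<close>

lemma degree_gt_4: "m > 4"
proof (rule ccontr)
  assume m: "\<not> m > 4"
  define s where "s = cmod a"
  have s: "0 \<le> s" "s < 1" "1 - x = s\<^sup>2" "x
      = 1 - s\<^sup>2" using a_less by (auto simp: s_def x_def)
  have "y\<^sup>2 \<le> 4 * (1 - x) * 1"
    using y_square_le C_le_1 x_bounds mult_left_mono[of C 1 "4 * (1 - x)"] by simp
  then have "y\<^sup>2 \<le> (2 * s)\<^sup>2" by (simp add: s power_mult_distrib)
  then have y: "y \<le> 2 * s" by (rule power2_le_imp_le) (use s in simp)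
  have "1 \<le> integral {0..1} (\<lambda>t. (s + t * (1 - s\<^sup>2)) ^ 4)"
  proof (rule integral_Va_le[where e = "1 / 2"])
    fix t :: real assume t: "t \<in> {0..1}"
    have "Va t \<le> s\<^sup>2 + t * x * (2 * s) + t\<^sup>2 * x\<^sup>2"
      unfolding Va_def s(3) [symmetric] using y t x_bounds by (intro add_mono mult_left_mono) auto
    also have "\<dots> = (s + t * x)\<^sup>2" by (simp add: power2_eq_square algebra_simps)
    also have "\<dots> = ((s + t * x) ^ 4) powr (1/2)"
    proof -
      have "(s + t * x) ^ 4 = ((s + t * x)\<^sup>2)\<^sup>2" by simp
      then show ?thesis by (simp only: powr_half_sqrt zero_le_power2 real_sqrt_abs abs_power2)
    qed
    finally show "Va t \<le> ((s + t * (1 - s\<^sup>2)) ^ 4) powr (1/2)" using s by simp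
    show "0 \<le> (s + t * (1 - s\<^sup>2)) ^ 4" by simp
  qed (use m in \<open>auto intro!: continuous_intros\<close>)
  then show False using linear_power4_integral_less[of s] s by simp
qed

text \<open>The slopes of the integral lemmas come from \<open>y_le_affine\<close> at the threshold:
  \<open>39/20 = 6/5 + 5/6 * 9/10\<close> with \<open>w = 6/5\<close>, and
  \<open>15/8 = 5/4 + 4/5 * 25/32\<close> and \<open>7/4 = 5/4 + 4/5 * 5/8\<close> with
  \<open>w = 5/4\<close>. The exponents 3, 4, 5 are half the largest degree in each range.\<close>

lemma C_lower_bounds:
  shows "m \<le> 6 \<Longrightarrow> C > 9/10" "m \<le> 8 \<Longrightarrow> C > 25/32" "m
      \<le> 10 \<Longrightarrow> C > 5/8"
proof -
  show "C > 9/10" if "m \<le> 6"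
  proof (rule ccontr)
    assume "\<not> C > 9/10"
    moreover have "y \<le> 6/5 * (1 - x) + 5/6 * C" using y_le_affine[of "6/5"] by simp
    ultimately have "y \<le> 39/20 - 6/5 * x" by argo
    then have "1 \<le> integral {0..1} (\<lambda>t. (1 - x + t * (x * (39/20 - 6/5 * x))
        + t\<^sup>2 * x\<^sup>2) ^ 3)"
      using that by (intro integral_quadratic_power_ge_1) auto
    then show False using quadratic_power3_integral_less_1[OF x_bounds] by simp
  qed
  show "C > 25/32" if "m \<le> 8"
  proof (rule ccontr)
    assume "\<not> C > 25/32"
    moreover have "y \<le> 5/4 * (1 - x) + 4/5 * C" using y_le_affine[of "5/4"] by simp
    ultimately have "y \<le> 15/8 - 5/4 * x" by argo
    then have "1 \<le> integral {0..1} (\<lambda>t. (1 - x + t * (x * (15/8 - 5/4 * x))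
        + t\<^sup>2 * x\<^sup>2) ^ 4)"
      using that by (intro integral_quadratic_power_ge_1) auto
    then show False using quadratic_power4_integral_less_1[OF x_bounds] by simp
  qed
  show "C > 5/8" if "m \<le> 10"
  proof (rule ccontr)
    assume "\<not> C > 5/8"
    moreover have "y \<le> 5/4 * (1 - x) + 4/5 * C" using y_le_affine[of "5/4"] by simp
    ultimately have "y \<le> 7/4 - 5/4 * x" by argo
    then have "1 \<le> integral {0..1} (\<lambda>t. (1 - x + t * (x * (7/4 - 5/4 * x))
        + t\<^sup>2 * x\<^sup>2) ^ 5)"
      using that by (intro integral_quadratic_power_ge_1) auto
    then show False using quadratic_power5_integral_less_1[OF x_bounds] by simp
  qed
qed

lemma x_lower_bound_small: "x > 1 - C + R" if "m \<le> 10"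
proof (rule ccontr)
  assume "\<not> x > 1 - C + R"
  then have "y \<le> 2 - 2 * x" using R_eq by simp
  then have "1 \<le> integral {0..1} (\<lambda>t. (1 - x + t * (x * (2 - 2 * x))
      + t\<^sup>2 * x\<^sup>2) ^ 5)"
    using that by (intro integral_quadratic_power_ge_1) auto
  then show False using quadratic_power5_integral_less_1'[OF x_bounds] by simp
qed

lemma Va_le_chord:
  assumes "t \<in> {0..1}"
  shows "Va t \<le> (1 - x) + x * (t * (1 + C))" "Va t \<le> 1 + x * (t * (1 + (C - R)) - 1)"
proof -
  have yy: "y = 1 - x + (C - R)" using R_eq by simp
  have "t\<^sup>2 * x\<^sup>2
      \<le> t * x\<^sup>2" using assms by (intro mult_right_mono) (auto simp: power2_eq_square mult_left_le)
  then show 1: "Va t \<le> 1 + x * (t * (1 + (C - R)) - 1)"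
    unfolding Va_def yy by (simp add: algebra_simps power2_eq_square)
  have "x * (t * (1 + (C - R))) \<le> x * (t * (1 + C))"
    using assms x_bounds R_nonneg by (intro mult_left_mono) auto
  then show "Va t \<le> (1 - x) + x * (t * (1 + C))" using 1 by (simp add: right_diff_distrib)
qed

text \<open>The chord bounds \<open>Va\<close> by a combination of 1 and \<open>t * (1 + C)\<close>
  with weights \<open>1 - x\<close> and \<open>x\<close>. Convexity of the power acts on each part
  separately, and \<open>x\<close> cancels from the integrated inequality.\<close>

lemma C_lower_bound_large:
  assumes m: "m \<ge> 2"
  shows "(1 + C) powr (m / 2) \<ge> 1 + m / 2"
proof -
  let ?q = "m / 2"
  have q: "?q \<ge> 1" using m by simp
  have hi: "((\<lambda>t. (t * (1 + C)) powr ?q) has_integral (1 + C) powr ?q / (1 + ?q)) {0..1}"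
  proof -
    have "((\<lambda>t. t powr ?q * (1 + C) powr ?q) has_integral (1 powr (?q + 1) / (?q + 1)) * (1
        + C) powr ?q) {0..1}"
      using q by (intro has_integral_mult_left has_integral_powr_from_0) auto
    then show ?thesis
      by (rule has_integral_eq_rhs[OF has_integral_eq[rotated]]) (use C_nonneg in \<open>auto simp: powr_mult add.commute\<close>)
  qed
  have "1 \<le> integral {0..1} (\<lambda>t. Va t powr ?q)" by (rule one_le_integral_Va)
  also have "\<dots> \<le> integral {0..1} (\<lambda>t. (1 - x) + x * (t * (1 + C)) powr ?q)"
  proof (rule integral_le)
    fix t :: real assume t: "t \<in> {0..1}"
    have "Va t powr ?q \<le> ((1 - x) + x * (t * (1 + C))) powr ?q"
      using Va_le_chord(1)[OF t] Va_nonneg by (intro powr_mono2) auto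
    also have "\<dots> \<le> (1 - x) + x * (t * (1 + C)) powr ?q"
    proof (cases "t = 0")
      case True
      then show ?thesis using x_bounds q powr_mono'[of 1 ?q "1 - x"] by simp
    next
      case False
      then show ?thesis
        using powr_convex_comb3[of 1 "t * (1 + C)" 1 "1 - x" x 0 ?q] x_bounds t C_nonneg q by simp
    qed
    finally show "Va t powr ?q \<le> (1 - x) + x * (t * (1 + C)) powr ?q" .
  next
    show "(\<lambda>t. (1 - x) + x * (t * (1 + C)) powr ?q) integrable_on {0..1}"
      using hi by (intro integrable_add integrable_on_mult_right) (auto simp: has_integral_iff)
  qed (intro integrable_continuous_real cont_Va_powr)
  also have "\<dots> = (1 - x) + x * ((1 + C) powr ?q / (1 + ?q))"
  proof (rule integral_unique)
    have "((\<lambda>t::real. 1 - x) has_integral (1 - x)) {0..1}"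
      using has_integral_const_real[of "1 - x" 0 1] by simp
    then show "((\<lambda>t. (1 - x) + x * (t * (1 + C)) powr ?q) has_integral (1 - x) + x * ((1
        + C) powr ?q / (1 + ?q))) {0..1}"
      by (intro has_integral_add has_integral_mult_right hi)
  qed
  finally have "x * 1 \<le> x * ((1 + C) powr ?q / (1 + ?q))" by simp
  then have "1 \<le> (1 + C) powr ?q / (1 + ?q)" using x_bounds by (simp only: mult_le_cancel_left_pos)
  then show ?thesis using q by (simp add: pos_le_divide_eq)
qed

lemma mC_lower_bound:
  assumes m: "m \<ge> 11"
  shows "m * C \<ge> 22/5"
proof (rule ccontr)
  assume "\<not> m * C \<ge> 22/5"
  then have C: "C \<le> 22 / (5 * m)" using m by (simp add: field_simps)
  have "(1 + m / 2)\<^sup>2 \<le> ((1 + C) powr (m / 2))\<^sup>2"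
    using C_lower_bound_large m by (intro power_mono) auto
  also have "\<dots> = (1 + C) ^ m"
    using C_nonneg by (simp add: powr_powr flip: powr_realpow)
  also have "\<dots> \<le> (1 + 22 / (5 * m)) ^ m" using C C_nonneg by (intro power_mono) auto
  finally have le: "(1 + m / 2)\<^sup>2 \<le> (1 + 22 / (5 * m)) ^ m" .
  show False
  proof (cases "m \<ge> 17")
    case True
    have "(1 + 22 / (5 * m)) ^ m \<le> exp (22 / (5 * m)) ^ m"
      by (intro power_mono) auto
    also have "\<dots> = exp (22/5)" using m by (simp flip: exp_of_nat_mult)
    finally have "(1 + m / 2)\<^sup>2 \<le> exp (22/5)" using le by simp
    moreover have "(19/2)\<^sup>2 \<le> (1 + m / 2)\<^sup>2" using True by (intro power_mono) auto
    ultimately have "(19/2)\<^sup>2 \<le> exp (22/5 :: real)" by linarith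
    \<comment> \<open>The fifth power makes the exponent 22/5 an integer. Here
      \<open>exp (22/5)\<close> is about 81.5, just above \<open>(1 + 16/2)^2 = 81\<close>; this is
      why the exponential argument starts at \<open>m = 17\<close>.\<close>
    then have "((19/2)\<^sup>2) ^ 5 \<le> exp (22/5 :: real) ^ 5" by (rule power_mono) simp
    also have "\<dots> = exp 1 ^ 22" by (simp flip: exp_of_nat_mult)
    also have "\<dots> \<le> (272/100) ^ 22" using e_less_272 by (intro power_mono) auto
    finally show False by (simp add: power_divide)
  next
    case False
    then consider "m = 11" | "m = 12" | "m = 13" | "m = 14" | "m = 15" | "m = 16" using m by linarith
    then show False using le by cases (simp_all add: power_divide field_simps)
  qed
qed

text \<open>Bounding \<open>Va\<close> by an exponential makes the integral explicit and leaves an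
  inequality between \<open>X = m x / 2\<close> and \<open>C - R\<close>. The result is the
  hypothesis on \<open>x\<close> in \<open>reflected_bound\<close> with
  \<open>\<eta> = 6 / (m * C)\<close>.\<close>

lemma x_lower_bound_large:
  assumes m: "m \<ge> 2"
  shows "x * (m * C) > 6 * (1 - C + R)"
proof -
  define C' where "C' = C - R"
  define X where "X = m / 2 * x"
  have C': "0 < C'" using R_less_C by (simp add: C'_def)
  have X: "0 < X" using x_bounds m by (simp add: X_def)
  let ?c = "X * (1 + C')"
  have c: "?c > 0" using X C' by simp
  have "((\<lambda>t. exp (?c * t - X))
      has_integral (exp (?c * 1 - X) / ?c - exp (?c * 0 - X) / ?c)) {0..1}"
    using c by (intro fundamental_theorem_of_calculus)
      (auto intro!: derivative_eq_intros simp flip: has_real_derivative_iff_has_vector_derivative)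
  moreover have "?c * 1 - X = X * C'" by (simp add: algebra_simps)
  ultimately have hi: "((\<lambda>t. exp (?c * t - X)) has_integral (exp (X * C') - exp (- X)) / ?c) {0..1}"
    by (simp add: diff_divide_distrib)
  have "1 \<le> integral {0..1} (\<lambda>t. Va t powr (m / 2))" by (rule one_le_integral_Va)
  also have "\<dots> \<le> integral {0..1} (\<lambda>t. exp (?c * t - X))"
  proof (rule integral_le)
    fix t :: real assume t: "t \<in> {0..1}"
    let ?z = "x * (t * (1 + C') - 1)"
    have "Va t \<le> 1 + ?z" using Va_le_chord(2)[OF t] by (simp add: C'_def)
    then have "Va t \<le> exp ?z" using exp_ge_add_one_self by (rule order_trans)
    then have "Va t powr (m / 2) \<le> exp ?z powr (m / 2)"
      using Va_nonneg by (intro powr_mono2) auto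
    also have "\<dots> = exp (?c * t - X)" by (simp add: exp_powr_real X_def algebra_simps)
    finally show "Va t powr (m / 2) \<le> exp (?c * t - X)" .
  qed (auto intro!: integrable_continuous_real continuous_intros cont_Va_powr)
  also have "\<dots> = (exp (X * C') - exp (- X)) / ?c" using hi by (rule integral_unique)
  finally have "?c \<le> exp (X * C') - exp (- X)" using c by (simp add: pos_le_divide_eq)
  then have main: "exp (- X) + X \<le> exp (X * C') - X * C'" by (simp add: algebra_simps)
  \<comment> \<open>The map \<open>u - > exp u - u\<close> increases for \<open>u \<ge> 0\<close>,
    so \<open>main\<close> bounds \<open>X * C'\<close> below by the positive solution of
    \<open>exp u - u = exp (- X) + X\<close>. That solution expands as
    \<open>X - X^2 / 3 + ...\<close>, and \<open>3 * X / (3 + X)\<close> agrees with it to second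
    order.\<close>
  have "X * C' > 3 * X / (3 + X)"
  proof (rule ccontr)
    assume "\<not> X * C' > 3 * X / (3 + X)"
    then have le: "X * C' \<le> 3 * X / (3 + X)" (is "?a \<le> ?b") by simp
    have "exp ?a * (1 + (?b - ?a)) \<le> exp ?a * exp (?b - ?a)" by (intro mult_left_mono) auto
    also have "\<dots> = exp ?b" by (simp flip: exp_add)
    finally have "exp ?a * (1 + (?b - ?a)) \<le> exp ?b" .
    moreover have "1 * (?b - ?a) \<le> exp ?a * (?b - ?a)"
      using le X C' by (intro mult_right_mono) auto
    ultimately have "exp ?a - ?a \<le> exp ?b - ?b" by (simp add: algebra_simps)
    then show False using main exp_minus_id_less[OF X] by linarith
  qed
  then have "3 * X < X * C' * (3 + X)" using X by (simp add: pos_divide_less_eq)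
  then have "X * 3 < X * (C' * (3 + X))" by (simp add: mult_ac)
  then have "3 < C' * (3 + X)" using X by (simp only: mult_less_cancel_left_pos)
  then have "6 * (1 - C') < x * (m * C')" by (simp add: X_def algebra_simps)
  also have "\<dots>
      \<le> x * (m * C)" using x_bounds R_nonneg by (intro mult_left_mono) (auto simp: C'_def)
  finally show ?thesis by (simp add: C'_def)
qed

text \<open>With \<open>\<theta> = 1 - C\<close>, multiply both bounds for
  \<open>(m + 1) |q(b)|\<close> by \<open>C\<close>. The lower one is \<open>1 - \<theta>\<close>
  times the first two terms of \<open>est\<close>, the upper one is
  \<open>1 - \<theta> (1 - C (1 - \<eta>) m / (m + 2))\<close>; they are incompatible exactly under
  \<open>est\<close>.\<close>

lemma contradiction_criterion:
  assumes m: "m \<ge> 5" and \<eta>: "0 \<le> \<eta>" "\<eta> \<le> 1" and x: "x > \<eta> * (1 - C + R)"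
    and D: "D = 1 - sqrt (m * (1 - C) / (m - 1))"
    and est: "C < 1 \<Longrightarrow> (1 - C) ^ m + m * C * integral {0..1} (\<lambda>t. t * (1
        + t / (m - 1)) * (1 - t * D) ^ (m - 3))
      + C * (1 - \<eta>) * m / (m + 2) \<le> 1"
  shows False
proof -
  define I where "I = cmod (integral {0..1} (\<lambda>t. \<Prod>j<m. of_real (1 - t)
      + of_real t * (1 - cnj \<mu> * v j)))"
  have up: "(real m + 1) * I < 1 + (1 - \<eta>) * (1 - C) * m / (real m + 2)"
    unfolding I_def using m by (intro reflected_bound \<eta> x) auto
  define \<theta> where "\<theta> = 1 - C"
  have \<theta>: "0
      \<le> \<theta>" "\<theta> < 1" using C_le_1 R_less_C R_nonneg by (auto simp: \<theta>_def)
  have C: "C = 1 - \<theta>" "C > 0" using \<theta> by (auto simp: \<theta>_def)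
  have sum_g: "(\<Sum>j<m. 1 - cnj \<mu> * v j) = of_real (m * \<theta>)"
  proof -
    have "(\<Sum>j<m. 1 - cnj \<mu> * v j) = m - cnj \<mu> * (\<Sum>j<m. v j)"
      by (simp add: sum_subtractf sum_distrib_left)
    also have "\<dots> = m - m * (\<mu> * cnj \<mu>)" by (simp add: sum_v)
    also have "\<mu> * cnj \<mu> = of_real C" unfolding C_def by (rule complex_norm_square [symmetric])
    finally show ?thesis by (simp add: \<theta>_def algebra_simps)
  qed
  have sum_sq: "(\<Sum>j<m. (cmod (1 - cnj \<mu> * v j))\<^sup>2) \<le> m * \<theta>"
  proof -
    have "(\<Sum>j<m. (cmod (1 + of_real 1 * (- cnj \<mu>) * v j))\<^sup>2) / m
        \<le> (cmod 1)\<^sup>2 + 2 * 1 * Re (cnj 1 * (- cnj \<mu>) * ((\<Sum>j<m. v j) / m)) + 1\<^sup>2 * (cmod (- cnj \<mu>))\<^sup>2"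
      by (rule mean_square_affine[OF m_pos mean_square])
    also have "\<dots> = \<theta>"
      unfolding \<mu>_def [symmetric] \<theta>_def C_def cmod_power2 by (simp add: power2_eq_square)
    finally show ?thesis using m_pos by (simp add: pos_divide_le_eq mult.commute)
  qed
  show False
  proof (cases "\<theta> = 0")
    \<comment> \<open>The lower bound for products needs \<open>\<theta> > 0\<close>. For
      \<open>\<theta> = 0\<close> all factors are \<open>1 - t\<close>, and
      \<open>(m + 1) * I = 1\<close> contradicts the strict upper bound.\<close>
    case True
    then have "(\<Sum>j<m. (cmod (1 - cnj \<mu> * v j))\<^sup>2) \<le> 0" using sum_sq by simp
    then have "(\<Sum>j<m. (cmod (1 - cnj \<mu> * v j))\<^sup>2) = 0" by (simp add: sum_nonneg antisym)
    then have "1 - cnj \<mu> * v j = 0" if "j < m" for j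
      using that by (subst (asm) sum_nonneg_eq_0_iff) auto
    then have "(\<lambda>t. \<Prod>j<m. of_real (1 - t) + of_real t * (1 - cnj \<mu> * v j))
        = (\<lambda>t. complex_of_real ((1 - t) ^ m))"
      by (intro ext) simp
    moreover have "((\<lambda>t. (1 - t) ^ m) has_integral (1 / (real m + 1))) {0..1}"
    proof -
      have d: "((\<lambda>s::real. - ((1 - s) ^ Suc m / Suc m)) has_real_derivative (1 - s) ^ m) (at s within {0..1})" for s
        by (rule derivative_eq_intros refl | simp del: power_Suc)+
      have "((\<lambda>s::real. (1 - s) ^ m)
          has_integral (- ((1 - 1) ^ Suc m / Suc m) - - ((1 - 0) ^ Suc m / Suc m))) {0..1}"
        by (rule fundamental_theorem_of_calculus)
          (use d in \<open>simp_all add: has_real_derivative_iff_has_vector_derivative del: power_Suc\<close>)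
      then show ?thesis by (simp add: add.commute)
    qed
    then have "((\<lambda>t. complex_of_real ((1 - t) ^ m)) has_integral of_real (1 / (real m + 1))) {0..1}"
      by (rule has_integral_of_real)
    ultimately have "I = cmod (of_real (1 / (real m + 1)))" unfolding I_def by (metis integral_unique)
    then have "(real m + 1) * I = 1" by (simp only: norm_of_real) simp
    then show False using up True by (simp add: \<theta>_def)
  next
    case False
    then have \<theta>': "0 < \<theta>" using \<theta> by simp
    define J where "J = integral {0..1} (\<lambda>t. t * (1 + t / (m - 1)) * (1 - t * D) ^ (m - 3))"
    have "1 - \<theta> ^ (m + 1) - m * \<theta> * (1 - \<theta>) * J \<le> (m + 1) * (1 - \<theta>) * I"
      unfolding I_def J_def
      by (rule product_mean_lower_bound[OF _ \<theta>' \<theta>(2) sum_g sum_sq]) (use m D in \<open>auto simp: \<theta>_def\<close>)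
    then have low: "1 - \<theta> * (\<theta> ^ m + m * C * J) \<le> C * ((real m + 1) * I)"
      by (simp add: C algebra_simps)
    have "\<theta> ^ m + m * C * J + C * (1 - \<eta>) * m / (real m + 2) \<le> 1"
      using est \<theta>' unfolding J_def \<theta>_def by (simp add: add.commute)
    then have "\<theta> ^ m + m * C * J \<le> 1 - C * (1 - \<eta>) * m / (real m + 2)" by linarith
    then have "\<theta> * (\<theta> ^ m + m * C * J)
        \<le> \<theta> * (1 - C * (1 - \<eta>) * m / (real m + 2))"
      using \<theta>' by (intro mult_left_mono) auto
    then have "1 - \<theta> * (1 - C * (1 - \<eta>) * m / (real m + 2)) \<le> C * ((real m + 1) * I)"
      using low by linarith
    also have "\<dots> < C * (1 + (1 - \<eta>) * (1 - C) * m / (real m + 2))"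
      using up C(2) by (intro mult_strict_left_mono) auto
    also have "\<dots> = 1 - \<theta> * (1 - C * (1 - \<eta>) * m / (real m + 2))"
      by (simp add: \<theta>_def algebra_simps)
    finally show False by simp
  qed
qed

lemma no_configuration: False
proof -
  define D where "D = 1 - sqrt (m * (1 - C) / (m - 1))"
  let ?J = "integral {0..1} (\<lambda>t. t * (1 + t / (m - 1)) * (1 - t * D) ^ (m - 3))"
  have m5: "m \<ge> 5" using degree_gt_4 by simp
  show False
  proof (cases "m \<le> 8")
    case True
    show False
    proof (rule contradiction_criterion[OF m5, of 1 D])
      have "1 - C \<le> (if m \<le> 6 then 1/10 else 7/32)" using C_lower_bounds(1,2) True by auto
      then show "(1 - C) ^ m + m * C * ?J + C * (1 - 1) * m / (m + 2) \<le> 1"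
        using weight_integral_small[OF m5 True, of "1 - C" D] C_le_1 by (simp add: D_def)
    qed (use x_lower_bound_small True in \<open>auto simp: D_def\<close>)
  next
    case False
    define k where "k = m * C"
    have m9: "m \<ge> 9" using False by simp
    have k: "22/5 \<le> k" "k \<le> m" "m \<le> 10 \<Longrightarrow> k \<ge> 5/8 * m"
    proof -
      show k3: "k \<ge> 5/8 * m" if "m \<le> 10"
        using mult_left_mono[of "5/8" C "real m"] C_lower_bounds(3)[OF that] by (simp add: k_def)
      show "22/5 \<le> k"
      proof (cases "m \<le> 10")
        case True
        then show ?thesis using k3 m9 by simp
      qed (use mC_lower_bound in \<open>simp add: k_def\<close>)
      show "k \<le> m" using C_le_1 by (simp add: k_def mult_left_le)
    qed
    \<comment> \<open>Up to \<open>m = 10\<close> the full bound on \<open>x\<close> is known;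
      beyond that \<open>x_lower_bound_large\<close> supplies the fraction \<open>6 / k\<close>, cut
      off at 1.\<close>
    define \<eta> where "\<eta> = (if m \<le> 10 then 1 else min 1 (6 / k))"
    have \<eta>: "0 \<le> \<eta>" "\<eta> \<le> 1" using k by (auto simp: \<eta>_def)
    have x: "x > \<eta> * (1 - C + R)"
    proof (cases "m \<le> 10")
      case True
      then show ?thesis using x_lower_bound_small by (simp add: \<eta>_def)
    next
      case False
      have "6 / k * (1 - C + R) < x"
        using x_lower_bound_large m9 k by (simp add: k_def field_simps)
      moreover have "\<eta> * (1 - C + R) \<le> 6 / k * (1 - C + R)"
        using False C_le_1 R_nonneg by (intro mult_right_mono) (auto simp: \<eta>_def)
      ultimately show ?thesis by linarith
    qed
    define v where "v = (m - 3) * D - 1 / (m - 1)"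
    have mk: "m * (1 - C) = m - k" by (simp add: k_def algebra_simps)
    have v: "(117 * k - 171) / 250 \<le> v"
      unfolding v_def by (rule decay_rate_lower_bound[OF m9 k]) (simp_all add: D_def mk)
    have D1: "D \<le> 1" using C_le_1 m9 by (simp add: D_def)
    have J: "?J \<le> integral {0..1} (\<lambda>t. t * exp (- (v * t)))"
      unfolding v_def by (rule weight_integral_le_exp) (use m9 D1 in auto)
    have est: "(1 - k / m) ^ m + k * integral {0..1} (\<lambda>t. t * exp (- (v * t)))
        + (k * (1 - \<eta>)) / (m + 2) \<le> 1"
    proof (rule large_degree_estimate[OF m9 k(1,2)])
      fix w assume "0 < w" "w \<le> (117 * k - 171) / 250"
      then show "integral {0..1} (\<lambda>t. t * exp (- (v * t))) \<le> 1 / (2 + 4/3 * w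
          + 7/18 * w\<^sup>2) \<and>
          integral {0..1} (\<lambda>t. t * exp (- (v * t))) \<le> 1 / w\<^sup>2"
        using integral_times_exp_le[of w v] v by auto
    next
      show "k * (1 - \<eta>) = 0 \<or> m \<ge> 11 \<and> k * (1 - \<eta>) = max 0 (k - 6)"
        using k by (auto simp: \<eta>_def min_def max_def field_simps)
    qed
    show False
    proof (rule contradiction_criterion[OF m5 \<eta> x, of D])
      have "m * C * ?J \<le> k * integral {0..1} (\<lambda>t. t * exp (- (v * t)))"
        using J k by (simp add: k_def mult_left_mono)
      moreover have "1 - C = 1 - k / m" using m9 by (simp add: k_def)
      moreover have "C * (1 - \<eta>) * m / (m + 2) = (k * (1 - \<eta>)) / (m
          + 2)" by (simp add: k_def mult_ac)
      ultimately show "(1 - C) ^ m + m * C * ?J + C * (1 - \<eta>) * m / (m + 2) \<le> 1"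
        using est by simp
    qed (simp add: D_def)
  qed
qed

end

section \<open>Zeros and critical points\<close>

lemma norm_diff_le_norm_one_minus_mult_cnj:
  assumes "cmod b \<le> 1" "cmod z \<le> 1"
  shows "cmod (b - z) \<le> cmod (1 - z * cnj b)"
proof (rule power2_le_imp_le)
  have "0 \<le> (1 - (cmod b)\<^sup>2) * (1 - (cmod z)\<^sup>2)"
    using assms by (intro mult_nonneg_nonneg) (auto intro: power_le_one)
  also have "\<dots> = (cmod (1 - z * cnj b))\<^sup>2 - (cmod (b - z))\<^sup>2"
    unfolding cmod_power2 by (simp add: power2_eq_square algebra_simps)
  finally show "(cmod (b - z))\<^sup>2 \<le> (cmod (1 - z * cnj b))\<^sup>2" by simp
qed simp

text \<open>A root \<open>z\<close> contributes \<open>b - z\<close> on the left and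
  \<open>1 - z * cnj b\<close> on the right, because \<open>reflect_poly\<close> reverses the
  coefficients without conjugating them. The right-hand side is \<open>|b|^m |q(1 / cnj b)|\<close>
  for \<open>b \<noteq> 0\<close> and the modulus of the leading coefficient for
  \<open>b = 0\<close>.\<close>

lemma norm_poly_le_norm_reflect_poly:
  fixes q :: "complex poly"
  assumes roots: "\<forall>z. poly q z = 0 \<longrightarrow> cmod z \<le> 1" and b: "cmod b \<le> 1"
  shows "cmod (poly q b) \<le> cmod (poly (reflect_poly q) (cnj b))"
proof (cases "q = 0")
  case False
  have le: "cmod (poly (\<Prod>x\<in>#A. [:- x, 1:]) b)
      \<le> cmod (poly (reflect_poly (\<Prod>x\<in>#A. [:- x, 1:])) (cnj b))"
    if "\<forall>x\<in>#A. cmod x \<le> 1" for A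
    using that
  proof (induction A)
    case (add z A)
    have "reflect_poly [:- z, 1:] = [:1, - z:]" by (simp add: reflect_poly_def)
    then have "cmod (poly [:- z, 1:] b) \<le> cmod (poly (reflect_poly [:- z, 1:]) (cnj b))"
      using norm_diff_le_norm_one_minus_mult_cnj[OF b, of z] add by (simp add: mult.commute)
    then show ?case
      using add by (simp only: image_mset_add_mset prod_mset.add_mset reflect_poly_mult poly_mult norm_mult)
        (auto intro!: mult_mono)
  qed simp
  have q: "q = smult (lead_coeff q) (\<Prod>x\<in>#proots q. [:- x, 1:])"
    by (simp add: complex_poly_decompose_multiset)
  have "\<forall>x\<in>#proots q. cmod x \<le> 1" using roots False by (simp add: set_count_proots)
  from mult_left_mono[OF le[OF this], of "cmod (lead_coeff q)"] show ?thesis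
    by (subst (1 2) q) (simp add: reflect_poly_smult norm_mult del: complex_poly_decompose_multiset)
qed simp

lemma poly_eq_integral_pderiv:
  fixes p :: "complex poly"
  assumes "poly p a = 0"
  shows "poly p z = (z - a) * integral {0..1} (\<lambda>t. poly (pderiv p) (a + of_real t * (z - a)))"
proof -
  let ?g = "\<lambda>t. poly (pderiv p) (a + of_real t * (z - a))"
  have "((\<lambda>t. (z - a) * ?g t) has_integral poly p (a + of_real 1 * (z - a)) - poly p (a
      + of_real 0 * (z - a))) {0..1}"
  proof (rule fundamental_theorem_of_calculus)
    fix t :: real
    have "((\<lambda>w. poly p (a + w * (z - a))) has_field_derivative (z - a) * ?g t) (at (of_real t))"
      by (rule derivative_eq_intros poly_DERIV[THEN DERIV_chain2] refl | simp)+
    then show "((\<lambda>t. poly p (a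
        + of_real t * (z - a))) has_vector_derivative (z - a) * ?g t) (at t within {0..1})"
      by (rule has_vector_derivative_real_field)
  qed simp
  from integral_unique[OF this] show ?thesis using assms by simp
qed

lemma pderiv_linear_mult: "pderiv ([:- z, 1:] * q) = q + [:- z, 1:] * pderiv q"
  for q :: "complex poly"
  unfolding pderiv_mult by (simp add: pderiv_pCons)

lemma poly_pderiv_eq_mult_sum_roots:
  fixes q :: "complex poly"
  assumes "poly q a \<noteq> 0"
  shows "poly (pderiv q) a = poly q a * (\<Sum>x\<in>#proots q. 1 / (a - x))"
proof -
  have prod: "poly (pderiv (\<Prod>x\<in>#A. [:- x, 1:])) a
      = poly (\<Prod>x\<in>#A. [:- x, 1:]) a * (\<Sum>x\<in>#A. 1 / (a - x))" if "a \<notin># A" for A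
    using that
  proof (induction A)
    case (add z A)
    let ?P = "\<Prod>x\<in>#A. [:- x, 1:]" and ?s = "\<Sum>x\<in>#A. 1 / (a - x)"
    have IH: "poly (pderiv ?P) a = poly ?P a * ?s" using add by simp
    have "poly (pderiv (\<Prod>x\<in>#add_mset z A. [:- x, 1:])) a = poly ?P a
        + (a - z) * poly (pderiv ?P) a"
      unfolding image_mset_add_mset prod_mset.add_mset pderiv_linear_mult by (simp add: algebra_simps)
    also have "\<dots> = (a - z) * poly ?P a * (1 / (a - z) + ?s)"
      unfolding IH using add.prems by (simp add: distrib_left)
    finally show ?case by (simp add: algebra_simps)
  qed simp
  have q: "q = smult (lead_coeff q) (\<Prod>x\<in>#proots q. [:- x, 1:])"
    by (simp add: complex_poly_decompose_multiset)
  have "q \<noteq> 0" using assms by auto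
  then have "a \<notin># proots q" using assms by simp
  from prod[OF this] show ?thesis
    by (subst (1 2) q) (simp add: pderiv_smult del: complex_poly_decompose_multiset)
qed

lemma lead_coeff_pderiv:
  fixes p :: "complex poly"
  assumes "degree p > 0"
  shows "lead_coeff (pderiv p) = of_nat (degree p) * lead_coeff p"
  using assms by (simp add: degree_pderiv coeff_pderiv)

lemma sum_norm_reciprocals_gt:
  fixes p :: "complex poly" and \<zeta> :: "nat \<Rightarrow> complex"
  assumes m: "m > 0" and deg: "degree p = Suc m" and a: "poly p a = 0" "cmod a < 1"
    and roots: "\<forall>z. poly p z = 0 \<longrightarrow> cmod z \<le> 1"
    and dp: "pderiv p
        = smult c (\<Prod>j<m. [:- \<zeta> j, 1:])" and ne: "\<And>j. j < m \<Longrightarrow> \<zeta> j \<noteq> a"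
  shows "m < (\<Sum>j<m. (cmod (1 / (a - \<zeta> j)))\<^sup>2)"
proof (rule ccontr)
  define v where "v = (\<lambda>j. 1 / (a - \<zeta> j))"
  assume "\<not> ?thesis"
  then have mean_square: "(\<Sum>j<m. (cmod (v j))\<^sup>2) \<le> m" by (simp add: v_def)
  \<comment> \<open>This is \<open>p'(a)\<close>. The quotient \<open>q\<close> below is not
    normalised, so \<open>d\<close> appears as a common factor on both sides of the inequality and
    cancels at the end.\<close>
  define d where "d = c * (\<Prod>j<m. a - \<zeta> j)"
  have "pderiv p \<noteq> 0" using deg by (auto simp: pderiv_eq_0_iff)
  then have c0: "c \<noteq> 0" using dp by auto
  have d0: "d \<noteq> 0" using c0 ne by (auto simp: d_def)
  have c: "c = d * (\<Prod>j<m. v j)"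
  proof -
    have "(\<Prod>j<m. a - \<zeta> j) * (\<Prod>j<m. v j) = (\<Prod>j<m. 1)"
      unfolding prod.distrib [symmetric] by (rule prod.cong) (use ne in \<open>auto simp: v_def\<close>)
    then show ?thesis by (simp add: d_def mult.assoc)
  qed
  have dp_eq: "poly (pderiv p) (a + w) = d * (\<Prod>j<m. 1 + w * v j)" for w
  proof -
    have "a + w - \<zeta> j = (a - \<zeta> j) * (1 + w * v j)" if "j < m" for j
      using ne[OF that] by (simp add: v_def field_simps)
    then have "(\<Prod>j<m. a + w - \<zeta> j) = (\<Prod>j<m. a - \<zeta> j) * (\<Prod>j<m. 1 + w * v j)"
      unfolding prod.distrib [symmetric] by (intro prod.cong) auto
    moreover have "poly (pderiv p) (a + w) = c * (\<Prod>j<m. a + w - \<zeta> j)"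
      by (simp add: dp poly_prod algebra_simps)
    ultimately show ?thesis by (simp add: d_def mult.assoc)
  qed
  obtain q where q: "p = [:- a, 1:] * q" using a(1) by (auto simp: poly_eq_0_iff_dvd elim: dvdE)
  have q0: "q \<noteq> 0" using deg q by auto
  have degq: "degree q = m"
  proof -
    have "degree p = degree [:- a, 1:] + degree q" unfolding q using q0 by (intro degree_mult_eq) auto
    then show ?thesis using deg by simp
  qed
  have q_eq: "poly q z = d * integral {0..1} (\<lambda>t. \<Prod>j<m. 1 + of_real t * (z - a) * v j)" for z
  proof (cases "z = a")
    case True
    have "poly q a = poly (pderiv p) (a + 0)" unfolding q pderiv_linear_mult by simp
    then show ?thesis unfolding dp_eq True by simp
  next
    case False
    have "(z - a) * poly q z = poly p z" by (simp add: q algebra_simps)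
    also have "\<dots> = (z - a) * (d * integral {0..1} (\<lambda>t. \<Prod>j<m. 1
        + of_real t * (z - a) * v j))"
      unfolding poly_eq_integral_pderiv[OF a(1)] dp_eq by simp
    finally show ?thesis using False by simp
  qed
  have rootsq: "\<forall>z. poly q z = 0 \<longrightarrow> cmod z \<le> 1" using roots by (simp add: q)
  interpret reciprocal_configuration a v m
  proof
    fix b :: complex assume b: "cmod b \<le> 1"
    let ?I = "integral {0..1} (\<lambda>t. \<Prod>j<m. 1 + of_real t * (b - a) * v j)"
    let ?J = "integral {0..1} (\<lambda>t. \<Prod>j<m. cmod (cnj b + of_real t * (1 - a * cnj b) * v j))"
    have "cmod (poly (reflect_poly q) (cnj b)) \<le> cmod d * ?J"
    proof (cases "b = 0")
      case True
      \<comment> \<open>At \<open>b = 0\<close> the reflected polynomial is the leading coefficient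
        of \<open>q\<close>; comparing with that of \<open>p'\<close> gives the factor
        \<open>m + 1\<close>, which matches the integral of \<open>t ^ m\<close>.\<close>
      have "lead_coeff p = lead_coeff q" unfolding q lead_coeff_mult by simp
      moreover have "lead_coeff (pderiv p) = (of_nat m + 1) * lead_coeff p"
        by (simp add: lead_coeff_pderiv deg add.commute)
      moreover have "lead_coeff (pderiv p) = c" unfolding dp lead_coeff_smult lead_coeff_prod by simp
      ultimately have lc: "(of_nat m + 1) * lead_coeff q = c" by simp
      have "(real m + 1) * cmod (lead_coeff q) = cmod ((of_nat m + 1) * lead_coeff q)"
        by (metis norm_mult norm_of_nat of_nat_Suc add.commute)
      then have lc': "(real m + 1) * cmod (lead_coeff q) = cmod d * (\<Prod>j<m. cmod (v j))"
        unfolding lc c by (simp add: norm_mult prod_norm)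
      moreover have "integral {0..1} (\<lambda>t. \<Prod>j<m. cmod (of_real t * v j))
          = (\<Prod>j<m. cmod (v j)) / (real m + 1)"
      proof -
        have "integral {0..1} (\<lambda>t. \<Prod>j<m. cmod (of_real t * v j))
            = integral {0..1} (\<lambda>t. t ^ m * (\<Prod>j<m. cmod (v j)))"
          by (rule integral_cong) (simp add: norm_mult prod.distrib)
        then show ?thesis by (simp add: has_integral_power_unit[THEN integral_unique])
      qed
      moreover have "cmod (lead_coeff q) = cmod d * (\<Prod>j<m. cmod (v j)) / (real m + 1)"
        using lc' by (simp add: field_simps)
      ultimately show ?thesis using True by simp
    next
      case False
      have cn: "cnj b \<noteq> 0" using False by simp
      have "poly (reflect_poly q) (cnj b) = cnj b ^ m * poly q (inverse (cnj b))"
        using poly_reflect_poly_nz[OF cn, of q] degq by simp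
      also have "\<dots> = d * integral {0..1} (\<lambda>t. cnj b ^ m * (\<Prod>j<m. 1
          + of_real t * (inverse (cnj b) - a) * v j))"
        unfolding q_eq by simp
      also have "(\<lambda>t. cnj b ^ m * (\<Prod>j<m. 1 + of_real t * (inverse (cnj b) - a) * v j))
          = (\<lambda>t. \<Prod>j<m. cnj b + of_real t * (1 - a * cnj b) * v j)"
      proof
        fix t :: real
        have "cnj b ^ m * (\<Prod>j<m. 1 + of_real t * (inverse (cnj b) - a) * v j)
            = (\<Prod>j<m. cnj b * (1 + of_real t * (inverse (cnj b) - a) * v j))"
          by (simp add: prod.distrib)
        also have "\<dots> = (\<Prod>j<m. cnj b + of_real t * (1 - a * cnj b) * v j)"
          using cn by (intro prod.cong) (simp_all add: field_simps)
        finally show "cnj b ^ m * (\<Prod>j<m. 1 + of_real t * (inverse (cnj b) - a) * v j)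
            = (\<Prod>j<m. cnj b + of_real t * (1 - a * cnj b) * v j)" .
      qed
      finally have "poly (reflect_poly q) (cnj b)
          = d * integral {0..1} (\<lambda>t. \<Prod>j<m. cnj b + of_real t * (1 - a * cnj b) * v j)" .
      moreover have "cmod (integral {0..1} (\<lambda>t. \<Prod>j<m. cnj b
          + of_real t * (1 - a * cnj b) * v j)) \<le> ?J"
        by (rule integral_norm_bound_integral)
          (auto intro!: integrable_continuous_real continuous_intros simp: prod_norm)
      ultimately show ?thesis by (simp add: norm_mult mult_left_mono)
    qed
    with norm_poly_le_norm_reflect_poly[OF rootsq b] have "cmod (poly q b) \<le> cmod d * ?J"
      by (rule order_trans)
    then have "cmod d * cmod ?I \<le> cmod d * ?J" by (simp only: q_eq norm_mult)
    then show "cmod ?I \<le> ?J" using d0 by simp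
  qed (use m a mean_square in auto)
  show False by (rule no_configuration)
qed

section \<open>Zeros on the unit circle and the equality case\<close>

lemma Re_divide_diff_ge_half:
  assumes "cmod a = 1" "cmod z \<le> 1" "z \<noteq> a"
  shows "1 / 2 \<le> Re (a / (a - z))"
proof -
  have pos: "0 < (cmod (a - z))\<^sup>2" using assms by simp
  have "(cmod z)\<^sup>2 \<le> (cmod a)\<^sup>2" using assms by (intro power_mono) auto
  then have "(cmod (a - z))\<^sup>2 \<le> 2 * Re (a * cnj (a - z))"
    unfolding cmod_power2 by (simp add: power2_eq_square algebra_simps)
  then have "1 / 2 \<le> Re (a * cnj (a - z)) / (cmod (a - z))\<^sup>2" using pos by (simp add: field_simps)
  also have "\<dots> = Re (a / (a - z))" by (simp add: complex_div_cnj[of a "a - z"])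
  finally show ?thesis .
qed

lemma size_proots_pderiv:
  fixes p :: "complex poly"
  assumes "degree p = n"
  shows "size (proots (pderiv p)) = n - 1"
  using assms by (simp add: size_proots_complex degree_pderiv)

lemma sum_mset_ge_size:
  fixes r :: real
  assumes "\<And>x. x \<in># A \<Longrightarrow> r \<le> f x"
  shows "r * size A \<le> (\<Sum>x\<in>#A. f x :: real)"
  using assms by (induction A) (auto simp: algebra_simps add_mono)

lemma sum_mset_nonneg_eq_0:
  assumes "\<And>x. x \<in># A \<Longrightarrow> 0 \<le> (f x :: real)" "(\<Sum>x\<in>#A. f x)
      \<le> 0" "x \<in># A"
  shows "f x = 0"
proof -
  obtain B where B: "A = add_mset x B" using assms(3) by (metis insert_DiffM)
  have "(0::real) * size B \<le> (\<Sum>x\<in>#B. f x)" using assms(1) B by (intro sum_mset_ge_size) auto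
  then show ?thesis using assms B by fastforce
qed

lemma critical_points_eq_0:
  fixes p :: "complex poly"
  assumes deg: "degree p = n" and n: "n \<ge> 2" and a: "poly p a = 0" "cmod a = 1"
    and roots: "\<forall>z. poly p z = 0 \<longrightarrow> cmod z
        \<le> 1" and crit: "a \<notin># proots (pderiv p)"
  defines "S \<equiv> \<Sum>x\<in>#proots (pderiv p). (cmod (1 / (a - x)))\<^sup>2"
  shows "real (n - 1) \<le> S" and "S
      \<le> real (n - 1) \<Longrightarrow> \<forall>x\<in>#proots (pderiv p). x = 0"
proof -
  let ?Z = "proots (pderiv p)"
  have "pderiv p \<noteq> 0" using deg n by (auto simp: pderiv_eq_0_iff)
  then have dp0: "poly (pderiv p) a \<noteq> 0" using crit by (simp add: set_count_proots)
  obtain q where q: "p = [:- a, 1:] * q" using a(1) by (auto simp: poly_eq_0_iff_dvd elim: dvdE)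
  have q0: "q \<noteq> 0" using deg n q by auto
  have degq: "degree q = n - 1"
  proof -
    have "degree p = degree [:- a, 1:] + degree q" unfolding q using q0 by (intro degree_mult_eq) auto
    then show ?thesis using deg by simp
  qed
  have dq: "poly (pderiv p) a = poly q a" "poly (pderiv (pderiv p)) a = 2 * poly (pderiv q) a"
    unfolding q pderiv_linear_mult pderiv_add by simp_all
  have "poly q a * (\<Sum>x\<in>#?Z. 1 / (a - x)) = poly q a * (2 * (\<Sum>x\<in>#proots q. 1 / (a - x)))"
    using poly_pderiv_eq_mult_sum_roots[OF dp0] poly_pderiv_eq_mult_sum_roots[of q a] dp0 dq by simp
  then have "(\<Sum>x\<in>#?Z. 1 / (a - x)) = 2 * (\<Sum>x\<in>#proots q. 1 / (a - x))" using dp0 dq by simp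
  then have "a * (\<Sum>x\<in>#?Z. 1 / (a - x)) = 2 * (a * (\<Sum>x\<in>#proots q. 1 / (a - x)))" by simp
  moreover have "Re (a * (\<Sum>x\<in>#A. 1 / (a - x))) = (\<Sum>x\<in>#A. Re (a / (a - x)))" for A
    by (induction A) (auto simp: algebra_simps)
  moreover have "Re (2 * w) = 2 * Re w" for w by simp
  ultimately have eq: "(\<Sum>x\<in>#?Z. Re (a / (a - x))) = 2 * (\<Sum>x\<in>#proots q. Re (a / (a - x)))"
    by (metis (no_types))
  have "1 / 2 * size (proots q) \<le> (\<Sum>x\<in>#proots q. Re (a / (a - x)))"
  proof (rule sum_mset_ge_size)
    fix x assume "x \<in># proots q"
    then have "poly q x = 0" using q0 by (simp add: set_count_proots)
    then show "1 / 2 \<le> Re (a / (a - x))"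
      using dp0 dq roots by (intro Re_divide_diff_ge_half a) (auto simp: q)
  qed
  then have Re_ge: "real (n - 1) \<le> (\<Sum>x\<in>#?Z. Re (a / (a - x)))"
    unfolding eq using degq by (simp add: size_proots_complex)
  have sq: "(cmod (1 - a / (a - x)))\<^sup>2 = (cmod (1 / (a - x)))\<^sup>2 - 2 * Re (a / (a - x))
      + 1" for x
  proof -
    have "(cmod (1 - a / (a - x)))\<^sup>2 = 1 - 2 * Re (a / (a - x)) + (cmod (a / (a - x)))\<^sup>2"
      unfolding cmod_power2 by (simp add: power2_eq_square algebra_simps)
    also have "cmod (a / (a - x)) = cmod (1 / (a - x))" using a by (simp add: norm_divide)
    finally show ?thesis by simp
  qed
  have "(\<Sum>x\<in>#A. (cmod (1 - a / (a - x)))\<^sup>2)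
      = (\<Sum>x\<in>#A. (cmod (1 / (a - x)))\<^sup>2) - 2 * (\<Sum>x\<in>#A. Re (a / (a - x))) + size A" for A
    by (induction A) (auto simp: sq)
  \<comment> \<open>The sum of the real parts enters with factor -2 and is at least
    \<open>n - 1\<close>, while the constant terms contribute \<open>n - 1\<close> once, so
    \<open>n - 1\<close> is lost altogether. A vanishing summand means
    \<open>a / (a - x) = 1\<close>, that is \<open>x = 0\<close>.\<close>
  from this[of ?Z] have S: "(\<Sum>x\<in>#?Z. (cmod (1 - a / (a - x)))\<^sup>2) \<le> S - real (n - 1)"
    using Re_ge by (simp add: S_def size_proots_pderiv[OF deg])
  have "(0::real) * size ?Z
      \<le> (\<Sum>x\<in>#?Z. (cmod (1 - a / (a - x)))\<^sup>2)" by (rule sum_mset_ge_size) simp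
  then show "real (n - 1) \<le> S" using S by simp
  show "\<forall>x\<in>#?Z. x = 0" if "S \<le> real (n - 1)"
  proof
    fix x assume x: "x \<in># ?Z"
    have "(cmod (1 - a / (a - x)))\<^sup>2 = 0"
      by (rule sum_mset_nonneg_eq_0[of ?Z _ x]) (use x that S in auto)
    moreover have "a \<noteq> x" using x crit by auto
    ultimately show "x = 0" by (simp add: field_simps)
  qed
qed

lemma poly_eq_of_critical_points_0:
  fixes p :: "complex poly"
  assumes deg: "degree p = n" and n: "n \<ge> 2"
    and crit: "\<forall>x\<in>#proots (pderiv p). x = 0"
  shows "\<exists>d. \<forall>z. poly p z = lead_coeff p * z ^ n + d"
proof -
  let ?c = "lead_coeff p"
  have "proots (pderiv p) = replicate_mset (n - 1) 0"
    by (metis crit set_mset_subset_singletonD size_proots_pderiv[OF deg] singletonI subsetI)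
  then have "pderiv p = smult (lead_coeff (pderiv p)) ([:- 0, 1:] ^ (n - 1))"
    using complex_poly_decompose_multiset[of "pderiv p"] by simp
  also have "\<dots> = pderiv (monom ?c n)"
    by (use n in \<open>simp add: lead_coeff_pderiv deg pderiv_monom smult_monom flip: monom_altdef\<close>)
  finally have "pderiv (p - monom ?c n) = 0" by (simp add: pderiv_diff)
  then have "degree (p - monom ?c n) = 0" by (simp add: pderiv_eq_0_iff)
  then obtain d where "p - monom ?c n = [:d:]" by (rule degree_eq_zeroE)
  then have "p = monom ?c n + [:d:]" by (simp add: algebra_simps)
  then have "poly p z = ?c * z ^ n + d" for z by (metis poly_add poly_monom poly_const_conv)
  then show ?thesis by blast
qed

lemma critical_points_of_power_minus:
  fixes p :: "complex poly"
  assumes p: "\<And>z. poly p z = c * (z ^ n - \<omega>)" and n: "n \<ge> 2" and c: "c \<noteq> 0"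
    and x: "x \<in># proots (pderiv p)"
  shows "x = 0"
proof -
  have "poly p = poly (monom c n + [:- (c * \<omega>):])"
    by (rule ext) (simp add: p poly_monom algebra_simps)
  then have "p = monom c n + [:- (c * \<omega>):]" by (simp only: poly_eq_poly_eq_iff)
  then have dp: "pderiv p = monom (of_nat n * c) (n - 1)"
    by (simp add: pderiv_add pderiv_monom pderiv_pCons)
  then have "pderiv p \<noteq> 0" using c n by simp
  then have "poly (pderiv p) x = 0" using x by simp
  then have "of_nat n * c * x ^ (n - 1) = 0" by (simp add: dp poly_monom)
  then show "x = 0" using c n by simp
qed

text \<open>Away from critical points the two divisions agree. At a critical point the real summand
  would be 0 instead of infinity, so that case has to be treated on its own.\<close>

lemma recip_dist_sq_sum_eq_ennreal:
  assumes "a \<notin># proots (pderiv p)"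
  shows "recip_dist_sq_sum p a = ennreal (\<Sum>x\<in>#proots (pderiv p). (cmod (1 / (a - x)))\<^sup>2)"
proof -
  have "(\<Sum>x\<in>#A. 1 / ennreal ((cmod (a - x))\<^sup>2))
      = ennreal (\<Sum>x\<in>#A. (cmod (1 / (a - x)))\<^sup>2)"
    if "a \<notin># A" for A
    using that
  proof (induction A)
    case (add z A)
    then have pos: "0 < (cmod (a - z))\<^sup>2" by auto
    have "1 / ennreal ((cmod (a - z))\<^sup>2) = ennreal 1 / ennreal ((cmod (a - z))\<^sup>2)" by simp
    also have "\<dots> = ennreal ((cmod (1 / (a - z)))\<^sup>2)"
      using pos by (subst divide_ennreal) (auto simp: norm_divide power_divide)
    finally have "1 / ennreal ((cmod (a - z))\<^sup>2) = ennreal ((cmod (1 / (a - z)))\<^sup>2)" .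
    moreover have "(0::real) * size A
        \<le> (\<Sum>x\<in>#A. (cmod (1 / (a - x)))\<^sup>2)" by (rule sum_mset_ge_size) simp
    ultimately show ?case using add by (simp add: ennreal_plus del: ennreal_plus[symmetric])
  qed simp
  then show ?thesis unfolding recip_dist_sq_sum_def using assms .
qed

lemma sum_norm_reciprocals_critical_points_gt:
  fixes p :: "complex poly"
  assumes deg: "degree p = n" and n: "n \<ge> 2" and a: "poly p a = 0" "cmod a < 1"
    and roots: "\<forall>z. poly p z = 0 \<longrightarrow> cmod z
        \<le> 1" and crit: "a \<notin># proots (pderiv p)"
  shows "real (n - 1) < (\<Sum>x\<in>#proots (pderiv p). (cmod (1 / (a - x)))\<^sup>2)"
proof -
  obtain xs where xs: "mset xs = proots (pderiv p)" using ex_mset by blast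
  have len: "length xs = n - 1" using xs size_proots_pderiv[OF deg] by (metis size_mset)
  have "pderiv p = smult (lead_coeff (pderiv p)) (\<Prod>x\<in>#mset xs. [:- x, 1:])"
    unfolding xs by (rule complex_poly_decompose_multiset [symmetric])
  also have "(\<Prod>x\<in>#mset xs. [:- x, 1:]) = (\<Prod>j<n - 1. [:- (xs ! j), 1:])"
    by (simp add: prod_mset_prod_list prod.list_conv_set_nth len atLeast0LessThan flip: mset_map)
  finally have "real (n - 1) < (\<Sum>j<n - 1. (cmod (1 / (a - xs ! j)))\<^sup>2)"
  proof (rule sum_norm_reciprocals_gt[rotated 5])
    fix j assume "j < n - 1"
    then have "xs ! j \<in># proots (pderiv p)" using len xs by (metis nth_mem set_mset_mset)
    then show "xs ! j \<noteq> a" using crit by auto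
  qed (use deg n a roots in auto)
  also have "\<dots> = (\<Sum>x\<in>#mset xs. (cmod (1 / (a - x)))\<^sup>2)"
    by (simp add: sum_mset_sum_list sum_list_sum_nth len atLeast0LessThan flip: mset_map)
  finally show ?thesis unfolding xs .
qed

theorem theorem1p3:
  fixes p :: "complex poly" and n :: nat and a :: complex
  assumes "degree p = n" and "n \<ge> 2"
    and "\<And>z. poly p z = 0 \<Longrightarrow> cmod z \<le> 1"
    and "poly p a = 0"
  shows "recip_dist_sq_sum p a \<ge> of_nat (n - 1) \<and>
    (recip_dist_sq_sum p a = of_nat (n - 1) \<longleftrightarrow>
      (\<exists>c \<omega>. c \<noteq> 0 \<and> cmod \<omega> = 1 \<and> (\<forall>z. poly p z = c * (z ^ n - \<omega>))))"
proof -
  let ?Z = "proots (pderiv p)"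
  let ?S = "\<Sum>x\<in>#?Z. (cmod (1 / (a - x)))\<^sup>2"
  let ?extremal = "\<exists>c \<omega>. c \<noteq> 0 \<and> cmod \<omega>
      = 1 \<and> (\<forall>z. poly p z = c * (z ^ n - \<omega>))"
  have roots: "\<forall>z. poly p z = 0 \<longrightarrow> cmod z \<le> 1" using assms(3) by blast
  have extremal: "a \<notin># ?Z \<and> ?S = real (n - 1)" if ?extremal
  proof -
    from that obtain c \<omega> where c: "c \<noteq> 0" and \<omega>: "cmod \<omega> = 1"
      and p: "\<And>z. poly p z = c * (z ^ n - \<omega>)" by blast
    have "a ^ n = \<omega>" using p[of a] assms c by simp
    then have "cmod a ^ n = 1" using \<omega> by (simp flip: norm_power)
    from power_eq_1_iff[OF this] have a1: "cmod a = 1" using assms(2) by simp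
    have Z0: "x = 0" if "x \<in># ?Z" for x by (rule critical_points_of_power_minus[OF p assms(2) c that])
    have "a \<notin># ?Z" using Z0 a1 by fastforce
    moreover have "(cmod (1 / (a - x)))\<^sup>2 = 1" if "x \<in># ?Z" for x
      using Z0[OF that] a1 by (simp add: norm_divide)
    then have "?S = (\<Sum>x\<in>#?Z. 1)"
      by (intro arg_cong[where f = sum_mset] image_mset_cong)
    ultimately show ?thesis using size_proots_pderiv[OF assms(1)] by simp
  qed
  show ?thesis
  proof (cases "a \<in># ?Z")
    case True
    \<comment> \<open>The sum is infinite, so equality fails; the extremal form fails as well, since
      its only critical point is 0 while it would force \<open>cmod a = 1\<close>.\<close>
    then show ?thesis using extremal by (auto simp: recip_dist_sq_sum_eq_top)
  next
    case False
    have le: "real (n - 1) \<le> ?S" and ex: "?S \<le> real (n - 1) \<Longrightarrow> ?extremal"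
    proof -
      have "real (n - 1) \<le> ?S \<and> (?S \<le> real (n - 1) \<longrightarrow> ?extremal)"
      proof (cases "cmod a = 1")
        case True
        note crit = critical_points_eq_0[OF assms(1,2,4) True roots False]
        have ?extremal if S: "?S \<le> real (n - 1)"
        proof -
          from poly_eq_of_critical_points_0[OF assms(1,2) crit(2)[OF S]]
          obtain d where p: "\<And>z. poly p z = lead_coeff p * z ^ n + d" by blast
          have lc: "lead_coeff p \<noteq> 0" using assms(1,2) by auto
          have "d = - lead_coeff p * a ^ n" using p[of a] assms(4) by (simp add: add_eq_0_iff)
          then have "\<forall>z. poly p z
              = lead_coeff p * (z ^ n - a ^ n)" using p by (simp add: algebra_simps)
          then show ?thesis using lc True by (intro exI[of _ "lead_coeff p"] exI[of _ "a ^ n"]) (simp add: norm_power)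
        qed
        then show ?thesis using crit(1) by blast
      next
        case a: False
        then have "cmod a < 1" using assms(3)[OF assms(4)] by simp
        from sum_norm_reciprocals_critical_points_gt[OF assms(1,2,4) this roots False]
        show ?thesis by simp
      qed
      then show "real (n - 1) \<le> ?S" "?S \<le> real (n - 1) \<Longrightarrow> ?extremal" by blast+
    qed
    have "0 \<le> ?S" using le by simp
    then have "recip_dist_sq_sum p a = of_nat (n - 1) \<longleftrightarrow> ?S = real (n - 1)"
      unfolding recip_dist_sq_sum_eq_ennreal[OF False] ennreal_of_nat_eq_real_of_nat by simp
    moreover have "recip_dist_sq_sum p a \<ge> of_nat (n - 1)"
      unfolding recip_dist_sq_sum_eq_ennreal[OF False] ennreal_of_nat_eq_real_of_nat
      using le by (rule ennreal_leI)
    ultimately show ?thesis using ex extremal by auto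
  qed
qed

end
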